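(* Let $k\geq3$ be an integer, and for each $n\geq1$ let $\mathcal{U}_{n,k}=UT_k(\mathcal{R}_n)$ be the group of upper unitriangular $k\times k$ matrices over the ring $\mathcal{R}_n=(\mathcal{P}(\omega^n)/I_{\omega^n},\triangle,\cap,\mathbf{1})$; these are $\omega^n$-automatic groups. (1) In ZFC + CH, the groups $\mathcal{U}_{n,k}$, $n\geq1$, are pairwise isomorphic. (2) In ZFC + AT, the groups $\mathcal{U}_{n,k}$, $n\geq1$, are pairwise non-isomorphic.
   Context: $I_{\omega^n}=\{P\subseteq\omega^n\mid \mathrm{o.t.}(P)<\omega^n\}$ ($\mathrm{o.t.}$ = order type as a suborder of $(\omega^n,<)$); $\mathcal{R}_n$ is the quotient of $\mathcal{P}(\omega^n)$ by $A\approx B\iff A\triangle B\in I_{\omega^n}$, with addition $\triangle$, multiplication $\cap$, unit $[\omega^n]$. $UT_k(R)$ is the group under matrix multiplication of upper triangular matrices with all diagonal entries equal to $1$. CH is the continuum hypothesis. AT is Just's axiom: for every ${\bf\Sigma}^1_1$-ideal $I$ of subsets of $\omega$ (subsets identified with points of $2^\omega$), every $H:\mathcal{P}(\omega)\to\mathcal{P}(\omega)$ preserving intersections modulo $I$ (i.e. $H(X)\triangle H(Y)\in I$ whenever $X\triangle Y$ is finite, and $H(X\cap Y)\triangle(H(X)\cap H(Y))\in I$), and every uncountable family $\mathcal{A}$ of pairwise almost disjoint infinite subsets of $\omega$, there exist $A\in\mathcal{A}$ and a finite decomposition $A=\bigcup_{i<m}A_i$ with continuous $F_i:\mathcal{P}(A_i)\to\mathcal{P}(\omega)$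 such that $F_i(X)\triangle H(X)\in I$ for all $X\subseteq A_i$. A structure is $\omega^n$-automatic if it has a presentation (domain a regular $\omega^n$-language modulo an equivalence relation, relations and graphs of operations regular $\omega^n$-languages over product alphabets) by ordinal Büchi automata reading words of length $\omega^n$. *)

theory Defs
  imports "HOL-Analysis.Function_Topology" "HOL-Analysis.Product_Topology"
    "HOL-Algebra.Group" "HOL-Algebra.Ring"
begin

unbundle cardinal_syntax

text \<open>The ordinal \<open>\<omega>\<^sup>n\<close> is realised on the lists of naturals of length \<open>n\<close>, ordered
  lexicographically with the head most significant: the list \<open>[a\<^sub>1, \<dots>, a\<^sub>n]\<close> stands for
  \<open>\<omega>\<^bsup>n-1\<^esup>\<cdot>a\<^sub>1 + \<dots> + \<omega>\<cdot>a\<^bsub>n-1\<^esub> + a\<^sub>n\<close>.\<close>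

definition omega_pow :: "nat \<Rightarrow> nat list set" where
  "omega_pow n = {xs. length xs = n}"

definition omega_le :: "nat \<Rightarrow> nat list rel" where
  "omega_le n = Id_on (omega_pow n) \<union> lexn less_than n"

lemma Field_omega_le [simp]: "Field (omega_le n) = omega_pow n"
  by (auto simp: omega_le_def omega_pow_def Field_def Id_on_def dest: lexn_length)

lemma Well_order_omega_le: "Well_order (omega_le n)"
proof -
  have irr: "(xs, xs) \<notin> lexn less_than n" for xs
    using wf_lexn[OF wf_less_than, of n] by auto
  have tr: "trans (lexn less_than n)"
    by (rule lexn_transI) simp
  have "wf (omega_le n - Id)"
    by (rule wf_subset[OF wf_lexn[OF wf_less_than, of n]]) (auto simp: omega_le_def)
  moreover have "refl_on (omega_pow n) (omega_le n)"
    by (auto simp: refl_on_def omega_le_def omega_pow_def)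
  moreover have "trans (omega_le n)"
    using tr unfolding omega_le_def trans_def Id_on_def by blast
  moreover have "antisym (omega_le n)"
    using tr irr unfolding omega_le_def trans_def antisym_def Id_on_def by blast
  moreover have "total_on (omega_pow n) (omega_le n)"
    unfolding total_on_def
  proof (intro ballI impI)
    fix xs ys assume "xs \<in> omega_pow n" "ys \<in> omega_pow n" "xs \<noteq> ys"
    then have len: "length xs = n" "length ys = n" by (auto simp: omega_pow_def)
    have "total less_than" by (auto simp: total_on_def)
    then have "total (lenlex less_than)" by (rule total_lenlex)
    then have "(xs, ys) \<in> lenlex less_than \<or> (ys, xs) \<in> lenlex less_than"
      using \<open>xs \<noteq> ys\<close> by (auto simp: total_on_def)
    then have "(xs, ys) \<in> lex less_than \<or> (ys, xs) \<in> lex less_than"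
      using len by (auto simp: lenlex_conv)
    then obtain m where "(xs, ys) \<in> lexn less_than m \<or> (ys, xs) \<in> lexn less_than m"
      by (auto simp: lex_def)
    with len have "(xs, ys) \<in> lexn less_than n \<or> (ys, xs) \<in> lexn less_than n"
      by (metis lexn_length)
    then show "(xs, ys) \<in> omega_le n \<or> (ys, xs) \<in> omega_le n"
      by (auto simp: omega_le_def)
  qed
  moreover have "omega_le n \<subseteq> omega_pow n \<times> omega_pow n"
    by (auto simp: omega_le_def omega_pow_def Id_on_def dest: lexn_length)
  ultimately show ?thesis
    by (simp add: well_order_on_def linear_order_on_def partial_order_on_def preorder_on_def)
qed

definition omega_ideal :: "nat \<Rightarrow> nat list set set" where
  "omega_ideal n = {P. P \<subseteq> omega_pow n \<and> Restr (omega_le n) P <o omega_le n}"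

definition omega_approx :: "nat \<Rightarrow> nat list set rel" where
  "omega_approx n =
     {(A, B). A \<subseteq> omega_pow n \<and> B \<subseteq> omega_pow n \<and> sym_diff A B \<in> omega_ideal n}"

definition omega_ring :: "nat \<Rightarrow> nat list set set ring" where
  "omega_ring n =
     \<lparr>carrier = Pow (omega_pow n) // omega_approx n,
      monoid.mult = (\<lambda>X Y. \<Union>A\<in>X. \<Union>B\<in>Y. omega_approx n `` {A \<inter> B}),
      one = omega_approx n `` {omega_pow n},
      zero = omega_approx n `` {{}},
      add = (\<lambda>X Y. \<Union>A\<in>X. \<Union>B\<in>Y. omega_approx n `` {sym_diff A B})\<rparr>"

definition UT :: "nat \<Rightarrow> ('a, 'm) ring_scheme \<Rightarrow> (nat \<times> nat \<Rightarrow> 'a) monoid" where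
  "UT k R =
     \<lparr>carrier = {A \<in> ({..<k} \<times> {..<k}) \<rightarrow>\<^sub>E carrier R.
                   (\<forall>i<k. A (i, i) = \<one>\<^bsub>R\<^esub>) \<and> (\<forall>i<k. \<forall>j<i. A (i, j) = \<zero>\<^bsub>R\<^esub>)},
      monoid.mult = (\<lambda>A B. \<lambda>(i, j)\<in>{..<k} \<times> {..<k}.
                   \<Oplus>\<^bsub>R\<^esub>l\<in>{..<k}. A (i, l) \<otimes>\<^bsub>R\<^esub> B (l, j)),
      one = (\<lambda>(i, j)\<in>{..<k} \<times> {..<k}. if i = j then \<one>\<^bsub>R\<^esub> else \<zero>\<^bsub>R\<^esub>)\<rparr>"

definition U_group :: "nat \<Rightarrow> nat \<Rightarrow> (nat \<times> nat \<Rightarrow> nat list set set) monoid" where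
  "U_group n k = UT k (omega_ring n)"

record ('q, 'a) ordinal_buchi =
  states :: "'q set"
  alphabet :: "'a set"
  initial :: 'q
  trans_succ :: "('q \<times> 'a \<times> 'q) set"
  trans_lim :: "('q set \<times> 'q) set"
  accepting :: "'q set"

definition wf_ordinal_buchi :: "('q, 'a) ordinal_buchi \<Rightarrow> bool" where
  "wf_ordinal_buchi \<A> \<longleftrightarrow>
     finite (states \<A>) \<and> finite (alphabet \<A>) \<and> initial \<A> \<in> states \<A> \<and>
     trans_succ \<A> \<subseteq> states \<A> \<times> alphabet \<A> \<times> states \<A> \<and>
     trans_lim \<A> \<subseteq> Pow (states \<A>) \<times> states \<A> \<and> accepting \<A> \<subseteq> states \<A>"

text \<open>A word whose length is the order type \<open>\<alpha>\<close> of a well-order \<open>r\<close> is a function on the field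
  of \<open>r\<close>.  A run on it is indexed by \<open>\<alpha> + 1\<close>, which is realised by adding \<open>None\<close> on top
  of \<open>r\<close>.\<close>

definition add_top :: "'p rel \<Rightarrow> 'p option rel" where
  "add_top r = {(Some i, Some j) |i j. (i, j) \<in> r} \<union> insert None (Some ` Field r) \<times> {None}"

definition is_zero_pos :: "'p rel \<Rightarrow> 'p \<Rightarrow> bool" where
  "is_zero_pos r p \<longleftrightarrow> p \<in> Field r \<and> (\<forall>q\<in>Field r. (p, q) \<in> r)"

definition is_succ_pos :: "'p rel \<Rightarrow> 'p \<Rightarrow> 'p \<Rightarrow> bool" where
  "is_succ_pos r p q \<longleftrightarrow>
     (p, q) \<in> r \<and> p \<noteq> q \<and> (\<forall>z. (p, z) \<in> r \<and> (z, q) \<in> r \<longrightarrow> z = p \<or> z = q)"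

definition is_lim_pos :: "'p rel \<Rightarrow> 'p \<Rightarrow> bool" where
  "is_lim_pos r p \<longleftrightarrow> p \<in> Field r \<and> \<not> is_zero_pos r p \<and> \<not> (\<exists>q. is_succ_pos r q p)"

definition cofinal_states :: "'p rel \<Rightarrow> ('p \<Rightarrow> 'q) \<Rightarrow> 'p \<Rightarrow> 'q set" where
  "cofinal_states r x p =
     {s. \<forall>a. (a, p) \<in> r \<and> a \<noteq> p \<longrightarrow> (\<exists>b. (a, b) \<in> r \<and> (b, p) \<in> r \<and> b \<noteq> p \<and> x b = s)}"

definition is_run ::
    "'p rel \<Rightarrow> ('q, 'a) ordinal_buchi \<Rightarrow> ('p \<Rightarrow> 'a) \<Rightarrow> ('p option \<Rightarrow> 'q) \<Rightarrow> bool" where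
  "is_run r \<A> w x \<longleftrightarrow>
     (\<forall>p. is_zero_pos (add_top r) p \<longrightarrow> x p = initial \<A>) \<and>
     (\<forall>i\<in>Field r. \<forall>p. is_succ_pos (add_top r) (Some i) p \<longrightarrow>
        (x (Some i), w i, x p) \<in> trans_succ \<A>) \<and>
     (\<forall>p. is_lim_pos (add_top r) p \<longrightarrow>
        (cofinal_states (add_top r) x p, x p) \<in> trans_lim \<A>)"

definition buchi_language :: "'p rel \<Rightarrow> ('q, 'a) ordinal_buchi \<Rightarrow> ('p \<Rightarrow> 'a) set" where
  "buchi_language r \<A> =
     {w \<in> Field r \<rightarrow>\<^sub>E alphabet \<A>. \<exists>x. is_run r \<A> w x \<and> x None \<in> accepting \<A>}"

text \<open>State sets are finite, so taking states in \<open>nat\<close> is no restriction; the same applies to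
  the alphabet of a presentation below.\<close>

definition regular_omega_lang :: "nat \<Rightarrow> 'a set \<Rightarrow> (nat list \<Rightarrow> 'a) set \<Rightarrow> bool" where
  "regular_omega_lang n \<Sigma> L \<longleftrightarrow>
     (\<exists>\<A> :: (nat, 'a) ordinal_buchi.
        wf_ordinal_buchi \<A> \<and> alphabet \<A> = \<Sigma> \<and> buchi_language (omega_le n) \<A> = L)"

text \<open>A letter of the \<open>m\<close>-fold product alphabet is a list of length \<open>m\<close>; an \<open>m\<close>-tuple of words
  is identified with the word of the \<open>m\<close>-tuples of letters.\<close>

definition product_alphabet :: "'a set \<Rightarrow> nat \<Rightarrow> 'a list set" where
  "product_alphabet \<Sigma> m = {as. length as = m \<and> set as \<subseteq> \<Sigma>}"

definition convolution :: "nat \<Rightarrow> (nat list \<Rightarrow> 'a) list \<Rightarrow> nat list \<Rightarrow> 'a list" where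
  "convolution n ws = (\<lambda>p\<in>omega_pow n. map (\<lambda>w. w p) ws)"

text \<open>A relational structure is a domain together with a list of relations, each given by its
  arity and a set of tuples (lists) of that length.\<close>

definition omega_automatic :: "nat \<Rightarrow> 'm set \<Rightarrow> (nat \<times> 'm list set) list \<Rightarrow> bool" where
  "omega_automatic n M rels \<longleftrightarrow>
     (\<exists>(\<Sigma> :: nat set) L h.
        finite \<Sigma> \<and> regular_omega_lang n \<Sigma> L \<and> h ` L = M \<and>
        regular_omega_lang n (product_alphabet \<Sigma> 2)
          {convolution n [u, v] |u v. u \<in> L \<and> v \<in> L \<and> h u = h v} \<and>
        (\<forall>(m, R)\<in>set rels.
           regular_omega_lang n (product_alphabet \<Sigma> m)
             {convolution n us |us. length us = m \<and> set us \<subseteq> L \<and> map h us \<in> R}))"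

definition omega_automatic_group :: "nat \<Rightarrow> 'a monoid \<Rightarrow> bool" where
  "omega_automatic_group n G \<longleftrightarrow>
     group G \<and>
     omega_automatic n (carrier G)
       [(3, {[x, y, x \<otimes>\<^bsub>G\<^esub> y] |x y. x \<in> carrier G \<and> y \<in> carrier G}),
        (2, {[x, inv\<^bsub>G\<^esub> x] |x. x \<in> carrier G}),
        (1, {[\<one>\<^bsub>G\<^esub>]})]"

definition CH :: bool where
  "CH \<longleftrightarrow> |UNIV :: nat set set| =o cardSuc natLeq"

definition cantor_topology :: "nat set topology" where
  "cantor_topology =
     pullback_topology UNIV (\<lambda>X i. i \<in> X)
       (product_topology (\<lambda>i. discrete_topology (UNIV :: bool set)) UNIV)"

definition baire_topology :: "(nat \<Rightarrow> nat) topology" where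
  "baire_topology = product_topology (\<lambda>i. discrete_topology UNIV) UNIV"

definition Sigma11 :: "nat set set \<Rightarrow> bool" where
  "Sigma11 S \<longleftrightarrow> (\<exists>C. closedin (prod_topology cantor_topology baire_topology) C \<and> S = fst ` C)"

definition set_ideal :: "nat set set \<Rightarrow> bool" where
  "set_ideal I \<longleftrightarrow> {} \<in> I \<and> (\<forall>X\<in>I. \<forall>Y. Y \<subseteq> X \<longrightarrow> Y \<in> I) \<and> (\<forall>X\<in>I. \<forall>Y\<in>I. X \<union> Y \<in> I)"

definition preserves_inter_mod :: "nat set set \<Rightarrow> (nat set \<Rightarrow> nat set) \<Rightarrow> bool" where
  "preserves_inter_mod I H \<longleftrightarrow>
     (\<forall>X Y. finite (sym_diff X Y) \<longrightarrow> sym_diff (H X) (H Y) \<in> I) \<and>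
     (\<forall>X Y. sym_diff (H (X \<inter> Y)) (H X \<inter> H Y) \<in> I)"

definition almost_disjoint_family :: "nat set set \<Rightarrow> bool" where
  "almost_disjoint_family \<A> \<longleftrightarrow>
     (\<forall>A\<in>\<A>. infinite A) \<and> (\<forall>A\<in>\<A>. \<forall>B\<in>\<A>. A \<noteq> B \<longrightarrow> finite (A \<inter> B))"

definition AT :: bool where
  "AT \<longleftrightarrow>
     (\<forall>I H \<A>. set_ideal I \<and> Sigma11 I \<and> preserves_inter_mod I H \<and>
        almost_disjoint_family \<A> \<and> uncountable \<A> \<longrightarrow>
        (\<exists>A\<in>\<A>. \<exists>(m :: nat) (D :: nat \<Rightarrow> nat set) (F :: nat \<Rightarrow> nat set \<Rightarrow> nat set).
           A = (\<Union>i<m. D i) \<and>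
           (\<forall>i<m. continuous_map (subtopology cantor_topology (Pow (D i))) cantor_topology (F i) \<and>
                  (\<forall>X. X \<subseteq> D i \<longrightarrow> sym_diff (F i X) (H X) \<in> I))))"

end

theory Submission
  imports Defs "HOL-Library.Nat_Bijection" "HOL-Library.Z2" "HOL-Library.Countable_Set_Type"
begin

text \<open>Write \<open>I\<^sub>n\<close> for the ideal of sets of order type below \<open>\<omega>\<^sup>n\<close>; then \<open>I\<^bsub>n+1\<^esub> = Fin \<otimes> I\<^sub>n\<close>.
  The group \<open>UT\<^sub>k(R\<^sub>n)\<close> is the power of the finite group \<open>UT\<^sub>k(F\<^sub>2)\<close> with exponent \<open>\<omega>\<^sup>n\<close>, modulo \<open>I\<^sub>n\<close>, so a
  presentation only needs an automaton testing whether the set of bad positions lies in \<open>I\<^sub>n\<close>; an automaton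
  whose limit transition is \<open>lim sup + 2\<close> does this.

  Under CH, the algebras \<open>P(\<omega>\<^sup>n)/I\<^sub>n\<close> are atomless, countably saturated (because \<open>I\<^sub>n\<close> is of the form
  \<open>Fin \<otimes> J\<close>) and of size \<open>\<aleph>\<^sub>1\<close>, so a back-and-forth argument of length \<open>\<omega>\<^sub>1\<close> makes them isomorphic.

  The centre of \<open>UT\<^sub>k(R\<^sub>n)\<close> is a copy of \<open>R\<^sub>n\<close>, and the sets of commutators \<open>[g, h]\<close>, \<open>h\<close> arbitrary, for a fixed \<open>g\<close>
  of the second centre are exactly its principal ideals. Hence a group isomorphism induces an
  isomorphism of the Boolean algebras. Under AT applied to an almost disjoint family of sets outside
  \<open>I\<^sub>n\<close>, an isomorphism from \<open>P(\<omega>\<^sup>n)/I\<^sub>n\<close> to \<open>P(\<omega>\<^sup>m)/I\<^sub>m\<close> would reduce \<open>I\<^sub>n\<close> continuously to \<open>I\<^sub>m\<close>. For \<open>m < n\<close> this is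
  impossible: all \<open>I\<^sub>N\<close> would reduce to \<open>I\<^sub>m\<close>, but every set of finite Borel rank reduces to some \<open>I\<^sub>N\<close>, in
  particular a set diagonalising against the reductions to \<open>I\<^sub>m\<close>.\<close>

section \<open>The ideal of sets of small order type\<close>

text \<open>The predicate \<open>null\<close> replaces order types throughout. It looks only at
  lists of length \<open>n\<close>, so arbitrary sets of lists can act as representatives and
  complements need no side conditions. The bridge to order types is that a non-null set contains an
  increasing copy of \<omega>^n which also reflects nullity. The same copy answers the main weakness
  of AT, which gives a continuous lifting only on unspecified pieces of a single set: one piece is
  non-null, and a reduction can be moved into the copy inside it. Exact Borel ranks are avoided. It
  is enough that finitely many countable operations stay within finite levels of reducibility; a
  collapse of two levels would then make one level closed under complements, which a diagonal set
  contradicts. On the group side, the commutators of an arbitrary element are hard to control. For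
  an element of the second centre each position offers at most two commutators, the identity and the
  corner transvection, so choosing partners position by position produces exactly the subsets of a
  set. A noncentral element of this kind needs \<open>k \<ge> 3\<close>, since the group is abelian
  for smaller \<open>k\<close>.\<close>

abbreviation slice :: "nat list set \<Rightarrow> nat \<Rightarrow> nat list set" where
  "slice P a \<equiv> {xs. a # xs \<in> P}"

fun null :: "nat \<Rightarrow> nat list set \<Rightarrow> bool" where
  "null 0 P \<longleftrightarrow> [] \<notin> P"
| "null (Suc n) P \<longleftrightarrow> finite {a. \<not> null n (slice P a)}"

lemma null_mono: "null n Q \<Longrightarrow> P \<subseteq> Q \<Longrightarrow> null n P"
proof (induction n arbitrary: P Q)
  case (Suc n)
  have "{a. \<not> null n (slice P a)} \<subseteq> {a. \<not> null n (slice Q a)}"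
    using Suc.prems(2) by (auto intro: Suc.IH[of "slice Q _"])
  with Suc.prems(1) show ?case by (simp add: finite_subset)
qed auto

lemma null_empty [simp]: "null n {}"
  by (induction n) auto

lemma null_Un [simp]: "null n (P \<union> Q) \<longleftrightarrow> null n P \<and> null n Q"
proof
  show "null n (P \<union> Q)" if "null n P \<and> null n Q"
    using that
  proof (induction n arbitrary: P Q)
    case (Suc n)
    have "{a. \<not> null n (slice (P \<union> Q) a)} \<subseteq> {a. \<not> null n (slice P a)} \<union> {a. \<not> null n (slice Q a)}"
      using Suc.IH[of "slice P _" "slice Q _"] by (auto simp: Collect_disj_eq)
    with Suc.prems show ?case by (simp add: finite_subset)
  qed auto
qed (auto intro: null_mono)

lemma null_UN: "finite A \<Longrightarrow> null n (\<Union>a\<in>A. P a) \<longleftrightarrow> (\<forall>a\<in>A. null n (P a))"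
  by (induction A rule: finite_induct) auto

lemma null_Int_omega_pow: "null n (P \<inter> omega_pow n) \<longleftrightarrow> null n P"
proof (induction n arbitrary: P)
  case (Suc n)
  have "slice (P \<inter> omega_pow (Suc n)) a = slice P a \<inter> omega_pow n" for a
    by (auto simp: omega_pow_def)
  with Suc show ?case by simp
qed (auto simp: omega_pow_def)

lemma not_null_omega_pow: "\<not> null n (omega_pow n)"
proof (induction n)
  case (Suc n)
  have "slice (omega_pow (Suc n)) a = omega_pow n" for a
    by (auto simp: omega_pow_def)
  with Suc show ?case by simp
qed (auto simp: omega_pow_def)

lemma null_finite:
  assumes "finite P" "n \<ge> 1"
  shows "null n P"
proof -
  obtain m where n: "n = Suc m" using assms(2) by (cases n) auto
  have "{a. \<not> null m (slice P a)} \<subseteq> hd ` P"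
  proof
    fix a assume "a \<in> {a. \<not> null m (slice P a)}"
    then have "slice P a \<noteq> {}" by (metis mem_Collect_eq null_empty)
    then show "a \<in> hd ` P" by force
  qed
  with assms(1) show ?thesis by (simp add: n finite_subset)
qed

text \<open>Unfolding the recursion, \<open>y []\<close> bounds the heads of the non-null slices and
  \<open>y (a # xs)\<close> carries the bounds for slice \<open>a\<close>. The result is one
  existential quantifier over functions in front of conditions that each consult finitely many
  values of \<open>y\<close>; this is what makes the ideal analytic.\<close>

lemma null_witness:
  "null n P \<longleftrightarrow> (\<exists>y. \<forall>p\<in>P. length p = n \<longrightarrow> (\<exists>j<n. p ! j < y (take j p)))"
proof (induction n arbitrary: P)
  case (Suc n)
  show ?case
  proof
    assume "null (Suc n) P"
    then obtain N where N: "\<And>a. a \<ge> N \<Longrightarrow> null n (slice P a)"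
      by (auto simp: finite_nat_set_iff_bounded linorder_not_le[symmetric])
    then have "\<forall>a. \<exists>y. a \<ge> N \<longrightarrow> (\<forall>p\<in>slice P a. length p = n \<longrightarrow> (\<exists>j<n. p ! j < y (take j p)))"
      using Suc.IH by blast
    then obtain y where y: "\<And>a. a \<ge> N \<Longrightarrow>
        \<forall>p\<in>slice P a. length p = n \<longrightarrow> (\<exists>j<n. p ! j < y a (take j p))"
      by metis
    define y' where "y' xs = (case xs of [] \<Rightarrow> N | a # as \<Rightarrow> y a as)" for xs
    have "\<exists>j<Suc n. p ! j < y' (take j p)" if p: "p \<in> P" "length p = Suc n" for p
    proof -
      obtain a as where as: "p = a # as" using p(2) by (cases p) auto
      show ?thesis
      proof (cases "a < N")
        case True
        then show ?thesis by (intro exI[of _ 0]) (auto simp: as y'_def)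
      next
        case False
        then obtain j where "j < n" "as ! j < y a (take j as)"
          using y[of a] p as by auto
        then show ?thesis by (intro exI[of _ "Suc j"]) (auto simp: as y'_def)
      qed
    qed
    then show "\<exists>y. \<forall>p\<in>P. length p = Suc n \<longrightarrow> (\<exists>j<Suc n. p ! j < y (take j p))" by blast
  next
    assume "\<exists>y. \<forall>p\<in>P. length p = Suc n \<longrightarrow> (\<exists>j<Suc n. p ! j < y (take j p))"
    then obtain y where y: "\<And>p. p \<in> P \<Longrightarrow> length p = Suc n \<Longrightarrow> \<exists>j<Suc n. p ! j < y (take j p)"
      by blast
    have "null n (slice P a)" if a: "a \<ge> y []" for a
    proof -
      have "\<exists>j<n. p ! j < y (a # take j p)" if p: "p \<in> slice P a" "length p = n" for p
      proof -
        obtain j where j: "j < Suc n" "(a # p) ! j < y (take j (a # p))"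
          using y[of "a # p"] p by auto
        with a obtain i where "j = Suc i" by (cases j) auto
        with j show ?thesis by auto
      qed
      then show ?thesis using Suc.IH by (auto intro!: exI[of _ "\<lambda>xs. y (a # xs)"])
    qed
    then have "{a. \<not> null n (slice P a)} \<subseteq> {..<y []}"
      by (auto simp: linorder_not_le[symmetric])
    then show "null (Suc n) P" by (simp add: finite_subset)
  qed
qed auto

section \<open>Strictly increasing maps between powers of omega, and order types\<close>

text \<open>\<open>lexn\<close> relates only lists of the given length, so for \<open>m > 0\<close>
  lists of length \<open>m\<close> automatically have images of length \<open>n\<close>. For
  \<open>m = 0\<close> the condition is void, hence the separate range assumptions below.\<close>

definition lex_mono :: "nat \<Rightarrow> nat \<Rightarrow> (nat list \<Rightarrow> nat list) \<Rightarrow> bool" where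
  "lex_mono m n f \<longleftrightarrow>
     (\<forall>p q. (p, q) \<in> lexn less_than m \<longrightarrow> (f p, f q) \<in> lexn less_than n)"

lemma Cons_Cons_lexn:
  "(a # p, b # q) \<in> lexn less_than (Suc n) \<longleftrightarrow>
     a < b \<and> length p = n \<and> length q = n \<or> a = b \<and> (p, q) \<in> lexn less_than n"
proof -
  have "(xs, ys) \<in> lexn less_than m \<longleftrightarrow> (xs, ys) \<in> lex less_than \<and> length xs = m" for xs ys :: "nat list" and m
    by (auto simp: lex_def dest: lexn_length)
  then show ?thesis by (auto simp del: lexn.simps dest: lexn_length)
qed

declare lexn.simps(2) [simp del]

lemma lexn_Suc_cases:
  assumes "(p, q) \<in> lexn less_than (Suc n)"
  obtains a as b bs where "p = a # as" "q = b # bs" "length as = n" "length bs = n"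
    "a < b \<or> a = b \<and> (as, bs) \<in> lexn less_than n"
proof -
  have "length p = Suc n" "length q = Suc n" using assms lexn_length by blast+
  then obtain a as b bs where *: "p = a # as" "q = b # bs" "length as = n" "length bs = n"
    by (auto simp: length_Suc_conv)
  then show ?thesis using assms that Cons_Cons_lexn by metis
qed

lemma lexn_linear:
  assumes "length p = n" "length q = n" "p \<noteq> q"
  shows "(p, q) \<in> lexn less_than n \<or> (q, p) \<in> lexn less_than n"
  using assms
proof (induction n arbitrary: p q)
  case (Suc n)
  then obtain a as b bs where "p = a # as" "q = b # bs" "length as = n" "length bs = n"
    by (auto simp: length_Suc_conv)
  then show ?case using Suc.IH[of as bs] Suc.prems(3)
    by (simp add: Cons_Cons_lexn) (use linorder_less_linear in blast)
qed auto

text \<open>The heads of the non-null slices form an infinite set; its increasing enumeration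
  supplies the leading coordinate, and recursion supplies a copy inside each of these slices. Slices
  of an image are images of slices, so nullity passes in both directions.\<close>

lemma not_null_copy:
  assumes "\<not> null n D"
  shows "\<exists>e. e ` omega_pow n \<subseteq> D \<inter> omega_pow n \<and> lex_mono n n e \<and>
           (\<forall>Y\<subseteq>omega_pow n. null n (e ` Y) \<longleftrightarrow> null n Y)"
  using assms
proof (induction n arbitrary: D)
  case 0
  then show ?case by (intro exI[of _ id]) (auto simp: omega_pow_def lex_mono_def)
next
  case (Suc n)
  define S where "S = {a. \<not> null n (slice D a)}"
  have "infinite S" using Suc.prems by (simp add: S_def)
  then have en: "strict_mono (enumerate S)" "\<And>i. enumerate S i \<in> S" "range (enumerate S) = S"
    using strict_mono_enumerate enumerate_in_set range_enumerate by blast+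
  have "\<forall>a\<in>S. \<exists>e. e ` omega_pow n \<subseteq> slice D a \<inter> omega_pow n \<and> lex_mono n n e \<and>
           (\<forall>Y\<subseteq>omega_pow n. null n (e ` Y) \<longleftrightarrow> null n Y)"
    using Suc.IH by (auto simp: S_def)
  then obtain e where e: "\<And>a. a \<in> S \<Longrightarrow> e a ` omega_pow n \<subseteq> slice D a \<inter> omega_pow n"
    "\<And>a. a \<in> S \<Longrightarrow> lex_mono n n (e a)"
    "\<And>a Y. a \<in> S \<Longrightarrow> Y \<subseteq> omega_pow n \<Longrightarrow> null n (e a ` Y) \<longleftrightarrow> null n Y"
    by metis
  let ?a = "enumerate S"
  define e' where "e' p = ?a (hd p) # e (?a (hd p)) (tl p)" for p
  have "e' ` omega_pow (Suc n) \<subseteq> D \<inter> omega_pow (Suc n)"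
  proof
    fix q assume "q \<in> e' ` omega_pow (Suc n)"
    then obtain a as where "q = e' (a # as)" "as \<in> omega_pow n"
      by (auto simp: omega_pow_def length_Suc_conv)
    then show "q \<in> D \<inter> omega_pow (Suc n)"
      using e(1)[OF en(2), of a] by (auto simp: e'_def omega_pow_def)
  qed
  moreover have "lex_mono (Suc n) (Suc n) e'"
    unfolding lex_mono_def
  proof (intro allI impI)
    fix p q assume "(p, q) \<in> lexn less_than (Suc n)"
    then obtain a as b bs where *: "p = a # as" "q = b # bs" "length as = n" "length bs = n"
      "a < b \<or> a = b \<and> (as, bs) \<in> lexn less_than n"
      by (rule lexn_Suc_cases)
    have "length (e (?a a) as) = n" "length (e (?a b) bs) = n"
      using e(1)[OF en(2), of a] e(1)[OF en(2), of b] *(3,4) by (auto simp: omega_pow_def)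
    then show "(e' p, e' q) \<in> lexn less_than (Suc n)"
      using *(5) en(1) e(2)[OF en(2), of b]
      by (auto simp: e'_def *(1,2) Cons_Cons_lexn strict_mono_def lex_mono_def)
  qed
  moreover have "null (Suc n) (e' ` Y) \<longleftrightarrow> null (Suc n) Y" if Y: "Y \<subseteq> omega_pow (Suc n)" for Y
  proof -
    have inj: "?a i = ?a j \<longleftrightarrow> i = j" for i j
      using en(1) by (simp add: strict_mono_eq)
    have sl: "slice (e' ` Y) (?a i) = e (?a i) ` slice Y i" for i
    proof (intro equalityI subsetI)
      fix xs assume "xs \<in> slice (e' ` Y) (?a i)"
      then obtain p where p: "p \<in> Y" "?a i # xs = e' p" by auto
      with Y obtain b bs where "p = b # bs" by (auto simp: omega_pow_def length_Suc_conv)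
      with p show "xs \<in> e (?a i) ` slice Y i" by (auto simp: e'_def inj)
    next
      fix xs assume "xs \<in> e (?a i) ` slice Y i"
      then show "xs \<in> slice (e' ` Y) (?a i)" by (force simp: e'_def image_iff)
    qed
    have "null n (slice (e' ` Y) (?a i)) \<longleftrightarrow> null n (slice Y i)" for i
      unfolding sl using Y by (intro e(3) en(2)) (auto simp: omega_pow_def)
    moreover have "slice (e' ` Y) a = {}" if "a \<notin> range ?a" for a
      using that by (auto simp: e'_def)
    then have "a \<in> range ?a" if "\<not> null n (slice (e' ` Y) a)" for a
      using that null_empty by metis
    ultimately have "{a. \<not> null n (slice (e' ` Y) a)} = ?a ` {i. \<not> null n (slice Y i)}"
      by blast
    moreover have "inj_on ?a A" for A using inj by (auto simp: inj_on_def)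
    ultimately show ?thesis by (simp add: finite_image_iff)
  qed
  ultimately show ?case by blast
qed

lemma lex_mono_comp: "lex_mono n r g \<Longrightarrow> lex_mono m n f \<Longrightarrow> lex_mono m r (g \<circ> f)"
  by (auto simp: lex_mono_def)

text \<open>Applying \<open>f\<close> again and again to such a point would give an infinite
  descent.\<close>

lemma no_lex_mono_below:
  assumes "lex_mono n n f" "(f p, p) \<in> lexn less_than n"
  shows False
  using assms(2)
proof (induction p rule: wf_induct_rule[OF wf_lexn[OF wf_less_than, of n]])
  case (1 p)
  then show ?case using assms(1) by (auto simp: lex_mono_def)
qed

text \<open>Prepending 0 turns a map into \<omega>^n into a self-map of \<omega>^(n+1) with values
  in the first block, hence below the point \<open>?p\<close>, which stands for \<omega>^n
  itself.\<close>

lemma no_lex_mono_Suc: "\<not> lex_mono (Suc n) n f"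
proof
  assume f: "lex_mono (Suc n) n f"
  let ?p = "1 # replicate n 0" and ?q = "0 # replicate n 0"
  have g: "lex_mono (Suc n) (Suc n) (\<lambda>p. 0 # f p)"
    using f by (auto simp: lex_mono_def Cons_Cons_lexn)
  \<comment> \<open>The comparison with a second point is what shows that \<open>f ?p\<close> has
    length \<open>n\<close>.\<close>
  have "(?q, ?p) \<in> lexn less_than (Suc n)" by (simp add: Cons_Cons_lexn)
  then have "(f ?q, f ?p) \<in> lexn less_than n" using f by (simp add: lex_mono_def)
  then have "length (f ?p) = n" using lexn_length by blast
  then have "(0 # f ?p, ?p) \<in> lexn less_than (Suc n)" by (simp add: Cons_Cons_lexn)
  with no_lex_mono_below[OF g] show False by blast
qed

lemma lex_mono_tl:
  assumes f: "lex_mono m (Suc n) f" and c: "\<And>p. p \<in> omega_pow m \<Longrightarrow> hd (f p) = c"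
  shows "lex_mono m n (\<lambda>p. tl (f p))"
  unfolding lex_mono_def
proof (intro allI impI)
  fix p q assume pq: "(p, q) \<in> lexn less_than m"
  then have "length p = m" "length q = m" using lexn_length by blast+
  with c have hd: "hd (f p) = c" "hd (f q) = c" by (auto simp: omega_pow_def)
  have "(f p, f q) \<in> lexn less_than (Suc n)" using f pq by (auto simp: lex_mono_def)
  then show "(tl (f p), tl (f q)) \<in> lexn less_than n"
    by (rule lexn_Suc_cases) (use hd in auto)
qed

lemma lex_mono_hd_le:
  assumes f: "lex_mono m (Suc n) f" and "(p, q) \<in> lexn less_than m"
  shows "hd (f p) \<le> hd (f q)"
proof -
  have "(f p, f q) \<in> lexn less_than (Suc n)" using assms by (auto simp: lex_mono_def)
  then show ?thesis by (rule lexn_Suc_cases) auto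
qed

text \<open>The heads of \<open>f\<close> on the block with head \<open>i\<close> are bounded by the
  head at the start of the next block, so one head occurs on a non-null part of the block; by
  induction the slice of \<open>P\<close> at that head is non-null. If only finitely many slices
  were non-null, this would bound all heads of \<open>f\<close>. Then one head would occur on a
  non-null part of \<omega>^(n+1), squeezing a copy of \<omega>^(n+1) into \<omega>^n.\<close>

lemma lex_mono_not_null:
  assumes "lex_mono n n f" "f ` omega_pow n \<subseteq> P \<inter> omega_pow n"
  shows "\<not> null n P"
  using assms
proof (induction n arbitrary: f P)
  case 0
  then show ?case by (auto simp: omega_pow_def)
next
  case (Suc n)
  note f = Suc.prems(1)
  show ?case
  proof
    assume "null (Suc n) P"
    then have fin: "finite {a. \<not> null n (slice P a)}" (is "finite ?S") by simp
    let ?z = "replicate n (0::nat)"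
    have ex: "\<exists>p\<in>omega_pow (Suc n). hd p = i \<and> hd (f p) \<in> ?S" for i
    proof -
      let ?h = "hd (f (Suc i # ?z))"
      define Q where "Q c = {xs\<in>omega_pow n. hd (f (i # xs)) = c}" for c
      have "omega_pow n \<subseteq> (\<Union>c\<in>{..?h}. Q c)"
      proof
        fix xs assume xs: "xs \<in> omega_pow n"
        then have "hd (f (i # xs)) \<le> ?h"
          by (intro lex_mono_hd_le[OF f]) (auto simp: Cons_Cons_lexn omega_pow_def)
        with xs show "xs \<in> (\<Union>c\<in>{..?h}. Q c)" by (auto simp: Q_def)
      qed
      then have "\<not> null n (\<Union>c\<in>{..?h}. Q c)" using not_null_omega_pow null_mono by blast
      then obtain c where "\<not> null n (Q c)" by (auto simp: null_UN)
      from not_null_copy[OF this] obtain e where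
        e: "e ` omega_pow n \<subseteq> Q c \<inter> omega_pow n" "lex_mono n n e" by blast
      let ?g = "\<lambda>xs. f (i # e xs)"
      have g: "lex_mono n (Suc n) ?g"
        using f e(2) by (auto simp: lex_mono_def Cons_Cons_lexn)
      have hd: "hd (?g xs) = c" if "xs \<in> omega_pow n" for xs
        using e(1) that by (auto simp: Q_def)
      have "?g xs = c # tl (?g xs) \<and> ?g xs \<in> P \<inter> omega_pow (Suc n)" if "xs \<in> omega_pow n" for xs
      proof -
        have "i # e xs \<in> omega_pow (Suc n)" using e(1) that by (auto simp: omega_pow_def)
        then have *: "?g xs \<in> P \<inter> omega_pow (Suc n)" using Suc.prems(2) by blast
        then have "?g xs \<noteq> []" by (auto simp: omega_pow_def)
        with * hd[OF that] show ?thesis by (metis list.collapse)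
      qed
      then have "tl (?g xs) \<in> slice P c \<inter> omega_pow n" if "xs \<in> omega_pow n" for xs
        using that by (force simp: omega_pow_def)
      then have "\<not> null n (slice P c)"
        by (intro Suc.IH[OF lex_mono_tl[OF g hd]]) auto
      moreover have "replicate n 0 \<in> omega_pow n" by (simp add: omega_pow_def)
      then have "e ?z \<in> omega_pow n" "hd (?g ?z) = c"
        using e(1) hd by blast+
      then have "i # e ?z \<in> omega_pow (Suc n)" "hd (?g ?z) = c"
        by (auto simp: omega_pow_def)
      ultimately show ?thesis by (intro bexI[of _ "i # e ?z"]) auto
    qed
    let ?N = "Max ?S"
    have le: "hd (f p) \<le> ?N" if pn: "p \<in> omega_pow (Suc n)" for p
    proof -
      obtain i xs where p: "p = i # xs" "length xs = n" using pn by (auto simp: omega_pow_def length_Suc_conv)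
      obtain q where q: "q \<in> omega_pow (Suc n)" "hd q = Suc i" "hd (f q) \<in> ?S" using ex by blast
      then obtain ys where "q = Suc i # ys" "length ys = n" by (auto simp: omega_pow_def length_Suc_conv)
      then have "hd (f p) \<le> hd (f q)"
        by (intro lex_mono_hd_le[OF f]) (auto simp: Cons_Cons_lexn p)
      with fin q(3) show ?thesis using Max_ge order_trans by blast
    qed
    define Q where "Q c = {p\<in>omega_pow (Suc n). hd (f p) = c}" for c
    have "omega_pow (Suc n) \<subseteq> (\<Union>c\<in>{..?N}. Q c)" using le by (auto simp: Q_def)
    then have "\<not> null (Suc n) (\<Union>c\<in>{..?N}. Q c)" using not_null_omega_pow null_mono by blast
    then obtain c where "\<not> null (Suc n) (Q c)" by (auto simp: null_UN simp del: null.simps)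
    from not_null_copy[OF this] obtain e where
      e: "e ` omega_pow (Suc n) \<subseteq> Q c \<inter> omega_pow (Suc n)" "lex_mono (Suc n) (Suc n) e" by blast
    have "lex_mono (Suc n) n (\<lambda>p. tl ((f \<circ> e) p))"
      by (rule lex_mono_tl[OF lex_mono_comp[OF f e(2)], of c]) (use e(1) in \<open>auto simp: Q_def\<close>)
    with no_lex_mono_Suc show False by blast
  qed
qed

text \<open>A null set has no room for an increasing image of \<omega>^n, which an embedding of the
  whole order would be. Conversely, a set of smaller order type is isomorphic to the points below
  some \<open>a\<close>; composed with a copy of \<omega>^n inside the set, this is an increasing
  self-map taking \<open>a\<close> below itself.\<close>

lemma Restr_omega_le_ordLess_iff:
  assumes P: "P \<subseteq> omega_pow n"
  shows "Restr (omega_le n) P <o omega_le n \<longleftrightarrow> null n P"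
proof -
  let ?r = "omega_le n"
  have W: "Well_order ?r" "Well_order (Restr ?r P)"
    using Well_order_omega_le Well_order_Restr by blast+
  have irr: "(p, p) \<notin> lexn less_than n" for p
    using wf_lexn[OF wf_less_than, of n] by auto
  have lexI: "(p, q) \<in> lexn less_than n" if "(p, q) \<in> ?r" "p \<noteq> q" for p q
    using that by (auto simp: omega_le_def)
  have inr: "p \<in> omega_pow n" "q \<in> omega_pow n" "(p, q) \<in> ?r" "p \<noteq> q" if "(p, q) \<in> lexn less_than n" for p q
    using that irr by (auto simp: omega_le_def omega_pow_def dest: lexn_length)
  have FR: "Field (Restr ?r P) = P"
    using P Refl_Field_Restr[of ?r P] Well_order_omega_le[of n]
    by (auto simp: well_order_on_def linear_order_on_def partial_order_on_def preorder_on_def)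
  show ?thesis
  proof
    assume "null n P"
    show "Restr ?r P <o ?r"
    proof (rule ccontr)
      assume "\<not> Restr ?r P <o ?r"
      then have "?r \<le>o Restr ?r P" using W not_ordLess_iff_ordLeq by blast
      then obtain f where f: "embed ?r (Restr ?r P) f" by (auto simp: ordLeq_def)
      have inj: "inj_on f (omega_pow n)" using embed_inj_on[OF W(1) f] by simp
      have "compat ?r (Restr ?r P) f" using embed_compat[OF f] .
      then have "(f p, f q) \<in> ?r" if "(p, q) \<in> ?r" for p q using that by (auto simp: compat_def)
      moreover have "f p \<noteq> f q" if "(p, q) \<in> lexn less_than n" for p q
        using inj inr[OF that] by (auto simp: inj_on_def)
      ultimately have "lex_mono n n f"
        unfolding lex_mono_def by (intro allI impI lexI) (auto dest: inr(3))
      moreover have "f ` omega_pow n \<subseteq> P"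
        using embed_Field[OF f] FR by simp
      ultimately show False using \<open>null n P\<close> lex_mono_not_null P by blast
    qed
  next
    assume less: "Restr ?r P <o ?r"
    show "null n P"
    proof (rule ccontr)
      assume "\<not> null n P"
      from not_null_copy[OF this] obtain e where
        e: "e ` omega_pow n \<subseteq> P \<inter> omega_pow n" "lex_mono n n e" by blast
      obtain a where a: "a \<in> omega_pow n" "Restr ?r P =o Restr ?r (underS ?r a)"
        using less ordLess_iff_ordIso_Restr[OF W] by auto
      then obtain f where f: "BNF_Wellorder_Embedding.iso (Restr ?r P) (Restr ?r (underS ?r a)) f"
        by (auto simp: ordIso_def)
      then have em: "embed (Restr ?r P) (Restr ?r (underS ?r a)) f" by (simp add: BNF_Wellorder_Embedding.iso_def)
      have inj: "inj_on f P" using embed_inj_on[OF W(2) em] FR by simp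
      have compat: "compat (Restr ?r P) (Restr ?r (underS ?r a)) f" using embed_compat[OF em] .
      have img: "f p \<in> underS ?r a" if "p \<in> P" for p
      proof -
        have "(p, p) \<in> Restr ?r P" using that P by (auto simp: omega_le_def Id_on_def)
        then show ?thesis using compat by (auto simp: compat_def)
      qed
      have eP: "e p \<in> P" if "p \<in> omega_pow n" for p using e(1) that by blast
      have "lex_mono n n (f \<circ> e)"
        unfolding lex_mono_def
      proof (intro allI impI)
        fix p q assume pq: "(p, q) \<in> lexn less_than n"
        then have epq: "(e p, e q) \<in> lexn less_than n" "e p \<in> P" "e q \<in> P"
          using e(2) pq inr(1,2)[OF pq] eP by (auto simp: lex_mono_def)
        then have "(e p, e q) \<in> Restr ?r P" "f (e p) \<noteq> f (e q)"
          using inr(3,4)[OF epq(1)] inj epq by (auto simp: inj_on_def)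
        then show "((f \<circ> e) p, (f \<circ> e) q) \<in> lexn less_than n"
          using compat lexI by (auto simp: compat_def)
      qed
      moreover have "((f \<circ> e) a, a) \<in> lexn less_than n"
        using img[OF eP[OF a(1)]] lexI by (auto simp: underS_def)
      ultimately show False by (rule no_lex_mono_below)
    qed
  qed
qed

lemma omega_ideal_eq: "omega_ideal n = {P. P \<subseteq> omega_pow n \<and> null n P}"
  using Restr_omega_le_ordLess_iff by (auto simp: omega_ideal_def)

section \<open>Continuous reducibility to the ideals\<close>

lemma topspace_cantor [simp]: "topspace cantor_topology = UNIV"
  by (simp add: cantor_topology_def topspace_pullback_topology)

lemma continuous_map_into_cantor:
  "continuous_map T cantor_topology f \<longleftrightarrow> (\<forall>i. continuous_map T (discrete_topology UNIV) (\<lambda>x. i \<in> f x))"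
proof -
  have *: "continuous_map T cantor_topology f \<longleftrightarrow>
      continuous_map T (product_topology (\<lambda>i. discrete_topology (UNIV :: bool set)) UNIV) (\<lambda>x i. i \<in> f x)"
    (is "?L \<longleftrightarrow> ?R")
  proof
    assume ?R then show ?L unfolding cantor_topology_def
      by (intro continuous_map_pullback') (auto simp: o_def)
  next
    assume L: ?L
    have "continuous_map cantor_topology (product_topology (\<lambda>i. discrete_topology (UNIV :: bool set)) UNIV)
        (id \<circ> (\<lambda>X i. i \<in> X))"
      unfolding cantor_topology_def by (rule continuous_map_pullback) simp
    from continuous_map_compose[OF L this] show ?R by (simp add: o_def)
  qed
  show ?thesis unfolding * continuous_map_componentwise_UNIV ..
qed

definition clopen :: "nat set set \<Rightarrow> bool" where
  "clopen C \<longleftrightarrow> openin cantor_topology C \<and> openin cantor_topology (- C)"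

lemma clopen_iff_continuous: "clopen C \<longleftrightarrow> continuous_map cantor_topology (discrete_topology UNIV) (\<lambda>x. x \<in> C)"
proof
  assume C: "clopen C"
  show "continuous_map cantor_topology (discrete_topology UNIV) (\<lambda>x. x \<in> C)"
    unfolding continuous_map_def
  proof (intro conjI allI impI)
    fix U :: "bool set"
    have "{x. (x \<in> C) \<in> U} = (if True \<in> U then C else {}) \<union> (if False \<in> U then - C else {})"
      by (auto, (metis (full_types))+)
    then show "openin cantor_topology {x \<in> topspace cantor_topology. (x \<in> C) \<in> U}"
      using C openin_topspace[of cantor_topology] by (auto simp: clopen_def)
  qed auto
next
  assume "continuous_map cantor_topology (discrete_topology UNIV) (\<lambda>x. x \<in> C)"
  from openin_continuous_map_preimage[OF this, of "{True}"] openin_continuous_map_preimage[OF this, of "{False}"]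
  show "clopen C" by (simp add: clopen_def Compl_eq)
qed

lemma clopen_coordinate: "clopen {X. i \<in> X}"
  using continuous_map_into_cantor[of cantor_topology id] by (simp add: clopen_iff_continuous)

lemma clopen_Compl: "clopen C \<Longrightarrow> clopen (- C)"
  by (simp add: clopen_def)

lemma clopen_Un: "clopen C \<Longrightarrow> clopen D \<Longrightarrow> clopen (C \<union> D)"
  by (auto simp: clopen_def)

lemma clopen_empty: "clopen {}"
  using openin_topspace[of cantor_topology] by (simp add: clopen_def)

lemma clopen_UN: "finite A \<Longrightarrow> (\<And>a. a \<in> A \<Longrightarrow> clopen (C a)) \<Longrightarrow> clopen (\<Union>a\<in>A. C a)"
  by (induction A rule: finite_induct) (auto intro: clopen_Un clopen_empty)

lemma clopen_Int: "clopen C \<Longrightarrow> clopen D \<Longrightarrow> clopen (C \<inter> D)"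
  by (auto simp: clopen_def)

text \<open>The basic clopen sets, numbered: \<open>i\<close> codes a length and a finite set that
  prescribes membership below it. A finite set not contained in that range gives the empty cylinder.
  The numbering lets a point of Cantor space list the cylinders of an open set, as the diagonal
  argument requires.\<close>

definition cylinder :: "nat \<Rightarrow> nat set set" where
  "cylinder i = {X. X \<inter> {..<fst (prod_decode i)} = set_decode (snd (prod_decode i))}"

lemma clopen_cylinder: "clopen (cylinder i)"
proof -
  define N s where "N = fst (prod_decode i)" and "s = set_decode (snd (prod_decode i))"
  have "cylinder i = (if s \<subseteq> {..<N} then - (\<Union>j\<in>{..<N}. if j \<in> s then - {X. j \<in> X} else {X. j \<in> X}) else {})"
    by (auto simp: cylinder_def N_def s_def split: if_splits)
  then show ?thesis
    by (simp only: clopen_empty split: if_split)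
      (intro conjI impI clopen_Compl clopen_UN, auto intro: clopen_Compl clopen_coordinate)
qed

lemma cylinder_basis:
  assumes "openin cantor_topology U" "X \<in> U"
  shows "\<exists>i. X \<in> cylinder i \<and> cylinder i \<subseteq> U"
proof -
  obtain V where V: "openin (product_topology (\<lambda>i. discrete_topology (UNIV :: bool set)) (UNIV :: nat set)) V"
    "U = (\<lambda>X i. i \<in> X) -` V"
    using assms(1) by (auto simp: cantor_topology_def openin_pullback_topology)
  have "(\<lambda>i. i \<in> X) \<in> V" using assms(2) V(2) by auto
  then obtain B :: "nat \<Rightarrow> bool set" where B: "finite {i. B i \<noteq> UNIV}" "(\<lambda>i. i \<in> X) \<in> Pi\<^sub>E UNIV B" "Pi\<^sub>E UNIV B \<subseteq> V"
    using V(1) unfolding openin_product_topology_alt by (fastforce simp del: PiE_UNIV_domain)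
  then obtain N where N: "\<And>i. B i \<noteq> UNIV \<Longrightarrow> i < N"
    by (auto simp: finite_nat_set_iff_bounded)
  let ?i = "prod_encode (N, set_encode (X \<inter> {..<N}))"
  have "X \<in> cylinder ?i" by (simp add: cylinder_def)
  moreover have "cylinder ?i \<subseteq> U"
  proof
    fix Y assume "Y \<in> cylinder ?i"
    then have Y: "Y \<inter> {..<N} = X \<inter> {..<N}" by (simp add: cylinder_def)
    have "(\<lambda>i. i \<in> Y) \<in> Pi\<^sub>E UNIV B"
    proof (rule PiE_I)
      fix i :: nat
      show "(i \<in> Y) \<in> B i"
      proof (cases "B i = UNIV")
        case False
        then have "i < N" by (rule N)
        then have "i \<in> Y \<longleftrightarrow> i \<in> X" using Y by auto
        then show ?thesis using B(2) by auto
      qed auto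
    qed auto
    then show "Y \<in> U" using B(3) V(2) by auto
  qed
  ultimately show ?thesis by blast
qed

section \<open>Sets continuously reducible to the ideals\<close>

text \<open>A family of clopen sets indexed by lists is the same as a continuous map from Cantor
  space to sets of lists, so these are the continuous preimages of the ideal. Only their closure
  properties are used, with crude bounds on the level.\<close>

definition null_class :: "nat \<Rightarrow> nat set set \<Rightarrow> bool" where
  "null_class n T \<longleftrightarrow> (\<exists>C. (\<forall>p. clopen (C p)) \<and> T = {X. null n {p. X \<in> C p}})"

lemma null_class_0: "null_class 0 T \<longleftrightarrow> clopen T"
proof
  assume "null_class 0 T"
  then obtain C :: "nat list \<Rightarrow> nat set set" where "\<And>p. clopen (C p)" "T = - C []"
    by (auto simp: null_class_def)
  then show "clopen T" by (simp add: clopen_Compl)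
next
  assume "clopen T"
  then show "null_class 0 T"
    unfolding null_class_def by (intro exI[of _ "\<lambda>_. - T"]) (auto simp: clopen_Compl)
qed

lemma null_class_Suc:
  "null_class (Suc n) T \<longleftrightarrow> (\<exists>S :: nat \<Rightarrow> _. (\<forall>i. null_class n (S i)) \<and> T = {X. finite {i. X \<notin> S i}})"
proof
  assume "null_class (Suc n) T"
  then obtain C where C: "\<And>p. clopen (C p)" "T = {X. null (Suc n) {p. X \<in> C p}}"
    by (auto simp: null_class_def simp del: null.simps)
  show "\<exists>S :: nat \<Rightarrow> _. (\<forall>i. null_class n (S i)) \<and> T = {X. finite {i. X \<notin> S i}}"
    by (rule exI[of _ "\<lambda>i. {X. null n {p. X \<in> C (i # p)}}"])
      (auto simp: null_class_def C intro!: exI[of _ "\<lambda>p. C (_ # p)"])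
next
  assume "\<exists>S :: nat \<Rightarrow> _. (\<forall>i. null_class n (S i)) \<and> T = {X. finite {i. X \<notin> S i}}"
  then obtain S :: "nat \<Rightarrow> nat set set" where S: "\<And>i. null_class n (S i)" "T = {X. finite {i. X \<notin> S i}}" by blast
  then obtain C where C: "\<And>i p. clopen (C i p)" "\<And>i. S i = {X. null n {p. X \<in> C i p}}"
    unfolding null_class_def by metis
  show "null_class (Suc n) T"
    unfolding null_class_def
    by (rule exI[of _ "\<lambda>p. C (hd p) (tl p)"]) (auto simp: C S(2))
qed

lemma null_class_mono: "null_class n T \<Longrightarrow> n \<le> m \<Longrightarrow> null_class m T"
proof (induction m)
  case (Suc m)
  show ?case
  proof (cases "n = Suc m")
    case False
    with Suc have "null_class m T" by auto
    then show ?thesis unfolding null_class_Suc by (intro exI[of _ "\<lambda>_. T"]) auto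
  qed (use Suc in auto)
qed auto

text \<open>A finite union is null iff all its members are, so it suffices to unite the clopen
  conditions position by position; no level is lost.\<close>

lemma null_class_finite_INT:
  assumes "\<And>j. null_class n (T j)"
  shows "null_class n (\<Inter>j\<in>{a..b::nat}. T j)"
proof -
  obtain C where C: "\<And>j p. clopen (C j p)" "\<And>j. T j = {X. null n {p. X \<in> C j p}}"
    using assms unfolding null_class_def by metis
  have "{p. X \<in> (\<Union>j\<in>{a..b}. C j p)} = (\<Union>j\<in>{a..b}. {p. X \<in> C j p})" for X by auto
  then have "null n {p. X \<in> (\<Union>j\<in>{a..b}. C j p)} \<longleftrightarrow> X \<in> (\<Inter>j\<in>{a..b}. T j)" for X
    by (simp add: null_UN C(2))
  then show ?thesis
    unfolding null_class_def by (intro exI[of _ "\<lambda>p. \<Union>j\<in>{a..b}. C j p"]) (auto intro: clopen_UN C(1))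
qed

text \<open>The finite intersections decrease, so lying in almost all of them means lying in all of
  them.\<close>

lemma null_class_INT:
  fixes T :: "nat \<Rightarrow> nat set set"
  assumes "\<And>j. null_class n (T j)"
  shows "null_class (Suc n) (\<Inter>j. T j)"
  unfolding null_class_Suc
proof (intro exI conjI allI)
  show "null_class n (\<Inter>j\<in>{0..i}. T j)" for i using assms by (rule null_class_finite_INT)
  show "(\<Inter>j. T j) = {X. finite {i. X \<notin> (\<Inter>j\<in>{0..i}. T j)}}"
  proof (intro equalityI subsetI)
    fix X assume "X \<in> {X. finite {i. X \<notin> (\<Inter>j\<in>{0..i}. T j)}}"
    then obtain N where N: "\<And>i. X \<notin> (\<Inter>j\<in>{0..i}. T j) \<Longrightarrow> i < N"
      by (auto simp: finite_nat_set_iff_bounded)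
    show "X \<in> (\<Inter>j. T j)"
    proof
      fix j show "X \<in> T j" using N[of "max j N"] by fastforce
    qed
  qed auto
qed

lemma null_class_incseq_UN:
  assumes "\<And>j. null_class n (T j)" "incseq T"
  shows "null_class (Suc n) (\<Union>j. T j)"
  unfolding null_class_Suc
proof (intro exI conjI allI)
  show "null_class n (T i)" for i by fact
  show "(\<Union>j. T j) = {X. finite {i. X \<notin> T i}}"
  proof (intro equalityI subsetI)
    fix X assume "X \<in> (\<Union>j. T j)"
    then obtain j where "X \<in> T j" by blast
    with assms(2) have "X \<in> T i" if "j \<le> i" for i using that by (auto simp: incseq_def)
    then have "{i. X \<notin> T i} \<subseteq> {..<j}" by (auto simp: linorder_not_le[symmetric])
    then show "X \<in> {X. finite {i. X \<notin> T i}}" by (simp add: finite_subset)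
  next
    fix X assume "X \<in> {X. finite {i. X \<notin> T i}}"
    then have "{i. X \<notin> T i} \<noteq> UNIV" by auto
    then show "X \<in> (\<Union>j. T j)" by auto
  qed
qed

lemma liminf_decomposition:
  fixes T :: "nat \<Rightarrow> 'a set"
  shows "{X. finite {i. X \<notin> T i}} = (\<Union>r. \<Inter>q. \<Inter>i\<in>{r..q}. T i)"
proof (intro equalityI subsetI)
  fix X assume "X \<in> {X. finite {i. X \<notin> T i}}"
  then obtain N where N: "\<And>i. X \<notin> T i \<Longrightarrow> i < N"
    by (auto simp: finite_nat_set_iff_bounded)
  then have "X \<in> (\<Inter>q. \<Inter>i\<in>{N..q}. T i)" by force
  then show "X \<in> (\<Union>r. \<Inter>q. \<Inter>i\<in>{r..q}. T i)" by blast
next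
  fix X assume "X \<in> (\<Union>r. \<Inter>q. \<Inter>i\<in>{r..q}. T i)"
  then obtain r where r: "\<forall>q. \<forall>i\<in>{r..q}. X \<in> T i" by blast
  have "X \<in> T i" if "r \<le> i" for i using r[rule_format, of i i] that by auto
  then have "{i. X \<notin> T i} \<subseteq> {..<r}" by (auto simp: linorder_not_le[symmetric])
  then show "X \<in> {X. finite {i. X \<notin> T i}}" by (simp add: finite_subset)
qed

text \<open>A union of limits inferior need not be the limit inferior of the unions. It is rewritten
  as an increasing countable union of countable intersections of finite unions from the level below;
  the two outer operations cost one level each, whence the factor 2.\<close>

lemma null_class_finite_UN:
  assumes "\<And>j. null_class n (T j)"
  shows "null_class (2 * n) (\<Union>j\<in>{..b::nat}. T j)"
  using assms
proof (induction n arbitrary: T)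
  case 0
  then show ?case by (auto simp: null_class_0 intro: clopen_UN)
next
  case (Suc n)
  have "\<forall>j. \<exists>S :: nat \<Rightarrow> _. (\<forall>i. null_class n (S i)) \<and> T j = {X. finite {i. X \<notin> S i}}"
    using Suc.prems by (simp only: null_class_Suc) simp
  from choice[OF this] obtain S :: "nat \<Rightarrow> nat \<Rightarrow> nat set set" where
    S: "\<And>j i. null_class n (S j i)" "\<And>j. T j = {X. finite {i. X \<notin> S j i}}"
    by blast
  have "(\<Union>j\<in>{..b}. T j) = (\<Union>r. \<Inter>q. \<Union>j\<in>{..b}. \<Inter>i\<in>{r..q}. S j i)"
    \<comment> \<open>pigeonhole: a finite union of decreasing intersections is the intersection of the unions\<close>
  proof (intro equalityI subsetI)
    fix X assume "X \<in> (\<Union>j\<in>{..b}. T j)"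
    then obtain j r where "j \<in> {..b}" "X \<in> (\<Inter>q. \<Inter>i\<in>{r..q}. S j i)"
      unfolding S(2) liminf_decomposition by (elim UN_E)
    then have "X \<in> (\<Union>j\<in>{..b}. \<Inter>i\<in>{r..q}. S j i)" for q by blast
    then have "X \<in> (\<Inter>q. \<Union>j\<in>{..b}. \<Inter>i\<in>{r..q}. S j i)" by (rule INT_I)
    then show "X \<in> (\<Union>r. \<Inter>q. \<Union>j\<in>{..b}. \<Inter>i\<in>{r..q}. S j i)" by (rule UN_I[OF UNIV_I])
  next
    fix X assume "X \<in> (\<Union>r. \<Inter>q. \<Union>j\<in>{..b}. \<Inter>i\<in>{r..q}. S j i)"
    then obtain r where "X \<in> (\<Inter>q. \<Union>j\<in>{..b}. \<Inter>i\<in>{r..q}. S j i)" by (rule UN_E)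
    then have "\<forall>q. \<exists>j\<in>{..b}. X \<in> (\<Inter>i\<in>{r..q}. S j i)" unfolding INT_iff UN_iff by (rule ball_UNIV[THEN iffD1])
    then obtain j where j: "\<And>q. j q \<in> {..b}" "\<And>q. X \<in> (\<Inter>i\<in>{r..q}. S (j q) i)" by metis
    have "finite (range j)" using j(1) finite_subset[of "range j" "{..b}"] by blast
    then obtain c where c: "infinite (j -` {c})"
      using inf_img_fin_dom[of j UNIV] by auto
    have "X \<in> S c i" if "i \<ge> r" for i
    proof -
      obtain q where "q \<ge> i" "j q = c" using c by (meson infinite_nat_iff_unbounded_le vimage_singleton_eq)
      then show ?thesis using j(2)[of q] that by auto
    qed
    moreover have "c \<in> {..b}" using c j(1) by (metis finite.emptyI ex_in_conv vimage_singleton_eq)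
    moreover from calculation have "X \<in> (\<Union>r. \<Inter>q. \<Inter>i\<in>{r..q}. S c i)" by (auto intro!: exI[of _ r])
    ultimately show "X \<in> (\<Union>j\<in>{..b}. T j)"
      unfolding S(2) liminf_decomposition by blast
  qed
  moreover have "null_class (Suc (Suc (2 * n))) (\<Union>r. \<Inter>q. \<Union>j\<in>{..b}. \<Inter>i\<in>{r..q}. S j i)"
  proof (rule null_class_incseq_UN)
    show "null_class (Suc (2 * n)) (\<Inter>q. \<Union>j\<in>{..b}. \<Inter>i\<in>{r..q}. S j i)" for r
      by (intro null_class_INT Suc.IH null_class_finite_INT S(1))
    show "incseq (\<lambda>r. \<Inter>q. \<Union>j\<in>{..b}. \<Inter>i\<in>{r..q}. S j i)"
      unfolding incseq_def by (intro allI impI INT_anti_mono INF_mono UN_mono) force+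
  qed
  ultimately show ?case by simp
qed

lemma null_class_UN:
  fixes T :: "nat \<Rightarrow> nat set set"
  assumes "\<And>j. null_class n (T j)"
  shows "null_class (Suc (2 * n)) (\<Union>j. T j)"
proof -
  have "(\<Union>j. T j) = (\<Union>b. \<Union>j\<in>{..b::nat}. T j)" by auto
  moreover have "null_class (Suc (2 * n)) (\<Union>b. \<Union>j\<in>{..b}. T j)"
    by (intro null_class_incseq_UN null_class_finite_UN assms) (force simp: incseq_def)
  ultimately show ?thesis by simp
qed

text \<open>Not being eventually in \<open>S i\<close> means being outside infinitely often, a
  countable intersection of countable unions of complements. The bound depends on \<open>n\<close>
  alone because the induction needs one level for all members of a sequence.\<close>

lemma null_class_Compl: "\<exists>m. \<forall>T. null_class n T \<longrightarrow> null_class m (- T)"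
proof (induction n)
  case 0
  then show ?case by (auto simp: null_class_0 clopen_Compl intro!: exI[of _ 0])
next
  case (Suc n)
  then obtain m where m: "\<And>T. null_class n T \<Longrightarrow> null_class m (- T)" by blast
  have "null_class (Suc (Suc (2 * m))) (- T)" if T: "null_class (Suc n) T" for T
  proof -
    obtain S :: "nat \<Rightarrow> nat set set" where S: "\<And>i. null_class n (S i)" "T = {X. finite {i. X \<notin> S i}}"
      using T unfolding null_class_Suc by blast
    have "- T = (\<Inter>r. \<Union>i. - S (r + i))"
    proof (intro equalityI subsetI)
      fix X assume X: "X \<in> - T"
      show "X \<in> (\<Inter>r. \<Union>i. - S (r + i))"
      proof
        fix r
        have "infinite {i. X \<notin> S i}" using X by (simp add: S(2))
        then obtain i where "i \<ge> r" "X \<notin> S i" by (auto simp: infinite_nat_iff_unbounded_le)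
        then show "X \<in> (\<Union>i. - S (r + i))" by (auto intro!: exI[of _ "i - r"])
      qed
    next
      fix X assume "X \<in> (\<Inter>r. \<Union>i. - S (r + i))"
      then have "\<exists>i. X \<notin> S (r + i)" for r by auto
      then have "\<exists>i\<ge>r. X \<notin> S i" for r by (metis le_add1)
      then show "X \<in> - T" by (simp add: S(2) infinite_nat_iff_unbounded_le)
    qed
    then show ?thesis by (simp only:) (intro null_class_INT null_class_UN m S(1))
  qed
  then show ?case by blast
qed

lemma null_class_null:
  "(\<And>p. null_class j (T p)) \<Longrightarrow> \<exists>i. null_class i {X. null m {p. X \<in> T p}}"
proof -
  \<comment> \<open>The level is fixed before the family \<open>T\<close>: the induction step needs
    a common level for all the tail families \<open>T (a # p)\<close>.\<close>
  have "\<exists>i. \<forall>T. (\<forall>p. null_class j (T p)) \<longrightarrow> null_class i {X. null m {p. X \<in> T p}}"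
  proof (induction m)
    case 0
    obtain i where "\<And>T. null_class j T \<Longrightarrow> null_class i (- T)" using null_class_Compl by blast
    then show ?case by (intro exI[of _ i]) (auto simp: Compl_eq[symmetric])
  next
    case (Suc m)
    then obtain i where i: "\<And>T. (\<forall>p. null_class j (T p)) \<Longrightarrow> null_class i {X. null m {p. X \<in> T p}}" by blast
    have "null_class (Suc i) {X. null (Suc m) {p. X \<in> T p}}" if "\<forall>p. null_class j (T p)" for T
      unfolding null_class_Suc
      by (rule exI[of _ "\<lambda>a. {X. null m {p. X \<in> T (a # p)}}"]) (use that in \<open>auto intro: i\<close>)
    then show ?case by blast
  qed
  then show "(\<And>p. null_class j (T p)) \<Longrightarrow> \<exists>i. null_class i {X. null m {p. X \<in> T p}}" by blast
qed

text \<open>A collapse spreads to all higher levels, so level \<open>m\<close> would absorb all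
  finite levels and hence be closed under complements. The sets \<open>X\<close> that lie in only a
  null family of the open sets they code form a set of finite level. Its complement cannot be at
  level \<open>m\<close>, because any clopen family defining it is itself coded by some
  \<open>X\<close>.\<close>

lemma null_class_proper:
  assumes "m < n"
  shows "\<exists>T. null_class n T \<and> \<not> null_class m T"
proof (rule ccontr)
  assume "\<nexists>T. null_class n T \<and> \<not> null_class m T"
  then have nm: "null_class m T" if "null_class (Suc m) T" for T
    using that null_class_mono[of "Suc m" T n] assms by auto
  have "null_class (m + i) T" if "null_class (Suc (m + i)) T" for i T
    using that
  proof (induction i arbitrary: T)
    case (Suc i)
    from Suc.prems have "null_class (Suc (Suc (m + i))) T" by simp
    then obtain S :: "nat \<Rightarrow> nat set set" where S: "\<And>j. null_class (Suc (m + i)) (S j)"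
      "T = {X. finite {j. X \<notin> S j}}"
      unfolding null_class_Suc[of "Suc (m + i)"] by blast
    then have "null_class (Suc (m + i)) T"
      unfolding null_class_Suc using Suc.IH S by (intro exI[of _ S]) simp
    then show ?case by simp
  qed (use nm in auto)
  then have collapse: "null_class m T" if "null_class (m + i) T" for i T
    using that by (induction i) auto
  define code where "code p i = prod_encode (list_encode p, i)" for p i
  \<comment> \<open>\<open>X\<close> is read as coding one open set for each position
    \<open>p\<close>; \<open>E p\<close> holds the points that belong to the open set they
    themselves code there.\<close>
  define E where "E p = (\<Union>i. {X. code p i \<in> X} \<inter> cylinder i)" for p
  have "null_class (Suc (2 * 0)) (E p)" for p
    unfolding E_def by (intro null_class_UN) (auto simp: null_class_0 intro: clopen_Int clopen_coordinate clopen_cylinder)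
  then obtain i where "null_class i {X. null m {p. X \<in> E p}}" using null_class_null by blast
  then obtain j where "null_class j (- {X. null m {p. X \<in> E p}})" using null_class_Compl by blast
  then have "null_class m (- {X. null m {p. X \<in> E p}})"
    by (intro collapse[of j]) (rule null_class_mono, auto)
  then obtain C where C: "\<And>p. clopen (C p)" "- {X. null m {p. X \<in> E p}} = {X. null m {p. X \<in> C p}}"
    by (auto simp: null_class_def)
  \<comment> \<open>This point codes exactly \<open>C p\<close> at every \<open>p\<close>, so the
    diagonal set and the reduction of its complement give the same answer at it.\<close>
  define X where "X = {code p i |p i. cylinder i \<subseteq> C p}"
  have code: "code p i = code q j \<longleftrightarrow> p = q \<and> i = j" for p q i j
    by (auto simp: code_def inj_list_encode[THEN inj_eq])
  have "X \<in> E p \<longleftrightarrow> X \<in> C p" for p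
  proof
    assume "X \<in> C p"
    with C(1)[of p] obtain i where "X \<in> cylinder i" "cylinder i \<subseteq> C p"
      using cylinder_basis unfolding clopen_def by blast
    then show "X \<in> E p" by (auto simp: E_def X_def)
  qed (auto simp: E_def X_def code)
  then have "{p. X \<in> E p} = {p. X \<in> C p}" by auto
  moreover have "X \<in> - {X. null m {p. X \<in> E p}} \<longleftrightarrow> X \<in> {X. null m {p. X \<in> C p}}"
    using C(2) by auto
  ultimately show False by auto
qed

section \<open>Consequences of AT\<close>

lemma list_encode_vimage_image [simp]: "list_encode -` (list_encode ` A) = A"
  by (auto simp: inj_list_encode[THEN inj_eq])

text \<open>The witness form exhibits the ideal as a projection: the point of Baire space carries
  the thresholds, indexed by encoded prefixes. One list consults finitely many prefixes, so each
  condition is closed.\<close>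

lemma Sigma11_null: "Sigma11 {X. null m (list_encode -` X)}"
proof -
  let ?T = "prod_topology cantor_topology baire_topology"
  define B where "B p = {z :: nat set \<times> (nat \<Rightarrow> nat). list_encode p \<in> fst z \<longrightarrow> length p = m \<longrightarrow>
    (\<exists>j<m. p ! j < snd z (list_encode (take j p)))}" for p
  have top: "topspace baire_topology = UNIV"
    by (simp add: baire_topology_def topspace_product_topology PiE_UNIV_domain)
  have coord: "continuous_map ?T (discrete_topology UNIV) (\<lambda>z. i \<in> fst z)" for i
    using continuous_map_into_cantor[of ?T fst] continuous_map_fst by blast
  have eval: "continuous_map ?T (discrete_topology UNIV) (\<lambda>z. snd z i)" for i
    using continuous_map_snd[of cantor_topology baire_topology]
    unfolding baire_topology_def continuous_map_componentwise_UNIV by simp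
  have c1: "closedin ?T {z. list_encode p \<notin> fst z}" for p
    using closedin_continuous_map_preimage[OF coord[of "list_encode p"], of "{False}"] by (simp add: top)
  have c2: "closedin ?T {z. a < snd z i}" for a i
    using closedin_continuous_map_preimage[OF eval[of i], of "{a<..}"] by (simp add: top)
  have "closedin ?T (B p)" for p
  proof (cases "length p = m")
    case True
    then have "B p = {z. list_encode p \<notin> fst z} \<union> (\<Union>j\<in>{..<m}. {z. p ! j < snd z (list_encode (take j p))})"
      by (auto simp: B_def)
    then show ?thesis by (simp only:) (intro closedin_Un c1 closedin_Union, auto intro: c2)
  next
    case False
    then have "B p = topspace ?T" by (auto simp: B_def top)
    then show ?thesis by (simp only: closedin_topspace)
  qed
  then have "closedin ?T (\<Inter>p. B p)" by (intro closedin_Inter) auto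
  moreover have "{X. null m (list_encode -` X)} = fst ` (\<Inter>p. B p)"
  proof (intro equalityI subsetI)
    fix X assume "X \<in> {X. null m (list_encode -` X)}"
    then obtain y where "\<forall>p\<in>list_encode -` X. length p = m \<longrightarrow> (\<exists>j<m. p ! j < y (take j p))"
      unfolding null_witness by auto
    then have "(X, y \<circ> list_decode) \<in> (\<Inter>p. B p)" by (auto simp: B_def)
    then show "X \<in> fst ` (\<Inter>p. B p)" by force
  next
    fix X assume "X \<in> fst ` (\<Inter>p. B p)"
    then obtain y where "\<forall>p. (X, y) \<in> B p" by auto
    then have "\<forall>p\<in>list_encode -` X. length p = m \<longrightarrow> (\<exists>j<m. p ! j < (y \<circ> list_encode) (take j p))"
      by (auto simp: B_def)
    then show "X \<in> {X. null m (list_encode -` X)}" unfolding null_witness by blast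
  qed
  ultimately show ?thesis unfolding Sigma11_def by blast
qed

text \<open>The last coordinate of a point of \<open>branch_set n x\<close> codes an initial segment of \<open>x\<close> whose
  length bounds the other coordinates, so two different branches share only finitely many points.\<close>

definition branch_code :: "nat set \<Rightarrow> nat \<Rightarrow> nat" where
  "branch_code x l = prod_encode (l, set_encode (x \<inter> {..<l}))"

definition branch_set :: "nat \<Rightarrow> nat set \<Rightarrow> nat list set" where
  "branch_set n x = {p \<in> omega_pow n. \<exists>l. last p = branch_code x l \<and> (\<forall>a\<in>set (butlast p). a \<le> l)}"

lemma branch_code_eq_iff:
  "branch_code x l = branch_code y k \<longleftrightarrow> l = k \<and> x \<inter> {..<l} = y \<inter> {..<l}"
  by (auto simp: branch_code_def set_encode_eq)

lemma not_null_branch_set: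
  assumes "n \<ge> 1"
  shows "\<not> null n (branch_set n x)"
proof -
  \<comment> \<open>The induction needs a lower bound \<open>r\<close> on the coded length: fixing a
    head \<open>a\<close> forces \<open>a \<le> l\<close> on the tail, which is absorbed by raising
    \<open>r\<close>.\<close>
  define B where "B n r = {p \<in> omega_pow n. \<exists>l\<ge>r. last p = branch_code x l \<and> (\<forall>a\<in>set (butlast p). a \<le> l)}" for n r
  have "\<not> null (Suc n) (B (Suc n) r)" for n r
  proof (induction n arbitrary: r)
    case 0
    have "{a. \<not> null 0 (slice (B (Suc 0) r) a)} = branch_code x ` {r..}"
      by (auto simp: B_def omega_pow_def)
    moreover have "inj_on (branch_code x) {r..}" by (auto simp: inj_on_def branch_code_eq_iff)
    ultimately show ?case by (simp add: finite_image_iff infinite_Ici)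
  next
    case (Suc n)
    have "B (Suc n) (max a r) \<subseteq> slice (B (Suc (Suc n)) r) a" for a
      by (auto simp: B_def omega_pow_def)
    then have "\<not> null (Suc n) (slice (B (Suc (Suc n)) r) a)" for a
      using Suc.IH[of "max a r"] null_mono by blast
    then show ?case by (subst null.simps) simp
  qed
  from this[of "n - 1" 0] assms show ?thesis by (simp add: B_def branch_set_def)
qed

lemma finite_branch_set_Int:
  assumes "x \<noteq> y"
  shows "finite (branch_set n x \<inter> branch_set n y)"
proof -
  obtain d where d: "d \<in> x \<longleftrightarrow> d \<notin> y" using assms by blast
  let ?S = "insert 0 ({..d} \<union> branch_code x ` {..d})"
  have "set p \<subseteq> ?S \<and> length p = n" if p: "p \<in> branch_set n x \<inter> branch_set n y" for p
  proof -
    obtain l k where l: "last p = branch_code x l" "\<forall>a\<in>set (butlast p). a \<le> l" "last p = branch_code y k"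
      and len: "length p = n"
      using p by (auto simp: branch_set_def omega_pow_def)
    then have "x \<inter> {..<l} = y \<inter> {..<l}" by (metis branch_code_eq_iff)
    then have "l \<le> d" using d by (metis Int_iff lessThan_iff linorder_not_le)
    have "set p \<subseteq> set (butlast p) \<union> {last p}"
      by (cases p rule: rev_cases) auto
    with l \<open>l \<le> d\<close> len show ?thesis by fastforce
  qed
  then have "branch_set n x \<inter> branch_set n y \<subseteq> {p. set p \<subseteq> ?S \<and> length p = n}" by blast
  moreover have "finite {p. set p \<subseteq> ?S \<and> length p = n}" by (rule finite_lists_length_eq) simp
  ultimately show ?thesis by (rule finite_subset)
qed

lemma uncountable_nat_sets: "uncountable (UNIV :: nat set set)"
proof
  assume "countable (UNIV :: nat set set)"
  then obtain f :: "nat \<Rightarrow> nat set" where "range f = UNIV"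
    using uncountable_def by fastforce
  then show False using Cantors_theorem[of UNIV] by (metis Pow_UNIV)
qed

text \<open>Order isomorphisms preserve meets modulo the ideals, so AT gives continuous liftings on
  finitely many pieces covering a branch. One piece is non-null and contains a copy of \<omega>^n;
  along it every reduction to the ideal of \<omega>^n becomes a reduction to the ideal of
  \<omega>^m, which puts level \<open>n\<close> inside level \<open>m\<close>.\<close>

theorem AT_no_isomorphism:
  assumes AT "m < n"
    and ord: "\<And>X Y. null n (X - Y) \<longleftrightarrow> null m (H X - H Y)"
    and surj: "\<And>Z. \<exists>X. null m (H X - Z) \<and> null m (Z - H X)"
  shows False
proof -
  have n: "n \<ge> 1" using assms(2) by simp
  have sub: "null k A" if "null k B" "A \<subseteq> B \<union> C" "null k C" for k A B C
    using that by (meson null_Un null_mono)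
  obtain X0 where X0: "null m (H X0)" using surj[of "{}"] by auto
  have H0: "null m (H {})"
    using ord[of "{}" X0] by (auto intro: sub[OF _ _ X0])
  have null_H: "null n X \<longleftrightarrow> null m (H X)" for X
    using ord[of X "{}"] by (auto intro: sub[OF _ _ H0] null_mono)
  \<comment> \<open>Surjectivity provides a preimage \<open>Z\<close> of the meet of
    \<open>H X\<close> and \<open>H Y\<close>. As \<open>H\<close> reflects the order,
    \<open>Z\<close> lies below \<open>X\<close> and below \<open>Y\<close>, hence below
    \<open>X \<inter> Y\<close>.\<close>
  have inter: "null m (sym_diff (H (X \<inter> Y)) (H X \<inter> H Y))" for X Y
  proof -
    have 1: "null m (H (X \<inter> Y) - H X)" "null m (H (X \<inter> Y) - H Y)"
      using ord[of "X \<inter> Y" X] ord[of "X \<inter> Y" Y] by (auto simp: Diff_eq Int_assoc)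
    obtain Z where Z: "null m (H Z - (H X \<inter> H Y))" "null m ((H X \<inter> H Y) - H Z)" using surj by blast
    have "null m (H Z - H X)" "null m (H Z - H Y)" using Z(1) by (auto intro: null_mono)
    then have "null n ((Z - X) \<union> (Z - Y))" using ord null_Un by blast
    then have "null m (H Z - H (X \<inter> Y))" using ord[of Z "X \<inter> Y"] by (simp add: Diff_Int)
    then have "null m ((H Z - H (X \<inter> Y)) \<union> ((H X \<inter> H Y) - H Z))" using Z(2) null_Un by blast
    then have "null m ((H X \<inter> H Y) - H (X \<inter> Y))" by (rule null_mono) blast
    moreover have "null m (H (X \<inter> Y) - (H X \<inter> H Y))"
      using 1 null_Un by (auto simp: Diff_Int)
    ultimately show ?thesis using null_Un by blast
  qed
  define I where "I = {X. null m (list_encode -` X)}"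
  define K where "K X = list_encode ` H (list_encode -` X)" for X
  have vK: "list_encode -` K X = H (list_encode -` X)" for X by (simp add: K_def)
  have ideal: "set_ideal I"
    unfolding set_ideal_def I_def by (auto intro: null_mono)
  have pres: "preserves_inter_mod I K"
    unfolding preserves_inter_mod_def
  proof (intro conjI allI impI)
    fix X Y :: "nat set"
    show "sym_diff (K (X \<inter> Y)) (K X \<inter> K Y) \<in> I"
      using inter by (simp add: I_def vK vimage_Diff)
    assume fin: "finite (sym_diff X Y)"
    have "null n (list_encode -` A - list_encode -` B)" if "finite (A - B)" for A B
      unfolding vimage_Diff[symmetric] using that n inj_list_encode
      by (intro null_finite finite_vimageI) auto
    then show "sym_diff (K X) (K Y) \<in> I"
      using fin ord by (simp add: I_def vK vimage_Diff)
  qed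
  let ?A = "range (\<lambda>x. list_encode ` branch_set n x)"
  have "infinite (branch_set n x)" for x using not_null_branch_set[OF n] null_finite n by blast
  then have inf: "infinite (list_encode ` branch_set n x)" for x
    using finite_imageD inj_list_encode by blast
  have fin: "finite (list_encode ` branch_set n x \<inter> list_encode ` branch_set n y)" if "x \<noteq> y" for x y
    unfolding image_Int[OF inj_list_encode, symmetric] using finite_branch_set_Int that by blast
  have ad: "almost_disjoint_family ?A"
    unfolding almost_disjoint_family_def
  proof (intro conjI ballI impI)
    fix A B assume "A \<in> ?A" "B \<in> ?A" "A \<noteq> B"
    then obtain x y where "A = list_encode ` branch_set n x" "B = list_encode ` branch_set n y" "x \<noteq> y"
      by blast
    then show "finite (A \<inter> B)" using fin by simp
  qed (use inf in auto)
  have "inj (\<lambda>x. list_encode ` branch_set n x)"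
  proof (rule injI, rule ccontr)
    fix x y assume "list_encode ` branch_set n x = list_encode ` branch_set n y" "x \<noteq> y"
    then show False using fin[of x y] inf[of y] by simp
  qed
  then have unc: "uncountable ?A" using uncountable_nat_sets countable_image_inj_on by blast
  have "\<exists>A\<in>?A. \<exists>(k :: nat) D F. A = (\<Union>i<k. D i) \<and>
      (\<forall>i<k. continuous_map (subtopology cantor_topology (Pow (D i))) cantor_topology (F i) \<and>
        (\<forall>X. X \<subseteq> D i \<longrightarrow> sym_diff (F i X) (K X) \<in> I))"
    by (rule \<open>AT\<close>[unfolded AT_def, rule_format])
      (intro conjI ideal Sigma11_null[of m, folded I_def] pres ad unc)
  then obtain A k D F where "A \<in> ?A" and D: "A = (\<Union>i<k::nat. D i)"
    and cont: "\<And>i. i < k \<Longrightarrow> continuous_map (subtopology cantor_topology (Pow (D i))) cantor_topology (F i)"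
    and F: "\<And>i X. i < k \<Longrightarrow> X \<subseteq> D i \<Longrightarrow> sym_diff (F i X) (K X) \<in> I"
    by (elim bexE exE conjE) (rule that, auto)
  from \<open>A \<in> ?A\<close> obtain x where "A = list_encode ` branch_set n x" by (rule imageE)
  with D have "(\<Union>i<k. D i) = list_encode ` branch_set n x" by simp
  then have "list_encode -` (\<Union>i<k. D i) = branch_set n x" by (simp only: list_encode_vimage_image)
  then have "(\<Union>i<k. list_encode -` D i) = branch_set n x" by (simp only: vimage_UN)
  then have "\<not> null n (\<Union>i<k. list_encode -` D i)" using not_null_branch_set[OF n] by simp
  then obtain i where i: "i < k" "\<not> null n (list_encode -` D i)" by (auto simp: null_UN)
  from not_null_copy[OF i(2)] obtain e where
    e: "e ` omega_pow n \<subseteq> list_encode -` D i" "lex_mono n n e"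
      "\<And>Y. Y \<subseteq> omega_pow n \<Longrightarrow> null n (e ` Y) \<longleftrightarrow> null n Y"
    by (elim exE conjE) (rule that, auto)
  have inj: "p = q" if "p \<in> omega_pow n" "q \<in> omega_pow n" "e p = e q" for p q
  proof (rule ccontr)
    assume "p \<noteq> q"
    then have "(p, q) \<in> lexn less_than n \<or> (q, p) \<in> lexn less_than n"
      using that lexn_linear by (auto simp: omega_pow_def)
    then have "(e p, e p) \<in> lexn less_than n" using e(2) that(3) unfolding lex_mono_def by metis
    then show False using wf_lexn[OF wf_less_than, of n] by auto
  qed
  have "null_class m T" if T: "null_class n T" for T
  proof -
    obtain C where C: "\<And>p. clopen (C p)" "T = {X. null n {p. X \<in> C p}}"
      using T by (auto simp: null_class_def)
    \<comment> \<open>The reduction of \<open>T\<close> is copied into \<open>D i\<close>. Since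
      \<open>e\<close> is injective, membership of one number depends on at most one clopen set
      \<open>C p\<close>, so \<open>Z\<close> is continuous.\<close>
    define Z where "Z X = list_encode ` e ` {p \<in> omega_pow n. X \<in> C p}" for X
    have ZD: "Z X \<subseteq> D i" for X using e(1) by (auto simp: Z_def)
    have clZ: "clopen {X. j \<in> Z X}" for j
    proof (cases "\<exists>p\<in>omega_pow n. j = list_encode (e p)")
      case True
      then obtain p where p: "p \<in> omega_pow n" "j = list_encode (e p)" by blast
      have "{X. j \<in> Z X} = C p"
        using p by (auto simp: Z_def inj_list_encode[THEN inj_eq] dest: inj[OF p(1)])
      with C(1) show ?thesis by simp
    next
      case False
      then have "{X. j \<in> Z X} = {}" by (auto simp: Z_def)
      then show ?thesis by (simp add: clopen_empty)
    qed
    then have "continuous_map cantor_topology cantor_topology Z"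
      by (simp add: continuous_map_into_cantor clopen_iff_continuous)
    then have "continuous_map cantor_topology (subtopology cantor_topology (Pow (D i))) Z"
      using ZD by (auto simp: continuous_map_in_subtopology)
    from continuous_map_compose[OF this cont[OF i(1)]]
    have cl: "clopen {X. j \<in> F i (Z X)}" for j
      by (simp add: continuous_map_into_cantor clopen_iff_continuous)
    have "X \<in> T \<longleftrightarrow> null m {q. X \<in> {X. list_encode q \<in> F i (Z X)}}" for X
    proof -
      have "X \<in> T \<longleftrightarrow> null n {p \<in> omega_pow n. X \<in> C p}"
        using null_Int_omega_pow[of n "{p. X \<in> C p}"] by (simp add: C(2) Int_def conj_commute)
      also have "\<dots> \<longleftrightarrow> null n (e ` {p \<in> omega_pow n. X \<in> C p})" using e(3) by auto
      also have "\<dots> \<longleftrightarrow> null m (H (list_encode -` Z X))" unfolding Z_def by (simp add: null_H)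
      also have "\<dots> \<longleftrightarrow> null m (list_encode -` K (Z X))" by (simp add: vK)
      also have "\<dots> \<longleftrightarrow> null m (list_encode -` F i (Z X))"
      proof -
        have d: "null m (list_encode -` (F i (Z X) - K (Z X)))" "null m (list_encode -` (K (Z X) - F i (Z X)))"
          using F[OF i(1) ZD[of X]] by (auto simp: I_def)
        show ?thesis by (auto intro: sub[OF _ _ d(1)] sub[OF _ _ d(2)])
      qed
      finally show ?thesis by (simp add: vimage_def)
    qed
    then show ?thesis
      unfolding null_class_def using cl by (intro exI[of _ "\<lambda>q. {X. list_encode q \<in> F i (Z X)}"]) auto
  qed
  then show False using null_class_proper[OF assms(2)] by blast
qed

section \<open>The ring and unitriangular matrices\<close>

text \<open>Cutting down to \<open>omega_pow n\<close> admits every set of lists as a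
  representative, including \<open>UNIV\<close>.\<close>

definition cls :: "nat \<Rightarrow> nat list set \<Rightarrow> nat list set set" where
  "cls n A = omega_approx n `` {A \<inter> omega_pow n}"

lemma omega_approx_iff:
  "(A, B) \<in> omega_approx n \<longleftrightarrow> A \<subseteq> omega_pow n \<and> B \<subseteq> omega_pow n \<and> null n (sym_diff A B)"
  by (auto simp: omega_approx_def omega_ideal_eq)

lemma null_sym_diff_trans:
  assumes "null n (sym_diff A B)" "null n (sym_diff B C)"
  shows "null n (sym_diff A C)"
proof -
  have "null n (sym_diff A B \<union> sym_diff B C)" using assms null_Un by blast
  then show ?thesis by (rule null_mono) blast
qed

lemma equiv_omega_approx: "equiv (Pow (omega_pow n)) (omega_approx n)"
proof (rule equivI)
  show "sym (omega_approx n)" by (auto simp: sym_def omega_approx_iff)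
  show "trans (omega_approx n)"
    unfolding trans_def omega_approx_iff using null_sym_diff_trans by blast
qed (auto simp: refl_on_def omega_approx_iff)

lemma cls_eq_iff: "cls n A = cls n B \<longleftrightarrow> null n (sym_diff A B)"
proof -
  have "cls n A = cls n B \<longleftrightarrow> null n (sym_diff (A \<inter> omega_pow n) (B \<inter> omega_pow n))"
    unfolding cls_def by (subst eq_equiv_class_iff[OF equiv_omega_approx]) (auto simp: omega_approx_iff)
  also have "sym_diff (A \<inter> omega_pow n) (B \<inter> omega_pow n) = sym_diff A B \<inter> omega_pow n" by blast
  finally show ?thesis by (simp only: null_Int_omega_pow)
qed

lemma carrier_omega_ring: "carrier (omega_ring n) = range (cls n)"
proof (intro equalityI subsetI)
  fix X assume "X \<in> carrier (omega_ring n)"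
  then obtain A where "A \<subseteq> omega_pow n" "X = omega_approx n `` {A}"
    by (auto simp: omega_ring_def quotient_def)
  then have "X = cls n A" by (simp add: cls_def Int_absorb2)
  then show "X \<in> range (cls n)" by blast
qed (auto simp: omega_ring_def quotient_def cls_def)

lemma cls_in_carrier [simp]: "cls n A \<in> carrier (omega_ring n)"
  by (simp add: carrier_omega_ring)

lemma omega_ring_carrierE:
  assumes "X \<in> carrier (omega_ring n)"
  obtains A where "X = cls n A"
  using assms by (auto simp: carrier_omega_ring)

lemma UN_cls:
  assumes "\<And>A' B'. A' \<in> cls n A \<Longrightarrow> B' \<in> cls n B \<Longrightarrow> f A' B' = Z"
  shows "(\<Union>A'\<in>cls n A. \<Union>B'\<in>cls n B. f A' B') = Z"
proof -
  have "A \<inter> omega_pow n \<in> cls n A" "B \<inter> omega_pow n \<in> cls n B"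
    by (auto simp: cls_def omega_approx_iff)
  then show ?thesis using assms by fastforce
qed

lemma in_cls_iff: "A' \<in> cls n A \<longleftrightarrow> A' \<subseteq> omega_pow n \<and> null n (sym_diff A A')"
proof -
  have "A' \<in> cls n A \<longleftrightarrow> A' \<subseteq> omega_pow n \<and> cls n A' = cls n A"
  proof (cases "A' \<subseteq> omega_pow n")
    case True
    then have "A' \<in> cls n A \<longleftrightarrow> (A \<inter> omega_pow n, A') \<in> omega_approx n" by (simp add: cls_def)
    also have "\<dots> \<longleftrightarrow> cls n A' = cls n A"
      using True equiv_class_eq_iff[OF equiv_omega_approx, of "A \<inter> omega_pow n" A' n]
      by (auto simp: cls_def Int_absorb2)
    finally show ?thesis using True by simp
  qed (auto simp: cls_def omega_approx_iff)
  then show ?thesis by (auto simp: cls_eq_iff)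
qed

lemma cls_mult [simp]: "cls n A \<otimes>\<^bsub>omega_ring n\<^esub> cls n B = cls n (A \<inter> B)"
proof -
  have "omega_approx n `` {A' \<inter> B'} = cls n (A \<inter> B)" if "A' \<in> cls n A" "B' \<in> cls n B" for A' B'
  proof -
    have *: "A' \<subseteq> omega_pow n" "null n (sym_diff A A' \<union> sym_diff B B')"
      using that by (auto simp: in_cls_iff)
    have "cls n (A' \<inter> B') = cls n (A \<inter> B)"
      unfolding cls_eq_iff using *(2) by (rule null_mono) blast
    with *(1) show ?thesis by (auto simp: cls_def Int_absorb2 inf.coboundedI1)
  qed
  from UN_cls[OF this] show ?thesis by (simp only: omega_ring_def monoid.simps)
qed

lemma cls_add [simp]: "cls n A \<oplus>\<^bsub>omega_ring n\<^esub> cls n B = cls n (sym_diff A B)"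
proof -
  have "omega_approx n `` {sym_diff A' B'} = cls n (sym_diff A B)" if "A' \<in> cls n A" "B' \<in> cls n B" for A' B'
  proof -
    have *: "sym_diff A' B' \<subseteq> omega_pow n" "null n (sym_diff A A' \<union> sym_diff B B')"
      using that by (auto simp: in_cls_iff)
    have "cls n (sym_diff A' B') = cls n (sym_diff A B)"
      unfolding cls_eq_iff using *(2) by (rule null_mono) blast
    with *(1) show ?thesis by (simp add: cls_def Int_absorb2)
  qed
  from UN_cls[OF this] show ?thesis by (simp only: omega_ring_def ring.simps)
qed

lemma cls_one: "\<one>\<^bsub>omega_ring n\<^esub> = cls n UNIV"
  by (simp add: omega_ring_def cls_def)

lemma cls_zero: "\<zero>\<^bsub>omega_ring n\<^esub> = cls n {}"
  by (simp add: omega_ring_def cls_def)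

lemma cring_omega_ring: "cring (omega_ring n)"
proof (rule cringI)
  show "abelian_group (omega_ring n)"
  proof (rule abelian_groupI)
    fix X assume X: "X \<in> carrier (omega_ring n)"
    then have "X \<oplus>\<^bsub>omega_ring n\<^esub> X = \<zero>\<^bsub>omega_ring n\<^esub>"
      by (auto simp: cls_zero elim!: omega_ring_carrierE)
    with X show "\<exists>y\<in>carrier (omega_ring n). y \<oplus>\<^bsub>omega_ring n\<^esub> X = \<zero>\<^bsub>omega_ring n\<^esub>" by blast
  next
    fix X Y Z assume "X \<in> carrier (omega_ring n)" "Y \<in> carrier (omega_ring n)" "Z \<in> carrier (omega_ring n)"
    then obtain A B C where "X = cls n A" "Y = cls n B" "Z = cls n C"
      by (auto elim!: omega_ring_carrierE)
    moreover have "sym_diff (sym_diff A B) C = sym_diff A (sym_diff B C)" "sym_diff A B = sym_diff B A"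
      by blast+
    ultimately show "X \<oplus>\<^bsub>omega_ring n\<^esub> Y \<oplus>\<^bsub>omega_ring n\<^esub> Z = X \<oplus>\<^bsub>omega_ring n\<^esub> (Y \<oplus>\<^bsub>omega_ring n\<^esub> Z)"
      "X \<oplus>\<^bsub>omega_ring n\<^esub> Y = Y \<oplus>\<^bsub>omega_ring n\<^esub> X"
      by (simp_all only: cls_add)
  qed (auto simp: cls_zero elim!: omega_ring_carrierE)
  show "comm_monoid (omega_ring n)"
    by (rule comm_monoidI)
      (auto simp: cls_one Int_ac elim!: omega_ring_carrierE)
  have "sym_diff A B \<inter> C = sym_diff (A \<inter> C) (B \<inter> C)" for A B C :: "nat list set" by blast
  then show "(X \<oplus>\<^bsub>omega_ring n\<^esub> Y) \<otimes>\<^bsub>omega_ring n\<^esub> Z =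
      X \<otimes>\<^bsub>omega_ring n\<^esub> Z \<oplus>\<^bsub>omega_ring n\<^esub> Y \<otimes>\<^bsub>omega_ring n\<^esub> Z"
    if "X \<in> carrier (omega_ring n)" "Y \<in> carrier (omega_ring n)" "Z \<in> carrier (omega_ring n)" for X Y Z
    using that by (auto simp del: Un_iff Diff_iff elim!: omega_ring_carrierE intro: arg_cong[where f = "cls n"])
qed

lemma bit_add_eq_1_iff: "a + b = (1 :: bit) \<longleftrightarrow> (a = 1) \<noteq> (b = 1)"
  by (cases a; cases b) auto

lemma bit_mult_eq_1_iff: "a * b = (1 :: bit) \<longleftrightarrow> a = 1 \<and> b = 1"
  by (cases a; cases b) auto

text \<open>Symmetric difference is addition of characteristic functions modulo 2. This is what
  turns matrix products over the ring into pointwise products of matrices over the field with two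
  elements.\<close>

lemma cls_finsum:
  fixes f :: "'i \<Rightarrow> nat list \<Rightarrow> bit"
  assumes "finite L"
  shows "(\<Oplus>\<^bsub>omega_ring n\<^esub>l\<in>L. cls n {p. f l p = 1}) = cls n {p. (\<Sum>l\<in>L. f l p) = 1}"
proof -
  interpret cring "omega_ring n" by (rule cring_omega_ring)
  show ?thesis
    using assms
  proof (induction L rule: finite_induct)
    case (insert l L)
    have "sym_diff {p. f l p = 1} {p. (\<Sum>l\<in>L. f l p) = 1} = {p. f l p + (\<Sum>l\<in>L. f l p) = 1}"
      by (auto simp: bit_add_eq_1_iff)
    with insert show ?case by simp
  qed (simp add: cls_zero)
qed

section \<open>Unitriangular matrices: group structure, centre and second centre\<close>

type_synonym 'a smat = "nat \<Rightarrow> nat \<Rightarrow> 'a"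

text \<open>Unitriangular \<open>k \<times> k\<close> matrices, extended to infinite ones by
  the identity matrix.\<close>

definition unitri :: "nat \<Rightarrow> 'a::comm_ring_1 smat set" where
  "unitri k = {A. (\<forall>i. A i i = 1) \<and> (\<forall>i j. j < i \<longrightarrow> A i j = 0) \<and> (\<forall>i j. i < j \<longrightarrow> k \<le> j \<longrightarrow> A i j = 0)}"

text \<open>Terms with \<open>l\<close> beyond the column \<open>j\<close> vanish for triangular
  factors, so this is the usual product without reference to the size \<open>k\<close>.\<close>

definition umul :: "'a::comm_ring_1 smat \<Rightarrow> 'a smat \<Rightarrow> 'a smat" where
  "umul A B = (\<lambda>i j. \<Sum>l\<le>j. A i l * B l j)"

definition uone :: "'a::comm_ring_1 smat" where
  "uone = (\<lambda>i j. if i = j then 1 else 0)"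

text \<open>Forward substitution for a left inverse: because the diagonal of \<open>A\<close> is 1,
  column \<open>j\<close> of \<open>umul (uinv A) A = uone\<close> yields the entry in column
  \<open>j\<close> from the earlier ones.\<close>

fun uinv :: "'a::comm_ring_1 smat \<Rightarrow> 'a smat" where
  "uinv A i j = (if i = j then 1 else 0) - (\<Sum>l<j. uinv A i l * A l j)"

declare uinv.simps [simp del]

definition UG :: "nat \<Rightarrow> bit smat monoid" where
  "UG k = \<lparr>carrier = unitri k, monoid.mult = umul, one = uone\<rparr>"

lemma umul_unitri:
  assumes "A \<in> unitri k" "B \<in> unitri k"
  shows "umul A B \<in> unitri k"
proof -
  have "umul A B i i = 1" for i
  proof -
    have "umul A B i i = (\<Sum>l\<in>{i}. A i l * B l i)"
      unfolding umul_def using assms by (intro sum.mono_neutral_right) (auto simp: unitri_def)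
    also have "\<dots> = 1" using assms by (simp add: unitri_def)
    finally show ?thesis .
  qed
  moreover have "umul A B i j = 0" if "j < i" for i j
    unfolding umul_def using assms that by (intro sum.neutral) (auto simp: unitri_def)
  moreover have "umul A B i j = 0" if "i < j" "k \<le> j" for i j
    unfolding umul_def using assms that
    by (intro sum.neutral ballI) (auto simp: unitri_def le_less)
  ultimately show ?thesis by (simp add: unitri_def)
qed

lemma umul_assoc:
  assumes "A \<in> unitri k" "B \<in> unitri k" "C \<in> unitri k"
  shows "umul (umul A B) C = umul A (umul B C)"
proof (intro ext)
  fix i j
  have "(\<Sum>q\<le>l. A i q * B q l) = (\<Sum>q\<le>j. A i q * B q l)" if "l \<le> j" for l
    using assms that by (intro sum.mono_neutral_left) (auto simp: unitri_def)
  then have "umul (umul A B) C i j = (\<Sum>l\<le>j. (\<Sum>q\<le>j. A i q * B q l) * C l j)"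
    unfolding umul_def by (intro sum.cong) auto
  also have "\<dots> = (\<Sum>l\<le>j. \<Sum>q\<le>j. A i q * (B q l * C l j))"
    by (simp add: sum_distrib_right mult.assoc)
  also have "\<dots> = (\<Sum>q\<le>j. \<Sum>l\<le>j. A i q * (B q l * C l j))" by (rule sum.swap)
  also have "\<dots> = umul A (umul B C) i j" by (simp add: umul_def sum_distrib_left)
  finally show "umul (umul A B) C i j = umul A (umul B C) i j" .
qed

lemma uone_unitri: "uone \<in> unitri k"
  by (auto simp: unitri_def uone_def)

lemma uone_umul:
  assumes "A \<in> unitri k"
  shows "umul uone A = A"
proof (intro ext)
  fix i j
  have "umul uone A i j = (\<Sum>l\<le>j. if l = i then A l j else 0)"
    unfolding umul_def uone_def by (intro sum.cong) auto
  also have "\<dots> = A i j" using assms by (auto simp: unitri_def)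
  finally show "umul uone A i j = A i j" .
qed

lemma uinv_unitri:
  assumes A: "A \<in> unitri k"
  shows "uinv A \<in> unitri k"
proof -
  have 0: "uinv A i j = 0" if "j < i" for i j
    using that
  proof (induction j rule: less_induct)
    case (less j)
    then show ?case by (subst uinv.simps) auto
  qed
  have "uinv A i i = 1" for i
    by (subst uinv.simps) (simp add: 0)
  moreover have "uinv A i j = 0" if "i < j" "k \<le> j" for i j
    using that A by (subst uinv.simps) (auto simp: unitri_def)
  ultimately show ?thesis using 0 by (simp add: unitri_def)
qed

lemma umul_uinv:
  assumes A: "A \<in> unitri k"
  shows "umul (uinv A) A = uone"
proof (intro ext)
  fix i j
  have "umul (uinv A) A i j = (\<Sum>l<j. uinv A i l * A l j) + uinv A i j * A j j"
    by (simp add: umul_def lessThan_Suc_atMost[symmetric])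
  also have "A j j = 1" using A by (simp add: unitri_def)
  also have "uinv A i j = uone i j - (\<Sum>l<j. uinv A i l * A l j)"
    by (subst uinv.simps) (simp add: uone_def)
  finally show "umul (uinv A) A i j = uone i j"
    by simp
qed

lemma group_UG: "group (UG k)"
  unfolding UG_def
  by (rule groupI)
    (auto simp: umul_unitri uone_unitri uone_umul intro: umul_assoc umul_uinv uinv_unitri)

lemma finite_unitri: "finite (unitri k :: bit smat set)"
proof (rule inj_on_finite)
  show "inj_on (\<lambda>A :: bit smat. {(i, j). i < k \<and> j < k \<and> A i j = 1}) (unitri k)"
  proof (rule inj_onI, intro ext)
    fix A B :: "bit smat" and i j assume *: "A \<in> unitri k" "B \<in> unitri k"
      "{(i, j). i < k \<and> j < k \<and> A i j = 1} = {(i, j). i < k \<and> j < k \<and> B i j = 1}"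
    show "A i j = B i j"
    proof (cases "i < k \<and> j < k")
      case True
      with *(3) have "A i j = 1 \<longleftrightarrow> B i j = 1" by blast
      then show ?thesis by (metis bit_not_one_iff)
    next
      case False
      with *(1,2) show ?thesis
        by (cases i j rule: linorder_cases) (auto simp: unitri_def)
    qed
  qed
  show "(\<lambda>A :: bit smat. {(i, j). i < k \<and> j < k \<and> A i j = 1}) ` unitri k \<subseteq> Pow ({..<k} \<times> {..<k})" by auto
qed simp

text \<open>The elementary transvection 1 + E_pq, used as a test element for commutation.\<close>

definition elem :: "nat \<Rightarrow> nat \<Rightarrow> 'a::comm_ring_1 smat" where
  "elem p q = (\<lambda>i j. if i = j \<or> i = p \<and> j = q then 1 else 0)"

lemma elem_unitri: "p < q \<Longrightarrow> q < k \<Longrightarrow> elem p q \<in> unitri k"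
  by (auto simp: unitri_def elem_def)

lemma umul_elem:
  assumes "A \<in> unitri k" "p < q"
  shows "umul A (elem p q) i j = A i j + (if j = q then A i p else 0)"
proof -
  have "umul A (elem p q) i j = (\<Sum>l\<le>j. (if l = j then A i l else 0) + (if l = p \<and> j = q then A i l else 0))"
    unfolding umul_def elem_def using assms(2) by (intro sum.cong) auto
  also have "\<dots> = A i j + (if j = q then A i p else 0)"
    using assms(2) by (cases "j = q") (simp_all add: sum.distrib)
  finally show ?thesis .
qed

lemma elem_umul:
  assumes "A \<in> unitri k" "p < q"
  shows "umul (elem p q) A i j = A i j + (if i = p then A q j else 0)"
proof -
  have "umul (elem p q) A i j = (\<Sum>l\<le>j. (if l = i then A l j else 0) + (if l = q \<and> i = p then A l j else 0))"
    unfolding umul_def elem_def using assms(2) by (intro sum.cong) auto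
  also have "\<dots> = A i j + (if i = p then A q j else 0)"
    using assms by (auto simp: sum.distrib unitri_def)
  finally show ?thesis .
qed

text \<open>The transvection in the upper right corner; over the field with two elements it is the
  only nontrivial central matrix.\<close>

definition ucentre :: "nat \<Rightarrow> 'a::comm_ring_1 smat" where
  "ucentre k = elem 0 (k - 1)"

lemma ucentre_unitri: "k \<ge> 3 \<Longrightarrow> ucentre k \<in> unitri k"
  unfolding ucentre_def by (rule elem_unitri) auto

lemma ucentre_commutes:
  assumes k: "k \<ge> 3" and A: "A \<in> unitri k"
  shows "umul A (ucentre k) = umul (ucentre k) A"
proof (intro ext)
  fix i j
  have "0 < k - 1" using k by simp
  note simps = umul_elem[OF A this] elem_umul[OF A this]
  have row: "A (k - 1) j = (if j = k - 1 then 1 else 0)"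
    using A k by (cases j "k - 1" rule: linorder_cases) (auto simp: unitri_def)
  have col: "A i 0 = (if i = 0 then 1 else 0)"
    using A by (cases i) (auto simp: unitri_def)
  show "umul A (ucentre k) i j = umul (ucentre k) A i j"
    unfolding ucentre_def simps row col by simp
qed

text \<open>Commuting with \<open>elem p q\<close> equates column \<open>p\<close> of
  \<open>A\<close>, moved to column \<open>q\<close>, with row \<open>q\<close>, moved to row
  \<open>p\<close>. The tests \<open>elem j (k - 1)\<close> and \<open>elem 0 i\<close> kill every
  entry above the diagonal except the corner, which has two possible values.\<close>

lemma unitri_central:
  fixes A :: "bit smat"
  assumes k: "k \<ge> 3" and A: "A \<in> unitri k"
    and comm: "\<And>B. B \<in> unitri k \<Longrightarrow> umul A B = umul B A"
  shows "A = uone \<or> A = ucentre k"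
proof -
  have eq: "(if j = q then A i p else 0) = (if i = p then A q j else 0)" if "p < q" "q < k" for i j p q
  proof -
    have "umul A (elem p q) i j = umul (elem p q) A i j" using comm elem_unitri that by metis
    then show ?thesis unfolding umul_elem[OF A that(1)] elem_umul[OF A that(1)] by (rule add_left_imp_eq)
  qed
  have 0: "A i j = 0" if ij: "i < j" "(i, j) \<noteq> (0, k - 1)" for i j
  proof -
    consider "k \<le> j" | "j < k - 1" | "j = k - 1" "i > 0" using ij by fastforce
    then show ?thesis
    proof cases
      case 1
      then show ?thesis using A that by (auto simp: unitri_def)
    next
      case 2
      then show ?thesis using eq[of j "k - 1" "k - 1" i] that by auto
    next
      case 3
      then show ?thesis using eq[of 0 i "k - 1" 0] that k by auto
    qed
  qed
  have A': "A i i = 1" "j < i \<Longrightarrow> A i j = 0" for i j using A by (auto simp: unitri_def)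
  have "A = (if A 0 (k - 1) = 1 then ucentre k else uone)"
  proof (intro ext)
    fix i j
    show "A i j = (if A 0 (k - 1) = 1 then ucentre k else uone) i j"
      using 0[of i j] A'(1)[of i] A'(2)[of j i] k
      by (cases i j rule: linorder_cases) (auto simp: ucentre_def elem_def uone_def)
  qed
  then show ?thesis by metis
qed

lemma ucentre_neq_uone: "k \<ge> 3 \<Longrightarrow> ucentre k \<noteq> (uone :: bit smat)"
  by (auto simp: ucentre_def elem_def uone_def fun_eq_iff)

lemma umul_ucentre_neq:
  assumes "k \<ge> 3" "A \<in> unitri k"
  shows "umul (ucentre k) A \<noteq> A"
proof
  assume "umul (ucentre k) A = A"
  then have "umul (ucentre k) A 0 (k - 1) = A 0 (k - 1)" by simp
  then show False
    using assms by (simp add: ucentre_def elem_umul[of _ k] unitri_def)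
qed

text \<open>The commutator of \<open>elem 0 (k - 2)\<close> with \<open>A\<close> is the corner
  transvection if the entry \<open>A (k - 2) (k - 1)\<close> is 1, and trivial otherwise. From
  \<open>k \<ge> 3\<close> follows \<open>0 < k - 2\<close>, so this matrix is a genuine
  transvection.\<close>

lemma second_centre_witness:
  assumes k: "k \<ge> 3"
  shows "\<exists>c\<in>unitri k :: bit smat set. (\<exists>h\<in>unitri k. umul c h \<noteq> umul h c) \<and>
    (\<forall>h\<in>unitri k. umul c h = umul h c \<or> umul c h = umul (ucentre k) (umul h c))"
proof -
  let ?c = "elem 0 (k - 2) :: bit smat" and ?h = "elem (k - 2) (k - 1) :: bit smat"
  have c: "?c \<in> unitri k" and h: "?h \<in> unitri k" using k by (auto intro!: elem_unitri)
  have lt: "0 < k - 2" "0 < k - 1" using k by auto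
  have "umul ?c ?h 0 (k - 1) \<noteq> umul ?h ?c 0 (k - 1)"
    unfolding elem_umul[OF h lt(1)] umul_elem[OF h lt(1)] using k by (auto simp: elem_def)
  then have ne: "umul ?c ?h \<noteq> umul ?h ?c" by metis
  have "umul ?c A = umul A ?c \<or> umul ?c A = umul (ucentre k) (umul A ?c)" if A: "A \<in> unitri k" for A
  proof -
    have Ac: "umul A ?c \<in> unitri k" using umul_unitri A c by blast
    have row: "A (k - 2) j = (if j = k - 2 then 1 else if j = k - 1 then A (k - 2) (k - 1) else 0)" for j
      using A k by (cases j "k - 2" rule: linorder_cases) (auto simp: unitri_def)
    have row': "A (k - 1) j = (if j = k - 1 then 1 else 0)" for j
      using A k by (cases j "k - 1" rule: linorder_cases) (auto simp: unitri_def)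
    have col: "A i 0 = (if i = 0 then 1 else 0)" for i
      using A by (cases i) (auto simp: unitri_def)
    show ?thesis
    proof (cases "A (k - 2) (k - 1) = 0")
      case True
      have "umul ?c A i j = umul A ?c i j" for i j
        unfolding elem_umul[OF A lt(1)] umul_elem[OF A lt(1)] row[of j] col True using k by auto
      then show ?thesis by blast
    next
      case False
      then have one: "A (k - 2) (k - 1) = 1" by simp
      have "umul ?c A i j = umul (ucentre k) (umul A ?c) i j" for i j
        unfolding ucentre_def elem_umul[OF Ac lt(2)] elem_umul[OF A lt(1)] umul_elem[OF A lt(1)]
          row[of j] row'[of j] row'[of 0] col one
        using k by auto
      then show ?thesis by blast
    qed
  qed
  with c h ne show ?thesis by blast
qed

section \<open>Groups of words\<close>

text \<open>An element of \<open>UT\<^sub>k(P(\<omega>\<^sup>n))\<close> is the same as a word over the finite group \<open>UT\<^sub>k\<close> of the field with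
  two elements, and matrix multiplication becomes pointwise multiplication of words.\<close>

definition words :: "nat \<Rightarrow> (nat list \<Rightarrow> bit smat) set" where
  "words k = {u. \<forall>p. u p \<in> unitri k}"

definition wclass :: "nat \<Rightarrow> nat \<Rightarrow> (nat list \<Rightarrow> bit smat) \<Rightarrow> nat \<times> nat \<Rightarrow> nat list set set" where
  "wclass n k u = (\<lambda>(i, j)\<in>{..<k} \<times> {..<k}. cls n {p. u p i j = 1})"

lemma wordsD: "u \<in> words k \<Longrightarrow> u p \<in> unitri k"
  by (simp add: words_def)

lemma wclass_carrier: "u \<in> words k \<Longrightarrow> wclass n k u \<in> carrier (U_group n k)"
  by (auto simp: wclass_def words_def U_group_def UT_def unitri_def cls_one cls_zero)

lemma U_group_carrierE:
  assumes "M \<in> carrier (U_group n k)"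
  obtains u where "u \<in> words k" "M = wclass n k u"
proof -
  have M: "M \<in> ({..<k} \<times> {..<k}) \<rightarrow>\<^sub>E carrier (omega_ring n)"
    "\<And>i. i < k \<Longrightarrow> M (i, i) = cls n UNIV" "\<And>i j. i < k \<Longrightarrow> j < i \<Longrightarrow> M (i, j) = cls n {}"
    using assms by (auto simp: U_group_def UT_def cls_one cls_zero)
  have "\<forall>x\<in>{..<k} \<times> {..<k}. \<exists>A. M x = cls n A"
    using PiE_mem[OF M(1)] by (meson omega_ring_carrierE)
  then obtain A where A: "\<And>i j. i < k \<Longrightarrow> j < k \<Longrightarrow> M (i, j) = cls n (A (i, j))"
    by (metis mem_Sigma_iff lessThan_iff)
  \<comment> \<open>Diagonal and lower entries are set exactly, not just modulo the ideal, so that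
    every letter is unitriangular.\<close>
  define u :: "nat list \<Rightarrow> bit smat" where
    "u p i j = (if i = j \<or> i < j \<and> j < k \<and> p \<in> A (i, j) then 1 else 0)" for p i j
  have "u \<in> words k" by (auto simp: words_def unitri_def u_def)
  moreover have "wclass n k u = M"
  proof (rule extensionalityI[of _ "{..<k} \<times> {..<k}"])
    show "wclass n k u \<in> extensional ({..<k} \<times> {..<k})" by (simp add: wclass_def)
    show "M \<in> extensional ({..<k} \<times> {..<k})" using M(1) by (auto simp: PiE_def)
    fix x assume "x \<in> {..<k} \<times> {..<k}"
    then obtain i j where x: "x = (i, j)" "i < k" "j < k" by auto
    show "wclass n k u x = M x"
      using x A[of i j] M(2)[of i] M(3)[of i j]
      by (cases i j rule: linorder_cases) (auto simp: wclass_def u_def)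
  qed
  ultimately show ?thesis using that by blast
qed

lemma words_umul: "u \<in> words k \<Longrightarrow> v \<in> words k \<Longrightarrow> (\<lambda>p. umul (u p) (v p)) \<in> words k"
  by (simp add: words_def umul_unitri)

lemma wclass_mult:
  assumes "u \<in> words k" "v \<in> words k"
  shows "wclass n k u \<otimes>\<^bsub>U_group n k\<^esub> wclass n k v = wclass n k (\<lambda>p. umul (u p) (v p))"
proof -
  interpret R: cring "omega_ring n" by (rule cring_omega_ring)
  have "(\<Oplus>\<^bsub>omega_ring n\<^esub>l\<in>{..<k}. wclass n k u (i, l) \<otimes>\<^bsub>omega_ring n\<^esub> wclass n k v (l, j)) =
      cls n {p. umul (u p) (v p) i j = 1}" if ij: "i < k" "j < k" for i j
  proof -
    have "(\<Oplus>\<^bsub>omega_ring n\<^esub>l\<in>{..<k}. wclass n k u (i, l) \<otimes>\<^bsub>omega_ring n\<^esub> wclass n k v (l, j)) =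
        (\<Oplus>\<^bsub>omega_ring n\<^esub>l\<in>{..<k}. cls n {p. u p i l * v p l j = 1})"
      using ij by (intro R.finsum_cong') (auto simp: wclass_def bit_mult_eq_1_iff Collect_conj_eq simp del: mult_bit_eq_and)
    also have "\<dots> = cls n {p. (\<Sum>l<k. u p i l * v p l j) = 1}"
      by (rule cls_finsum) simp
    also have "(\<lambda>p. \<Sum>l<k. u p i l * v p l j) = (\<lambda>p. umul (u p) (v p) i j)"
      unfolding umul_def using assms(2) ij
      by (intro ext sum.mono_neutral_right) (auto simp: words_def unitri_def)
    finally show ?thesis .
  qed
  then show ?thesis by (auto simp: U_group_def UT_def wclass_def[of n k "\<lambda>p. umul (u p) (v p)"] intro!: restrict_ext)
qed

lemma wclass_one: "\<one>\<^bsub>U_group n k\<^esub> = wclass n k (\<lambda>_. uone)"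
  by (auto simp: U_group_def UT_def wclass_def cls_one cls_zero uone_def intro!: restrict_ext)

text \<open>There are finitely many entries, so the null exceptional sets of the single entries
  unite to one null set.\<close>

lemma wclass_eq_iff:
  assumes "u \<in> words k" "v \<in> words k"
  shows "wclass n k u = wclass n k v \<longleftrightarrow> null n {p. u p \<noteq> v p}"
proof -
  have "wclass n k u = wclass n k v \<longleftrightarrow>
      (\<forall>x\<in>{..<k} \<times> {..<k}. null n (case x of (i, j) \<Rightarrow> {p. u p i j \<noteq> v p i j}))"
  proof -
    have "wclass n k u = wclass n k v \<longleftrightarrow>
        (\<forall>x\<in>{..<k} \<times> {..<k}. wclass n k u x = wclass n k v x)"
      by (auto simp: wclass_def restrict_def fun_eq_iff)
    also have "\<dots> \<longleftrightarrow> (\<forall>x\<in>{..<k} \<times> {..<k}. null n (case x of (i, j) \<Rightarrow> {p. u p i j \<noteq> v p i j}))"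
    proof (rule ball_cong)
      fix x assume "x \<in> {..<k} \<times> {..<k}"
      then obtain i j where x: "x = (i, j)" "i < k" "j < k" by auto
      have "a \<noteq> b \<longleftrightarrow> (a = 1) \<noteq> (b = 1)" for a b :: bit by (cases a; cases b) auto
      then have "sym_diff {p. u p i j = 1} {p. v p i j = 1} = {p. u p i j \<noteq> v p i j}" by blast
      with x show "(wclass n k u x = wclass n k v x) = null n (case x of (i, j) \<Rightarrow> {p. u p i j \<noteq> v p i j})"
        using cls_eq_iff[of n "{p. u p i j = 1}" "{p. v p i j = 1}"] by (simp add: wclass_def)
    qed simp
    finally show ?thesis .
  qed
  also have "\<dots> \<longleftrightarrow> null n (\<Union>x\<in>{..<k} \<times> {..<k}. case x of (i, j) \<Rightarrow> {p. u p i j \<noteq> v p i j})"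
    by (subst null_UN) auto
  also have "(\<Union>x\<in>{..<k} \<times> {..<k}. case x of (i, j) \<Rightarrow> {p. u p i j \<noteq> v p i j}) = {p. u p \<noteq> v p}"
  proof (intro equalityI subsetI)
    fix p assume p: "p \<in> {p. u p \<noteq> v p}"
    then obtain i j where ij: "u p i j \<noteq> v p i j" by (auto simp: fun_eq_iff)
    have "u p \<in> unitri k" "v p \<in> unitri k" using assms by (auto simp: words_def)
    with ij have "i < k \<and> j < k"
      by (cases i j rule: linorder_cases) (auto simp: unitri_def linorder_not_le[symmetric])
    with ij show "p \<in> (\<Union>x\<in>{..<k} \<times> {..<k}. case x of (i, j) \<Rightarrow> {p. u p i j \<noteq> v p i j})" by auto
  qed auto
  finally show ?thesis .
qed

lemma group_U_group: "group (U_group n k)"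
proof (rule groupI)
  show "\<one>\<^bsub>U_group n k\<^esub> \<in> carrier (U_group n k)"
    by (auto simp: wclass_one words_def uone_unitri intro: wclass_carrier)
  have one: "(\<lambda>_. uone) \<in> words k" by (simp add: words_def uone_unitri)
  fix x assume "x \<in> carrier (U_group n k)"
  then obtain u where u: "u \<in> words k" "x = wclass n k u" by (rule U_group_carrierE)
  show "\<one>\<^bsub>U_group n k\<^esub> \<otimes>\<^bsub>U_group n k\<^esub> x = x"
    using u one by (simp add: wclass_one wclass_mult uone_umul[OF wordsD])
  have "(\<lambda>p. uinv (u p)) \<in> words k" using u by (simp add: words_def uinv_unitri)
  with u show "\<exists>y\<in>carrier (U_group n k). y \<otimes>\<^bsub>U_group n k\<^esub> x = \<one>\<^bsub>U_group n k\<^esub>"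
    by (intro bexI[of _ "wclass n k (\<lambda>p. uinv (u p))"])
      (simp_all add: wclass_one wclass_mult wclass_carrier umul_uinv[OF wordsD])
  fix y assume "y \<in> carrier (U_group n k)"
  then obtain v where v: "v \<in> words k" "y = wclass n k v" by (rule U_group_carrierE)
  show "x \<otimes>\<^bsub>U_group n k\<^esub> y \<in> carrier (U_group n k)"
    using u v by (simp add: wclass_mult wclass_carrier words_umul)
  fix z assume "z \<in> carrier (U_group n k)"
  then obtain w where w: "w \<in> words k" "z = wclass n k w" by (rule U_group_carrierE)
  show "x \<otimes>\<^bsub>U_group n k\<^esub> y \<otimes>\<^bsub>U_group n k\<^esub> z = x \<otimes>\<^bsub>U_group n k\<^esub> (y \<otimes>\<^bsub>U_group n k\<^esub> z)"
    using u v w by (simp add: wclass_mult words_umul umul_assoc[OF wordsD wordsD wordsD])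
qed

lemma inv_wclass:
  assumes "u \<in> words k"
  shows "inv\<^bsub>U_group n k\<^esub> wclass n k u = wclass n k (\<lambda>p. uinv (u p))"
proof -
  have "(\<lambda>p. uinv (u p)) \<in> words k" using assms by (simp add: words_def uinv_unitri)
  then show ?thesis
    using assms by (intro group.inv_equality[OF group_U_group])
      (simp_all add: wclass_one wclass_mult wclass_carrier umul_uinv[OF wordsD])
qed

section \<open>From group isomorphisms to order isomorphisms\<close>

definition centre :: "('a, 'b) monoid_scheme \<Rightarrow> 'a set" where
  "centre G = {z \<in> carrier G. \<forall>h\<in>carrier G. z \<otimes>\<^bsub>G\<^esub> h = h \<otimes>\<^bsub>G\<^esub> z}"

text \<open>The equation says that the commutator of \<open>g\<close> and \<open>h\<close> is
  \<open>z\<close>; it avoids inverses so that a homomorphism transports it directly.\<close>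

definition second_centre :: "('a, 'b) monoid_scheme \<Rightarrow> 'a set" where
  "second_centre G = {g \<in> carrier G. \<forall>h\<in>carrier G. \<exists>z\<in>centre G. g \<otimes>\<^bsub>G\<^esub> h = z \<otimes>\<^bsub>G\<^esub> (h \<otimes>\<^bsub>G\<^esub> g)}"

definition commutators :: "('a, 'b) monoid_scheme \<Rightarrow> 'a \<Rightarrow> 'a set" where
  "commutators G g = {z \<in> centre G. \<exists>h\<in>carrier G. g \<otimes>\<^bsub>G\<^esub> h = z \<otimes>\<^bsub>G\<^esub> (h \<otimes>\<^bsub>G\<^esub> g)}"

lemma centre_iso:
  assumes "group G" "group G'" and f: "f \<in> iso G G'" and z: "z \<in> centre G"
  shows "f z \<in> centre G'"
proof -
  have hom: "\<And>x y. x \<in> carrier G \<Longrightarrow> y \<in> carrier G \<Longrightarrow> f (x \<otimes>\<^bsub>G\<^esub> y) = f x \<otimes>\<^bsub>G'\<^esub> f y"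
    and onto: "f ` carrier G = carrier G'"
    using f by (auto simp: iso_def hom_def bij_betw_def)
  have "f z \<otimes>\<^bsub>G'\<^esub> h' = h' \<otimes>\<^bsub>G'\<^esub> f z" if h': "h' \<in> carrier G'" for h'
  proof -
    obtain h where h: "h \<in> carrier G" "h' = f h" using h' onto by blast
    then show ?thesis using z hom[of z h] hom[of h z] by (auto simp: centre_def)
  qed
  then show ?thesis using z onto by (auto simp: centre_def)
qed

text \<open>Inclusions suffice: applied to the inverse isomorphism as well, they become
  equalities.\<close>

lemma second_centre_commutators_iso:
  assumes G: "group G" "group G'" and f: "f \<in> iso G G'" and g: "g \<in> carrier G"
  shows "(g \<in> second_centre G \<longrightarrow> f g \<in> second_centre G') \<and> f ` commutators G g \<subseteq> commutators G' (f g)"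
proof -
  have hom: "\<And>x y. x \<in> carrier G \<Longrightarrow> y \<in> carrier G \<Longrightarrow> f (x \<otimes>\<^bsub>G\<^esub> y) = f x \<otimes>\<^bsub>G'\<^esub> f y"
    and onto: "f ` carrier G = carrier G'"
    using f by (auto simp: iso_def hom_def bij_betw_def)
  interpret group G by fact
  have eq: "f g \<otimes>\<^bsub>G'\<^esub> f h = f z \<otimes>\<^bsub>G'\<^esub> (f h \<otimes>\<^bsub>G'\<^esub> f g)"
    if "h \<in> carrier G" "z \<in> centre G" "g \<otimes>\<^bsub>G\<^esub> h = z \<otimes>\<^bsub>G\<^esub> (h \<otimes>\<^bsub>G\<^esub> g)" for h z
  proof -
    have "z \<in> carrier G" using that(2) by (simp add: centre_def)
    then show ?thesis using that g by (metis hom m_closed)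
  qed
  note cz = centre_iso[OF G f]
  have "f g \<in> second_centre G'" if gs: "g \<in> second_centre G"
    unfolding second_centre_def
  proof (intro CollectI conjI ballI)
    show "f g \<in> carrier G'" using g onto by blast
    fix h' assume "h' \<in> carrier G'"
    then obtain h where h: "h \<in> carrier G" "h' = f h" using onto by blast
    then obtain z where "z \<in> centre G" "g \<otimes>\<^bsub>G\<^esub> h = z \<otimes>\<^bsub>G\<^esub> (h \<otimes>\<^bsub>G\<^esub> g)"
      using gs by (auto simp: second_centre_def)
    then show "\<exists>z\<in>centre G'. f g \<otimes>\<^bsub>G'\<^esub> h' = z \<otimes>\<^bsub>G'\<^esub> (h' \<otimes>\<^bsub>G'\<^esub> f g)"
      using eq h cz by blast
  qed
  moreover have "f ` commutators G g \<subseteq> commutators G' (f g)"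
    unfolding commutators_def using eq cz onto by blast
  ultimately show ?thesis by blast
qed

text \<open>Membership in the second centre of the finite group, whose centre consists of
  \<open>uone\<close> and \<open>ucentre k\<close>.\<close>

definition near_central :: "nat \<Rightarrow> bit smat \<Rightarrow> bool" where
  "near_central k A \<longleftrightarrow> (\<forall>B\<in>unitri k. umul A B = umul B A \<or> umul A B = umul (ucentre k) (umul B A))"

definition central_word :: "nat \<Rightarrow> nat list set \<Rightarrow> nat list \<Rightarrow> bit smat" where
  "central_word k A p = (if p \<in> A then ucentre k else uone)"

context
  fixes n k :: nat
  assumes k: "k \<ge> 3"
begin

lemma central_word_words: "central_word k A \<in> words k"
  using ucentre_unitri[OF k] uone_unitri by (auto simp: words_def central_word_def)

lemma umul_uone: "A \<in> unitri k \<Longrightarrow> umul A uone = (A :: bit smat)"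
  using monoid.r_one[OF group.is_monoid[OF group_UG], of A k] by (simp add: UG_def)

lemma central_word_central: "wclass n k (central_word k A) \<in> centre (U_group n k)"
proof -
  have "wclass n k (central_word k A) \<otimes>\<^bsub>U_group n k\<^esub> h = h \<otimes>\<^bsub>U_group n k\<^esub> wclass n k (central_word k A)"
    if h: "h \<in> carrier (U_group n k)" for h
  proof -
    obtain v where v: "v \<in> words k" "h = wclass n k v" using h by (rule U_group_carrierE)
    have "umul (central_word k A p) (v p) = umul (v p) (central_word k A p)" for p
      using ucentre_commutes[OF k wordsD[OF v(1)]] uone_umul[OF wordsD[OF v(1)]] umul_uone[OF wordsD[OF v(1)]]
      by (auto simp: central_word_def)
    then show ?thesis using v central_word_words by (simp add: wclass_mult)
  qed
  then show ?thesis using wclass_carrier central_word_words by (auto simp: centre_def)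
qed

lemma central_word_eq_iff:
  "wclass n k (central_word k A) = wclass n k (central_word k B) \<longleftrightarrow> null n (sym_diff A B)"
proof -
  have "{p. central_word k A p \<noteq> central_word k B p} = sym_diff A B"
    using ucentre_neq_uone[OF k] by (auto simp: central_word_def)
  then show ?thesis using wclass_eq_iff[OF central_word_words central_word_words, of n A B] by simp
qed

text \<open>Finitely many matrices give finitely many exceptional sets. Thus testing an element
  against constant words controls its letters at almost all positions.\<close>

lemma null_all_unitri:
  assumes "\<And>B. B \<in> unitri k \<Longrightarrow> null n {p. \<not> P p (B :: bit smat)}"
  shows "null n {p. \<not> (\<forall>B\<in>unitri k. P p B)}"
proof -
  have "{p. \<not> (\<forall>B\<in>unitri k. P p B)} = (\<Union>B\<in>unitri k. {p. \<not> P p B})" by auto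
  then show ?thesis using assms by (simp add: null_UN finite_unitri)
qed

lemma centre_U_groupE:
  assumes "z \<in> centre (U_group n k)"
  obtains A where "z = wclass n k (central_word k A)"
proof -
  obtain u where u: "u \<in> words k" "z = wclass n k u"
    using assms by (auto simp: centre_def elim: U_group_carrierE)
  have "null n {p. \<not> umul (u p) B = umul B (u p)}" if "B \<in> unitri k" for B
  proof -
    have B: "(\<lambda>_. B) \<in> words k" using that by (simp add: words_def)
    have "z \<otimes>\<^bsub>U_group n k\<^esub> wclass n k (\<lambda>_. B) = wclass n k (\<lambda>_. B) \<otimes>\<^bsub>U_group n k\<^esub> z"
      using assms wclass_carrier[OF B] by (auto simp: centre_def)
    then show ?thesis
      using u B by (simp add: wclass_mult wclass_eq_iff words_umul)
  qed
  then have nul: "null n {p. \<not> (\<forall>B\<in>unitri k. umul (u p) B = umul B (u p))}" by (rule null_all_unitri)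
  define A where "A = {p. u p = ucentre k}"
  have "{p. u p \<noteq> central_word k A p} \<subseteq> {p. \<not> (\<forall>B\<in>unitri k. umul (u p) B = umul B (u p))}"
    using unitri_central[OF k wordsD[OF u(1)]] by (auto simp: A_def central_word_def)
  then have "z = wclass n k (central_word k A)"
    using nul u central_word_words by (auto simp: wclass_eq_iff intro: null_mono)
  then show ?thesis using that by blast
qed

text \<open>The principal ideal generated by \<open>A\<close> in the copy of the Boolean ring formed
  by the centre.\<close>

definition central_below :: "nat list set \<Rightarrow> (nat \<times> nat \<Rightarrow> nat list set set) set" where
  "central_below A = {wclass n k (central_word k B) |B. null n (B - A)}"

lemma central_below_subset_iff: "central_below A \<subseteq> central_below B \<longleftrightarrow> null n (A - B)"
proof
  assume "central_below A \<subseteq> central_below B"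
  moreover have "wclass n k (central_word k A) \<in> central_below A" by (auto simp: central_below_def)
  ultimately obtain C where "wclass n k (central_word k A) = wclass n k (central_word k C)" "null n (C - B)"
    by (auto simp: central_below_def)
  then have "null n (sym_diff A C \<union> (C - B))" by (simp add: central_word_eq_iff)
  then show "null n (A - B)" by (rule null_mono) blast
next
  assume AB: "null n (A - B)"
  have "null n (C - B)" if "null n (C - A)" for C
  proof -
    have "null n ((C - A) \<union> (A - B))" using that AB by simp
    then show ?thesis by (rule null_mono) blast
  qed
  then show "central_below A \<subseteq> central_below B" by (auto simp: central_below_def)
qed

text \<open>Where \<open>u p\<close> is central, commutators are trivial. Elsewhere, off a null set,
  exactly \<open>uone\<close> and \<open>ucentre k\<close> occur as commutators of
  \<open>u p\<close>, so choosing the partner position by position realises every subset of these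
  positions.\<close>

lemma commutators_eq:
  assumes u: "u \<in> words k"
    and sc: "null n {p. \<not> near_central k (u p)}"
  shows "commutators (U_group n k) (wclass n k u) =
    central_below {p. \<exists>B\<in>unitri k. umul (u p) B \<noteq> umul B (u p)}" (is "_ = central_below ?A")
proof -
  have mem: "(\<exists>h\<in>carrier (U_group n k). wclass n k u \<otimes>\<^bsub>U_group n k\<^esub> h =
        wclass n k (central_word k C) \<otimes>\<^bsub>U_group n k\<^esub> (h \<otimes>\<^bsub>U_group n k\<^esub> wclass n k u)) \<longleftrightarrow> null n (C - ?A)"
    (is "?L \<longleftrightarrow> _") for C
  proof
    assume ?L
    then obtain v where v: "v \<in> words k" and eq: "wclass n k u \<otimes>\<^bsub>U_group n k\<^esub> wclass n k v =
        wclass n k (central_word k C) \<otimes>\<^bsub>U_group n k\<^esub> (wclass n k v \<otimes>\<^bsub>U_group n k\<^esub> wclass n k u)"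
      by (auto elim: U_group_carrierE)
    then have nul: "null n {p. umul (u p) (v p) \<noteq> umul (central_word k C p) (umul (v p) (u p))}"
      using u central_word_words[of C] by (simp add: wclass_mult words_umul wclass_eq_iff)
    have "umul (u p) (v p) \<noteq> umul (central_word k C p) (umul (v p) (u p))" if "p \<in> C - ?A" for p
    proof -
      have "umul (u p) (v p) = umul (v p) (u p)" using that wordsD[OF v] by auto
      moreover have "umul (ucentre k) (umul (v p) (u p)) \<noteq> umul (v p) (u p)"
        using umul_ucentre_neq[OF k] umul_unitri wordsD u v by blast
      ultimately show ?thesis using that by (simp add: central_word_def)
    qed
    then show "null n (C - ?A)" using null_mono[OF nul] by blast
  next
    assume C: "null n (C - ?A)"
    define v where "v p = (if p \<in> C \<inter> ?A then SOME B. B \<in> unitri k \<and> umul (u p) B \<noteq> umul B (u p) else uone)" for p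
    have v1: "v p \<in> unitri k \<and> umul (u p) (v p) \<noteq> umul (v p) (u p)" if "p \<in> C \<inter> ?A" for p
    proof -
      have "\<exists>B. B \<in> unitri k \<and> umul (u p) B \<noteq> umul B (u p)" using that by auto
      from someI_ex[OF this] show ?thesis using that by (simp add: v_def)
    qed
    have v2: "v p = uone" if "p \<notin> C \<inter> ?A" for p using that by (simp only: v_def if_False)
    have v: "v \<in> words k" unfolding words_def 
    proof (intro CollectI allI)
      fix p show "v p \<in> unitri k"
      proof (cases "p \<in> C \<inter> ?A")
        case True
        then show ?thesis using v1 by blast
      next
        case False
        from v2[OF this] show ?thesis by (simp only: uone_unitri)
      qed
    qed
    have "null n ((C - ?A) \<union> {p. \<not> near_central k (u p)})"
      using C sc by simp
    moreover have "umul (u p) (v p) = umul (central_word k C p) (umul (v p) (u p))"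
      if p: "p \<notin> C - ?A" "near_central k (u p)" for p
    proof (cases "p \<in> C \<inter> ?A")
      case True
      then show ?thesis using v1[OF True] p(2) by (auto simp: central_word_def near_central_def)
    next
      case False
      with p(1) have "p \<notin> C" by blast
      then show ?thesis using v2[OF False] wordsD[OF u, of p]
        by (simp add: central_word_def uone_umul umul_uone)
    qed
    then have "{p. umul (u p) (v p) \<noteq> umul (central_word k C p) (umul (v p) (u p))} \<subseteq>
      (C - ?A) \<union> {p. \<not> near_central k (u p)}"
      by blast
    ultimately have "null n {p. umul (u p) (v p) \<noteq> umul (central_word k C p) (umul (v p) (u p))}"
      by (rule null_mono)
    then have "wclass n k u \<otimes>\<^bsub>U_group n k\<^esub> wclass n k v =
        wclass n k (central_word k C) \<otimes>\<^bsub>U_group n k\<^esub> (wclass n k v \<otimes>\<^bsub>U_group n k\<^esub> wclass n k u)"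
      using u v central_word_words[of C] by (simp add: wclass_mult words_umul wclass_eq_iff)
    then show ?L using wclass_carrier[OF v] by blast
  qed
  show ?thesis
  proof (intro equalityI subsetI)
    fix z assume z: "z \<in> commutators (U_group n k) (wclass n k u)"
    then obtain C where C: "z = wclass n k (central_word k C)"
      by (auto simp: commutators_def elim: centre_U_groupE)
    then have "null n (C - ?A)" using z mem[of C] by (auto simp: commutators_def)
    then show "z \<in> central_below ?A" using C by (auto simp: central_below_def)
  next
    fix z assume "z \<in> central_below ?A"
    then obtain C where "z = wclass n k (central_word k C)" "null n (C - ?A)"
      by (auto simp: central_below_def)
    then show "z \<in> commutators (U_group n k) (wclass n k u)"
      using mem[of C] central_word_central by (auto simp: commutators_def)
  qed
qed

lemma second_centre_commutators:
  assumes "g \<in> second_centre (U_group n k)"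
  shows "\<exists>A. commutators (U_group n k) g = central_below A"
proof -
  obtain u where u: "u \<in> words k" "g = wclass n k u"
    using assms by (auto simp: second_centre_def elim: U_group_carrierE)
  have "null n {p. \<not> (umul (u p) B = umul B (u p) \<or> umul (u p) B = umul (ucentre k) (umul B (u p)))}"
    if "B \<in> unitri k" for B
  proof -
    have B: "(\<lambda>_. B) \<in> words k" using that by (simp add: words_def)
    obtain C where "g \<otimes>\<^bsub>U_group n k\<^esub> wclass n k (\<lambda>_. B) =
        wclass n k (central_word k C) \<otimes>\<^bsub>U_group n k\<^esub> (wclass n k (\<lambda>_. B) \<otimes>\<^bsub>U_group n k\<^esub> g)"
      using assms wclass_carrier[OF B, of n] unfolding second_centre_def
      by (auto elim!: ballE[of _ _ "wclass n k (\<lambda>_. B)"] elim: centre_U_groupE)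
    then have "null n {p. umul (u p) B \<noteq> umul (central_word k C p) (umul B (u p))}"
      using u B central_word_words[of C] by (simp add: wclass_mult words_umul wclass_eq_iff)
    then show ?thesis
      by (rule null_mono)
        (use uone_umul[OF umul_unitri[OF \<open>B \<in> unitri k\<close> wordsD[OF u(1)]]] in \<open>auto simp: central_word_def split: if_splits\<close>)
  qed
  then have "null n {p. \<not> near_central k (u p)}"
    unfolding near_central_def by (rule null_all_unitri)
  from commutators_eq[OF u(1) this] u(2) show ?thesis by blast
qed

lemma second_centre_realizes:
  "\<exists>g\<in>second_centre (U_group n k). commutators (U_group n k) g = central_below A"
proof -
  obtain c :: "bit smat" where c: "c \<in> unitri k" "\<exists>h\<in>unitri k. umul c h \<noteq> umul h c"
    "\<forall>h\<in>unitri k. umul c h = umul h c \<or> umul c h = umul (ucentre k) (umul h c)"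
    using second_centre_witness[OF k] by blast
  \<comment> \<open>With the noncentral \<open>c\<close> on \<open>A\<close> and the identity
    elsewhere, nontrivial commutators are possible exactly at the positions in
    \<open>A\<close>.\<close>
  define u where "u p = (if p \<in> A then c else uone)" for p
  have u: "u \<in> words k" using c(1) uone_unitri by (auto simp: words_def u_def)
  have comm: "umul (u p) B = umul B (u p) \<or> umul (u p) B = umul (ucentre k) (umul B (u p))"
    if "B \<in> unitri k" for p B
    using that c(3) by (auto simp: u_def uone_umul umul_uone)
  have "{p. \<exists>B\<in>unitri k. umul (u p) B \<noteq> umul B (u p)} = A"
    using c(2) by (auto simp: u_def uone_umul umul_uone)
  then have "commutators (U_group n k) (wclass n k u) = central_below A"
    using commutators_eq[OF u] comm by (simp add: near_central_def)
  moreover have "wclass n k u \<in> second_centre (U_group n k)"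
    unfolding second_centre_def
  proof (intro CollectI conjI ballI)
    fix h assume "h \<in> carrier (U_group n k)"
    then obtain v where v: "v \<in> words k" "h = wclass n k v" by (rule U_group_carrierE)
    define C where "C = {p. umul (u p) (v p) \<noteq> umul (v p) (u p)}"
    have "umul (u p) (v p) = umul (central_word k C p) (umul (v p) (u p))" for p
      using comm[OF wordsD[OF v(1)], of p p] uone_umul[OF umul_unitri[OF wordsD[OF v(1)] wordsD[OF u]]]
      by (auto simp: central_word_def C_def)
    then have "wclass n k u \<otimes>\<^bsub>U_group n k\<^esub> h =
        wclass n k (central_word k C) \<otimes>\<^bsub>U_group n k\<^esub> (h \<otimes>\<^bsub>U_group n k\<^esub> wclass n k u)"
      using u v central_word_words[of C] by (simp add: wclass_mult words_umul)
    then show "\<exists>z\<in>centre (U_group n k). wclass n k u \<otimes>\<^bsub>U_group n k\<^esub> h =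
        z \<otimes>\<^bsub>U_group n k\<^esub> (h \<otimes>\<^bsub>U_group n k\<^esub> wclass n k u)"
      using central_word_central by blast
  qed (use wclass_carrier u in auto)
  ultimately show ?thesis by blast
qed

end

text \<open>A set \<open>A\<close> is represented by an element of the second centre whose
  commutators form the ideal below \<open>A\<close>. Its image lies in the second centre of the
  other group, so its commutators form the ideal below some \<open>H A\<close>. Inclusion of such
  ideals is the order modulo null sets, and the inverse isomorphism gives surjectivity.\<close>

lemma U_group_iso_order_iso:
  assumes k: "k \<ge> 3" and iso: "U_group n k \<cong> U_group m k"
  shows "\<exists>H. (\<forall>X Y. null n (X - Y) \<longleftrightarrow> null m (H X - H Y)) \<and>
    (\<forall>Z. \<exists>X. null m (H X - Z) \<and> null m (Z - H X))"
proof -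
  let ?G = "U_group n k" and ?G' = "U_group m k"
  note G = group_U_group[of n k] and G' = group_U_group[of m k]
  obtain f where f: "f \<in> iso ?G ?G'" using iso by (auto simp: is_iso_def)
  define f' where "f' = inv_into (carrier ?G) f"
  have f': "f' \<in> iso ?G' ?G" unfolding f'_def using group.iso_set_sym[OF G f] .
  have bij: "bij_betw f (carrier ?G) (carrier ?G')" using f by (simp add: iso_def)
  have ff': "f' (f x) = x" if "x \<in> carrier ?G" for x
    using that bij by (simp add: f'_def bij_betw_def)
  have f'f: "f (f' y) = y" if "y \<in> carrier ?G'" for y
    using that bij by (simp add: f'_def bij_betw_def f_inv_into_f)
  have carr: "f' y \<in> carrier ?G" if "y \<in> carrier ?G'" for y
    using that f' by (auto simp: iso_def hom_def)
  have carr': "f x \<in> carrier ?G'" if "x \<in> carrier ?G" for x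
    using that f by (auto simp: iso_def hom_def)
  have sub: "commutators ?G g \<subseteq> carrier ?G" for g by (auto simp: commutators_def centre_def)
  have sub': "commutators ?G' g \<subseteq> carrier ?G'" for g by (auto simp: commutators_def centre_def)
  have comm: "commutators ?G' (f g) = f ` commutators ?G g" if g: "g \<in> carrier ?G" for g
  proof
    show "f ` commutators ?G g \<subseteq> commutators ?G' (f g)"
      using second_centre_commutators_iso[OF G G' f g] by blast
    have "f' ` commutators ?G' (f g) \<subseteq> commutators ?G g"
      using second_centre_commutators_iso[OF G' G f' carr'[OF g]] ff'[OF g] by simp
    moreover have "y = f (f' y)" if "y \<in> commutators ?G' (f g)" for y
      using that sub' f'f by force
    ultimately show "commutators ?G' (f g) \<subseteq> f ` commutators ?G g" by blast
  qed
  obtain c where c: "\<And>A. c A \<in> second_centre ?G" "\<And>A. commutators ?G (c A) = central_below n k A"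
    using second_centre_realizes[OF k, of n] by metis
  have cc: "c A \<in> carrier ?G" for A using c(1) by (simp add: second_centre_def)
  have "\<forall>A. \<exists>B. commutators ?G' (f (c A)) = central_below m k B"
    using second_centre_commutators[OF k] second_centre_commutators_iso[OF G G' f cc] c(1) by blast
  then obtain H where H: "\<And>A. commutators ?G' (f (c A)) = central_below m k (H A)" by metis
  have img: "f ` central_below n k A = central_below m k (H A)" for A
    using comm[OF cc[of A]] c(2)[of A] H[of A] by simp
  have inC: "central_below n k A \<subseteq> carrier ?G" for A using sub c(2) by metis
  have "null n (X - Y) \<longleftrightarrow> null m (H X - H Y)" for X Y
  proof -
    have "null n (X - Y) \<longleftrightarrow> central_below n k X \<subseteq> central_below n k Y"
      by (simp add: central_below_subset_iff[OF k])
    also have "\<dots> \<longleftrightarrow> f ` central_below n k X \<subseteq> f ` central_below n k Y"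
      using inj_on_image_mem_iff[OF bij_betw_imp_inj_on[OF bij]] inC by (smt (verit) image_mono image_subset_iff subset_iff)
    also have "\<dots> \<longleftrightarrow> null m (H X - H Y)" by (simp add: img central_below_subset_iff[OF k])
    finally show ?thesis .
  qed
  moreover have "\<exists>X. null m (H X - Z) \<and> null m (Z - H X)" for Z
  proof -
    obtain g' where g': "g' \<in> second_centre ?G'" "commutators ?G' g' = central_below m k Z"
      using second_centre_realizes[OF k] by blast
    then have g'c: "g' \<in> carrier ?G'" by (simp add: second_centre_def)
    have "f' g' \<in> second_centre ?G"
      using second_centre_commutators_iso[OF G' G f' g'c] g'(1) by blast
    then obtain X where X: "commutators ?G (f' g') = central_below n k X"
      using second_centre_commutators[OF k] by blast
    have "central_below m k Z = f ` central_below n k X"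
      using comm[OF carr[OF g'c]] f'f[OF g'c] X g'(2) by simp
    then have "central_below m k Z = central_below m k (H X)" using img by simp
    then show ?thesis using central_below_subset_iff[OF k] by blast
  qed
  ultimately show ?thesis by blast
qed

section \<open>Back and forth under CH\<close>

text \<open>The indices will be pairs of sets and \<open>g\<close> one of the projections, so that
  corresponding Boolean combinations on both sides share \<open>P\<close> and
  \<open>N\<close>.\<close>

definition cell :: "('c \<Rightarrow> 'x set) \<Rightarrow> 'c set \<Rightarrow> 'c set \<Rightarrow> 'x set" where
  "cell g P N = {x. (\<forall>c\<in>P. x \<in> g c) \<and> (\<forall>c\<in>N. x \<notin> g c)}"

text \<open>The pairing induces an isomorphism between the generated subalgebras modulo null sets.
  As a relation it can be reversed, which serves both directions of the back-and-forth, and sets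
  equal modulo null sets may have several partners.\<close>

definition partial_iso :: "nat \<Rightarrow> nat \<Rightarrow> (nat list set \<times> nat list set) set \<Rightarrow> bool" where
  "partial_iso m n f \<longleftrightarrow> (\<forall>P N. finite P \<and> finite N \<and> P \<subseteq> f \<and> N \<subseteq> f \<longrightarrow>
     (null m (cell fst P N) \<longleftrightarrow> null n (cell snd P N)))"

lemma partial_isoD: "partial_iso m n f \<Longrightarrow> finite P \<Longrightarrow> finite N \<Longrightarrow> P \<subseteq> f \<Longrightarrow> N \<subseteq> f \<Longrightarrow>
    null m (cell fst P N) \<longleftrightarrow> null n (cell snd P N)"
  by (simp add: partial_iso_def)

lemma partial_iso_mono: "partial_iso m n f \<Longrightarrow> g \<subseteq> f \<Longrightarrow> partial_iso m n g"
  unfolding partial_iso_def by (meson subset_trans)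

lemma partial_iso_converse: "partial_iso m n f \<Longrightarrow> partial_iso n m (f\<inverse>)"
  unfolding partial_iso_def[of n]
proof (intro allI impI)
  fix P N :: "(nat list set \<times> nat list set) set"
  assume f: "partial_iso m n f" and PN: "finite P \<and> finite N \<and> P \<subseteq> f\<inverse> \<and> N \<subseteq> f\<inverse>"
  have "null m (cell fst (P\<inverse>) (N\<inverse>)) \<longleftrightarrow> null n (cell snd (P\<inverse>) (N\<inverse>))"
    using PN by (intro partial_isoD[OF f]) auto
  moreover have "cell fst (P\<inverse>) (N\<inverse>) = cell snd P N" "cell snd (P\<inverse>) (N\<inverse>) = cell fst P N"
    by (force simp: cell_def)+
  ultimately show "null n (cell fst P N) \<longleftrightarrow> null m (cell snd P N)" by simp
qed

lemma partial_iso_finitary: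
  assumes "\<And>E. finite E \<Longrightarrow> E \<subseteq> f \<Longrightarrow> partial_iso m n E"
  shows "partial_iso m n f"
  unfolding partial_iso_def
proof (intro allI impI)
  fix P N assume PN: "finite P \<and> finite N \<and> P \<subseteq> f \<and> N \<subseteq> f"
  then have "partial_iso m n (P \<union> N)" by (intro assms) auto
  then show "null m (cell fst P N) \<longleftrightarrow> null n (cell snd P N)" using PN by (intro partial_isoD) auto
qed

lemma not_null_UNIV: "\<not> null n UNIV"
  using not_null_omega_pow null_mono by blast

lemma partial_iso_empty: "partial_iso m n {}"
  by (auto simp: partial_iso_def cell_def not_null_UNIV)

abbreviation side :: "bool \<Rightarrow> 'x set \<Rightarrow> 'x set" where
  "side s a \<equiv> if s then a else - a"

lemma partial_iso_insert:
  assumes f: "partial_iso m n f"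
    and ab: "\<And>P N s. finite P \<Longrightarrow> finite N \<Longrightarrow> P \<subseteq> f \<Longrightarrow> N \<subseteq> f \<Longrightarrow>
      null m (cell fst P N \<inter> side s a) \<longleftrightarrow> null n (cell snd P N \<inter> side s b)"
  shows "partial_iso m n (insert (a, b) f)"
  unfolding partial_iso_def
proof (intro allI impI)
  fix P N assume PN: "finite P \<and> finite N \<and> P \<subseteq> insert (a, b) f \<and> N \<subseteq> insert (a, b) f"
  let ?P = "P - {(a, b)}" and ?N = "N - {(a, b)}"
  have fin: "finite ?P" "finite ?N" "?P \<subseteq> f" "?N \<subseteq> f" using PN by auto
  consider "(a, b) \<in> P" "(a, b) \<in> N" | "(a, b) \<in> P" "(a, b) \<notin> N" | "(a, b) \<notin> P" "(a, b) \<in> N" | "(a, b) \<notin> P" "(a, b) \<notin> N"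
    by blast
  then show "null m (cell fst P N) \<longleftrightarrow> null n (cell snd P N)"
  proof cases
    case 1
    then have "cell fst P N = {}" "cell snd P N = {}" unfolding cell_def by force+
    then show ?thesis by simp
  next
    case 2
    then have "cell fst P N = cell fst ?P ?N \<inter> side True a" "cell snd P N = cell snd ?P ?N \<inter> side True b"
      unfolding cell_def by (auto split: prod.splits) 
    then show ?thesis using ab[OF fin, of True] by simp
  next
    case 3
    then have "cell fst P N = cell fst ?P ?N \<inter> side False a" "cell snd P N = cell snd ?P ?N \<inter> side False b"
      unfolding cell_def by (auto split: prod.splits)
    then show ?thesis using ab[OF fin, of False] by simp
  next
    case 4
    then show ?thesis using PN by (intro partial_isoD[OF f]) auto
  qed
qed

lemma partial_iso_insertD:
  assumes "partial_iso m n (insert (a, b) f)" "finite P" "finite N" "P \<subseteq> f" "N \<subseteq> f"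
  shows "null m (cell fst P N \<inter> side s a) \<longleftrightarrow> null n (cell snd P N \<inter> side s b)"
proof -
  let ?P = "if s then insert (a, b) P else P" and ?N = "if s then N else insert (a, b) N"
  have "cell fst P N \<inter> side s a = cell fst ?P ?N" "cell snd P N \<inter> side s b = cell snd ?P ?N"
    by (auto simp: cell_def)
  moreover have "null m (cell fst ?P ?N) \<longleftrightarrow> null n (cell snd ?P ?N)"
    using assms by (intro partial_isoD[OF assms(1)]) auto
  ultimately show ?thesis by simp
qed

text \<open>Alternate members of the infinite set of heads with non-null slices go to the two parts;
  this is atomlessness of the quotient.\<close>

lemma not_null_split:
  assumes "\<not> null n B" "n \<ge> 1"
  shows "\<exists>C\<subseteq>B. \<not> null n C \<and> \<not> null n (B - C)"
proof -
  obtain n' where n: "n = Suc n'" using assms(2) by (cases n) auto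
  define S where "S = {c. \<not> null n' (slice B c)}"
  have inf: "infinite S" using assms(1) by (simp add: S_def n)
  define S0 where "S0 = enumerate S ` {i. even i}"
  have inj: "inj (enumerate S)" using strict_mono_enumerate[OF inf] strict_mono_imp_inj_on by blast
  have "infinite {i::nat. even i}" "infinite {i::nat. odd i}"
    unfolding infinite_nat_iff_unbounded_le
  proof safe
    fix m :: nat
    show "\<exists>i\<ge>m. i \<in> {i. even i}" by (intro exI[of _ "2 * m"]) auto
    show "\<exists>i\<ge>m. i \<in> {i. odd i}" by (intro exI[of _ "Suc (2 * m)"]) auto
  qed
  then have i0: "infinite S0" "infinite (enumerate S ` {i. odd i})"
    unfolding S0_def using finite_imageD inj inj_on_subset by blast+
  have "enumerate S ` {i. odd i} \<subseteq> S - S0"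
    using inj enumerate_in_set[OF inf] by (auto simp: S0_def inj_on_def)
  then have i1: "infinite (S - S0)" using i0(2) finite_subset by blast
  define C where "C = {x \<in> B. x \<noteq> [] \<and> hd x \<in> S0}"
  have "S0 \<subseteq> {c. \<not> null n' (slice C c)}"
  proof
    fix c assume c: "c \<in> S0"
    then have "c \<in> S" using enumerate_in_set[OF inf] by (auto simp: S0_def)
    moreover have "slice C c = slice B c" using c by (auto simp: C_def)
    ultimately show "c \<in> {c. \<not> null n' (slice C c)}" by (simp add: S_def)
  qed
  moreover have "S - S0 \<subseteq> {c. \<not> null n' (slice (B - C) c)}"
  proof
    fix c assume c: "c \<in> S - S0"
    then have "slice (B - C) c = slice B c" by (auto simp: C_def)
    then show "c \<in> {c. \<not> null n' (slice (B - C) c)}" using c by (simp add: S_def)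
  qed
  ultimately have "\<not> null n C \<and> \<not> null n (B - C)"
    using i0(1) i1 unfolding n null.simps by (meson finite_subset)
  then show ?thesis by (intro exI[of _ C]) (auto simp: C_def)
qed

definition atom :: "('c \<Rightarrow> 'x set) \<Rightarrow> 'c set \<Rightarrow> 'c set \<Rightarrow> 'x set" where
  "atom g K S = cell g S (K - S)"

lemma cell_Un_atom:
  assumes "P \<subseteq> K" "N \<subseteq> K"
  shows "cell g P N = (\<Union>S\<in>{S \<in> Pow K. P \<subseteq> S \<and> N \<inter> S = {}}. atom g K S)"
proof (intro equalityI subsetI)
  fix x assume x: "x \<in> cell g P N"
  let ?S = "{c \<in> K. x \<in> g c}"
  have "?S \<in> {S \<in> Pow K. P \<subseteq> S \<and> N \<inter> S = {}}" "x \<in> atom g K ?S"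
    using x assms by (auto simp: cell_def atom_def)
  then show "x \<in> (\<Union>S\<in>{S \<in> Pow K. P \<subseteq> S \<and> N \<inter> S = {}}. atom g K S)" by blast
next
  fix x assume "x \<in> (\<Union>S\<in>{S \<in> Pow K. P \<subseteq> S \<and> N \<inter> S = {}}. atom g K S)"
  then show "x \<in> cell g P N" using assms unfolding cell_def atom_def by blast
qed

lemma atom_disjoint: "S \<subseteq> K \<Longrightarrow> S' \<subseteq> K \<Longrightarrow> S \<noteq> S' \<Longrightarrow> atom g K S \<inter> atom g K S' = {}"
  unfolding atom_def cell_def by blast

text \<open>Finitely many sets cut the space into disjoint atoms, and the partner of
  \<open>a\<close> can be prescribed in each atom separately. Where \<open>a\<close> splits an atom
  into two non-null parts, atomlessness splits the corresponding atom; otherwise the empty set or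
  the whole atom will do.\<close>

lemma partial_iso_extend_finite:
  assumes K: "finite K" "partial_iso m n K" and n: "n \<ge> 1"
  shows "\<exists>b. partial_iso m n (insert (a, b) K)"
proof -
  let ?A = "atom fst K" and ?B = "atom snd K"
  have "\<exists>\<beta>\<subseteq>?B S. (null m (?A S \<inter> a) \<longleftrightarrow> null n \<beta>) \<and> (null m (?A S \<inter> - a) \<longleftrightarrow> null n (?B S - \<beta>))"
    if S: "S \<subseteq> K" for S
  proof -
    have eq: "null m (?A S) \<longleftrightarrow> null n (?B S)"
      unfolding atom_def using K S finite_subset by (intro partial_isoD[OF K(2)]) auto
    have A: "null m (?A S) \<longleftrightarrow> null m (?A S \<inter> a) \<and> null m (?A S \<inter> - a)"
      unfolding null_Un[symmetric] Int_Un_distrib[symmetric] by simp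
    consider "null m (?A S \<inter> a)" | "\<not> null m (?A S \<inter> a)" "null m (?A S \<inter> - a)"
      | "\<not> null m (?A S \<inter> a)" "\<not> null m (?A S \<inter> - a)" by blast
    then show ?thesis
    proof cases
      case 1
      then show ?thesis using eq A by (intro exI[of _ "{}"]) auto
    next
      case 2
      then show ?thesis using eq A by (intro exI[of _ "?B S"]) auto
    next
      case 3
      then have "\<not> null n (?B S)" using eq A by blast
      from not_null_split[OF this n] show ?thesis using 3 by blast
    qed
  qed
  then obtain \<beta> where \<beta>: "\<And>S. S \<subseteq> K \<Longrightarrow> \<beta> S \<subseteq> ?B S"
    "\<And>S. S \<subseteq> K \<Longrightarrow> null m (?A S \<inter> a) \<longleftrightarrow> null n (\<beta> S)"
    "\<And>S. S \<subseteq> K \<Longrightarrow> null m (?A S \<inter> - a) \<longleftrightarrow> null n (?B S - \<beta> S)" by metis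
  define b where "b = (\<Union>S\<in>Pow K. \<beta> S)"
  have bS: "?B S \<inter> b = \<beta> S" if "S \<subseteq> K" for S
  proof
    show "?B S \<inter> b \<subseteq> \<beta> S"
    proof
      fix x assume "x \<in> ?B S \<inter> b"
      then obtain S' where S': "S' \<subseteq> K" "x \<in> \<beta> S'" "x \<in> ?B S" by (auto simp: b_def)
      then have "x \<in> ?B S'" using \<beta>(1) by blast
      then have "S = S'" using atom_disjoint[OF that S'(1), of snd] S'(3) by auto
      then show "x \<in> \<beta> S" using S' by simp
    qed
  qed (use that \<beta>(1) in \<open>auto simp: b_def\<close>)
  have eq: "null m (?A S \<inter> side s a) \<longleftrightarrow> null n (?B S \<inter> side s b)" if "S \<subseteq> K" for S s
  proof -
    have "?B S \<inter> - b = ?B S - \<beta> S" using bS[OF that] by blast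
    then show ?thesis using \<beta>(2,3)[OF that] bS[OF that] by simp
  qed
  have "partial_iso m n (insert (a, b) K)"
  proof (rule partial_iso_insert[OF K(2)])
    fix P N s assume PN: "P \<subseteq> K" "N \<subseteq> K"
    let ?I = "{S \<in> Pow K. P \<subseteq> S \<and> N \<inter> S = {}}"
    have fin: "finite ?I" using K(1) by simp
    show "null m (cell fst P N \<inter> side s a) \<longleftrightarrow> null n (cell snd P N \<inter> side s b)"
      unfolding cell_Un_atom[OF PN] Int_UN_distrib2 UN_extend_simps null_UN[OF fin] using eq by simp
  qed
  then show ?thesis by blast
qed

text \<open>Countable saturation: since the ideal has the form \<open>Fin \<otimes> J\<close>, the solutions \<open>b l\<close> of the first \<open>l\<close>
  requirements can be glued along consecutive intervals of slices.\<close>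

lemma saturation:
  fixes T :: "nat \<Rightarrow> nat list set \<Rightarrow> nat list set" and Z :: "nat \<Rightarrow> bool"
  assumes local: "\<And>j b b' c. slice b c = slice b' c \<Longrightarrow> slice (T j b) c = slice (T j b') c"
    and b: "\<And>l j. j < l \<Longrightarrow> null (Suc n) (T j (b l)) \<longleftrightarrow> Z j"
  shows "\<exists>b. \<forall>j. null (Suc n) (T j b) \<longleftrightarrow> Z j"
proof -
  \<comment> \<open>Null requirements need every slice from some point on, non-null ones infinitely
    many witnessing slices. \<open>P\<close> and \<open>Q\<close> state what an interval governed by
    \<open>b l\<close> has to provide for each sort.\<close>
  define P where "P l x \<longleftrightarrow> (\<forall>c\<ge>x. \<forall>j<l. Z j \<longrightarrow> null n (slice (T j (b l)) c))" for l x
  define Q where "Q l x y \<longleftrightarrow> x < y \<and> (\<forall>j<l. \<not> Z j \<longrightarrow> (\<exists>c\<in>{x..<y}. \<not> null n (slice (T j (b l)) c)))" for l x y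
  have exP: "\<exists>x. \<forall>y\<ge>x. P l y" for l
  proof -
    have "finite (\<Union>j\<in>{j. j < l \<and> Z j}. {c. \<not> null n (slice (T j (b l)) c)})"
      using b[of _ l] by auto
    then obtain x where x: "\<forall>c\<in>(\<Union>j\<in>{j. j < l \<and> Z j}. {c. \<not> null n (slice (T j (b l)) c)}). c < x"
      using finite_nat_set_iff_bounded by blast
    then have "P l y" if "y \<ge> x" for y
      using that unfolding P_def by (auto simp: linorder_not_le[symmetric]) (meson linorder_not_le order_trans)
    then show ?thesis by blast
  qed
  have exQ: "\<exists>y0. \<forall>y\<ge>y0. Q l x y" for l x
  proof -
    have "\<exists>c\<ge>x. \<not> null n (slice (T j (b l)) c)" if "j < l" "\<not> Z j" for j
    proof -
      have "infinite {c. \<not> null n (slice (T j (b l)) c)}" using b[of j l] that by simp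
      then show ?thesis by (auto simp: infinite_nat_iff_unbounded_le)
    qed
    then obtain w where w: "\<And>j. j < l \<Longrightarrow> \<not> Z j \<Longrightarrow> w j \<ge> x \<and> \<not> null n (slice (T j (b l)) (w j))" by metis
    have "Q l x y" if y: "y \<ge> Suc (x + (\<Sum>j<l. w j))" for y
      unfolding Q_def
    proof (intro conjI allI impI)
      show "x < y" using y by simp
      fix j assume j: "j < l" "\<not> Z j"
      have "w j \<le> (\<Sum>j<l. w j)" using j by (intro member_le_sum) auto
      then show "\<exists>c\<in>{x..<y}. \<not> null n (slice (T j (b l)) c)" using w[OF j] y by (intro bexI[of _ "w j"]) auto
    qed
    then show ?thesis by blast
  qed
  have "\<exists>t. \<forall>l. P l (t l) \<and> Q l (t l) (t (Suc l))"
  proof (rule dependent_nat_choice)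
    show "\<exists>x. P 0 x" by (simp add: P_def)
    fix x l assume "P l x"
    obtain x1 y1 where "\<forall>y\<ge>x1. P (Suc l) y" "\<forall>y\<ge>y1. Q l x y" using exP exQ by metis
    then show "\<exists>y. P (Suc l) y \<and> Q l x y" by (intro exI[of _ "max x1 y1"]) auto
  qed
  then obtain t where t: "\<And>l. P l (t l)" "\<And>l. Q l (t l) (t (Suc l))" by blast
  have sm: "strict_mono t" using t(2) by (simp add: strict_mono_Suc_iff Q_def)
  \<comment> \<open>The glued set follows \<open>b (lev c)\<close> on slice \<open>c\<close>. Slices
    before \<open>t 0\<close> get level 0; being finitely many, they do not influence
    nullity.\<close>
  define lev where "lev c = (LEAST l. c < t (Suc l))" for c
  have lev_lt: "c < t (Suc (lev c))" for c
  proof -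
    have "c < t (Suc c)" using strict_mono_imp_increasing[OF sm, of "Suc c"] by simp
    then show ?thesis unfolding lev_def by (rule LeastI)
  qed
  have lev_ge: "l \<le> lev c" if "t l \<le> c" for l c
  proof (rule ccontr)
    assume "\<not> l \<le> lev c"
    then have "t (Suc (lev c)) \<le> t l" using strict_mono_leD[OF sm] by simp
    then show False using lev_lt[of c] that by simp
  qed
  have t_lev: "t (lev c) \<le> c" if "t 0 \<le> c" for c
  proof (cases "lev c")
    case (Suc l)
    then have "\<not> c < t (Suc l)" using not_less_Least[of l "\<lambda>l. c < t (Suc l)"] unfolding lev_def by simp
    then show ?thesis using Suc by simp
  qed (use that in simp)
  define B where "B = {x. x \<noteq> [] \<and> x \<in> b (lev (hd x))}"
  have "slice B c = slice (b (lev c)) c" for c by (auto simp: B_def)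
  then have sl: "slice (T j B) c = slice (T j (b (lev c))) c" for j c by (rule local)
  have "null (Suc n) (T j B) \<longleftrightarrow> Z j" for j
  proof (cases "Z j")
    case True
    have "null n (slice (T j B) c)" if c: "c \<ge> t (Suc j)" for c
    proof -
      have "j < lev c" using lev_ge[OF c] by simp
      moreover have "t 0 \<le> c" using c strict_mono_leD[OF sm, of 0 "Suc j"] by simp
      ultimately show ?thesis using t(1)[of "lev c"] t_lev[of c] True unfolding sl P_def by blast
    qed
    then have "{c. \<not> null n (slice (T j B) c)} \<subseteq> {..<t (Suc j)}" by (auto simp: linorder_not_le[symmetric])
    then show ?thesis using True finite_subset by auto
  next
    case False
    have "\<exists>c\<ge>N. \<not> null n (slice (T j B) c)" for N
    proof -
      \<comment> \<open>The level exceeds \<open>j\<close>, so that \<open>Q\<close> covers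
        requirement \<open>j\<close>, and is at least \<open>N\<close>, so that the slice found is
        not below \<open>N\<close>.\<close>
      let ?l = "max N (Suc j)"
      obtain c where c: "t ?l \<le> c" "c < t (Suc ?l)" "\<not> null n (slice (T j (b ?l)) c)"
        using t(2)[of ?l, unfolded Q_def, THEN conjunct2, rule_format, of j] False by (auto simp: less_max_iff_disj)
      have "lev c \<le> ?l" unfolding lev_def using c(2) by (rule Least_le)
      then have "lev c = ?l" using lev_ge[OF c(1)] by simp
      moreover have "N \<le> c" using strict_mono_imp_increasing[OF sm, of ?l] c(1) by simp
      ultimately show ?thesis using c(3) sl[of c j] by auto
    qed
    then have "infinite {c. \<not> null n (slice (T j B) c)}" by (auto simp: infinite_nat_iff_unbounded_le)
    then show ?thesis using False by simp
  qed
  then show ?thesis by blast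
qed

text \<open>A partner of \<open>a\<close> has to meet countably many requirements, one for each cell
  of \<open>f\<close> and each side of \<open>a\<close>. Finitely many of them mention finitely many
  pairs and are met by the finite extension; each depends on the partner slice by slice, so
  saturation applies.\<close>

lemma partial_iso_extend:
  assumes f: "countable f" "partial_iso m n f" and n: "n \<ge> 1"
  shows "\<exists>b. partial_iso m n (insert (a, b) f)"
proof -
  obtain n' where n': "n = Suc n'" using n by (cases n) auto
  let ?F = "{P. finite P \<and> P \<subseteq> f}"
  let ?R = "?F \<times> ?F \<times> (UNIV :: bool set)"
  have cR: "countable ?R" using countable_Collect_finite_subset[OF f(1)] by (intro countable_SIGMA) auto
  have neR: "?R \<noteq> {}" by auto
  define e where "e = from_nat_into ?R"
  have e: "range e = ?R" unfolding e_def using cR neR by (rule range_from_nat_into[rotated])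
  define Pe Ne se where "Pe j = fst (e j)" and "Ne j = fst (snd (e j))" and "se j = snd (snd (e j))" for j
  have ej: "finite (Pe j)" "Pe j \<subseteq> f" "finite (Ne j)" "Ne j \<subseteq> f" for j
    using rangeI[of e j] unfolding e by (auto simp: Pe_def Ne_def)
  define T where "T j b = cell snd (Pe j) (Ne j) \<inter> side (se j) b" for j b
  define Z where "Z j \<longleftrightarrow> null m (cell fst (Pe j) (Ne j) \<inter> side (se j) a)" for j
  have "\<exists>b. \<forall>j<l. null n (T j b) \<longleftrightarrow> Z j" for l
  proof -
    let ?K = "\<Union>j<l. Pe j \<union> Ne j"
    have "finite ?K" "partial_iso m n ?K" using ej(1,3) ej(2,4)[THEN subsetD] by (auto intro!: partial_iso_mono[OF f(2)])
    then obtain b where b: "partial_iso m n (insert (a, b) ?K)" using partial_iso_extend_finite n by blast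
    have "null n (T j b) \<longleftrightarrow> Z j" if "j < l" for j
      unfolding T_def Z_def using that ej by (intro partial_iso_insertD[OF b, symmetric]) auto
    then show ?thesis by blast
  qed
  then obtain b where b: "\<And>l j. j < l \<Longrightarrow> null (Suc n') (T j (b l)) \<longleftrightarrow> Z j" unfolding n' by metis
  have "\<exists>b. \<forall>j. null (Suc n') (T j b) \<longleftrightarrow> Z j"
  proof (rule saturation)
    show "\<And>l j. j < l \<Longrightarrow> null (Suc n') (T j (b l)) \<longleftrightarrow> Z j" by (rule b)
    fix j b b' c assume "slice b c = slice b' c"
    then have "c # xs \<in> b \<longleftrightarrow> c # xs \<in> b'" for xs by blast
    then show "slice (T j b) c = slice (T j b') c" by (auto simp: T_def)
  qed
  then obtain b where b: "\<And>j. null n (T j b) \<longleftrightarrow> Z j" unfolding n' by blast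
  have "partial_iso m n (insert (a, b) f)"
  proof (rule partial_iso_insert[OF f(2)])
    fix P N s assume "finite P" "finite N" "P \<subseteq> f" "N \<subseteq> f"
    then have "(P, N, s) \<in> range e" unfolding e by blast
    then obtain j where "e j = (P, N, s)" by force
    then show "null m (cell fst P N \<inter> side s a) \<longleftrightarrow> null n (cell snd P N \<inter> side s b)"
      using b[of j] by (simp add: T_def Z_def Pe_def Ne_def se_def)
  qed
  then show ?thesis by blast
qed

section \<open>The transfinite construction of a total partial isomorphism\<close>

text \<open>Under CH the cardinal well-order of the sets of lists has type
  \<open>\<omega>\<^sub>1\<close>, so each stage of the recursion sees only countably many earlier
  choices.\<close>

lemma CH_countable_underS:
  assumes CH
  shows "countable (underS |UNIV :: nat list set set| x)"
proof -
  have "bij_betw (image list_encode) (UNIV :: nat list set set) (UNIV :: nat set set)"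
    by (rule bij_betw_byWitness[where f' = "image list_decode"]) (auto simp: image_image)
  then have "|UNIV :: nat list set set| =o |UNIV :: nat set set|" by (rule card_of_ordIsoI)
  then have eq: "|UNIV :: nat list set set| =o cardSuc natLeq"
    using assms ordIso_transitive unfolding CH_def by blast
  have "|underS |UNIV :: nat list set set| x| <o |UNIV :: nat list set set|"
    using card_of_underS[OF card_of_Card_order, of x "UNIV :: nat list set set"] by (simp add: Field_card_of)
  then have "|underS |UNIV :: nat list set set| x| <o cardSuc natLeq"
    using eq ordLess_ordIso_trans by blast
  then have "|underS |UNIV :: nat list set set| x| \<le>o natLeq"
    using cardSuc_ordLeq_ordLess[OF natLeq_Card_order card_of_Card_order] by blast
  then show ?thesis by (simp add: countable_card_le_natLeq)
qed

lemma CH_total_partial_iso: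
  assumes CH "m \<ge> 1" "n \<ge> 1"
  shows "\<exists>f. partial_iso m n f \<and> (\<forall>a. \<exists>b. (a, b) \<in> f) \<and> (\<forall>b. \<exists>a. (a, b) \<in> f)"
proof -
  let ?r = "|UNIV :: nat list set set|"
  have W: "Well_order ?r" by (rule card_of_Well_order)
  have F: "Field ?r = UNIV" by (simp add: Field_card_of)
  have tot: "x = y \<or> x \<in> underS ?r y \<or> y \<in> underS ?r x" for x y
    using W F unfolding well_order_on_def linear_order_on_def total_on_def underS_def by auto
  have tr: "underS ?r x \<subseteq> underS ?r y" if "x \<in> underS ?r y" for x y
    using W that unfolding well_order_on_def linear_order_on_def partial_order_on_def preorder_on_def
      trans_def antisym_def underS_def by blast
  define U where "U G x = (\<Union>z\<in>underS ?r x. G z)" for G :: "nat list set \<Rightarrow> (nat list set \<times> nat list set) set" and x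
  \<comment> \<open>Stage \<open>x\<close> takes care of \<open>x\<close> on both sides; the
    finiteness of what it adds keeps the union of the earlier stages countable.\<close>
  define Q where "Q G x y \<longleftrightarrow> finite y \<and> (\<exists>b. (x, b) \<in> y) \<and> (\<exists>a. (a, x) \<in> y) \<and> partial_iso m n (U G x \<union> y)"
    for G :: "nat list set \<Rightarrow> (nat list set \<times> nat list set) set" and x and y :: "(nat list set \<times> nat list set) set"
  \<comment> \<open>By linearity, a finite part of a union of stages lies within the stages up to
    the largest index involved, where \<open>Q\<close> applies.\<close>
  have dir: "E = {} \<or> (\<exists>z\<in>S. E \<subseteq> U G z \<union> G z)" if "finite E" "E \<subseteq> (\<Union>z\<in>S. G z)"
    for E S and G :: "nat list set \<Rightarrow> (nat list set \<times> nat list set) set"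
    using that
  proof (induction E rule: finite_induct)
    case (insert c E)
    then obtain z where z: "z \<in> S" "c \<in> G z" by blast
    show ?case
    proof (cases "E = {}")
      case False
      then obtain w where w: "w \<in> S" "E \<subseteq> U G w \<union> G w" using insert by auto
      consider "w = z" | "w \<in> underS ?r z" | "z \<in> underS ?r w" using tot by blast
      then show ?thesis
      proof cases
        case 2
        then have "U G w \<union> G w \<subseteq> U G z" using tr by (auto simp: U_def)
        then show ?thesis using z w by blast
      next
        case 3
        then have "c \<in> U G w" using z by (auto simp: U_def)
        then show ?thesis using w by blast
      qed (use z w in blast)
    qed (use z in blast)
  qed simp
  have partial_iso_UN: "partial_iso m n (\<Union>z\<in>S. G z)" if "\<And>z. z \<in> S \<Longrightarrow> Q G z (G z)"
    for S and G :: "nat list set \<Rightarrow> (nat list set \<times> nat list set) set"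
  proof (rule partial_iso_finitary)
    fix E assume "finite E" "E \<subseteq> (\<Union>z\<in>S. G z)"
    from dir[OF this] show "partial_iso m n E"
    proof
      assume "\<exists>z\<in>S. E \<subseteq> U G z \<union> G z"
      then obtain z where "z \<in> S" "E \<subseteq> U G z \<union> G z" by blast
      then show ?thesis using that[of z] partial_iso_mono by (auto simp: Q_def)
    qed (simp add: partial_iso_empty)
  qed
  have "\<exists>G. \<forall>x. Q G x (G x)"
  proof (rule dependent_wf_choice[of "?r - Id"])
    show "wf (?r - Id)" using W by (simp add: well_order_on_def)
    fix G G' :: "nat list set \<Rightarrow> (nat list set \<times> nat list set) set" and x y
    assume "\<And>z. (z, x) \<in> ?r - Id \<Longrightarrow> G z = G' z"
    then have "U G x = U G' x" by (auto simp: U_def underS_def)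
    then show "Q G x y = Q G' x y" by (simp add: Q_def)
  next
    fix x G assume IH: "\<And>y. (y, x) \<in> ?r - Id \<Longrightarrow> Q G y (G y)"
    then have IH': "Q G y (G y)" if "y \<in> underS ?r x" for y using that by (auto simp: underS_def)
    have g: "partial_iso m n (U G x)" unfolding U_def using IH' by (rule partial_iso_UN)
    have c: "countable (U G x)" unfolding U_def
      using CH_countable_underS[OF assms(1)] IH' by (intro countable_UN) (auto simp: Q_def countable_finite)
    \<comment> \<open>Forth: a partner for \<open>x\<close> on the left. Back: the same extension
      lemma for the converse relation.\<close>
    obtain b where b: "partial_iso m n (insert (x, b) (U G x))" using partial_iso_extend[OF c g assms(3)] by blast
    have "(insert (x, b) (U G x))\<inverse> = prod.swap ` insert (x, b) (U G x)" by auto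
    then have "countable ((insert (x, b) (U G x))\<inverse>)" using c by (simp only: countable_image countable_insert)
    from partial_iso_extend[OF this partial_iso_converse[OF b] assms(2), of x]
    obtain a where "partial_iso n m (insert (x, a) ((insert (x, b) (U G x))\<inverse>))" by blast
    then have "partial_iso m n ((insert (x, a) ((insert (x, b) (U G x))\<inverse>))\<inverse>)" by (rule partial_iso_converse)
    then have "partial_iso m n (U G x \<union> {(x, b), (a, x)})"
      by (rule partial_iso_mono) auto
    then show "\<exists>y. Q G x y" by (intro exI[of _ "{(x, b), (a, x)}"]) (auto simp: Q_def)
  qed
  then obtain G where G: "\<And>x. Q G x (G x)" by blast
  have "partial_iso m n (\<Union>z\<in>UNIV. G z)" using G by (intro partial_iso_UN)
  moreover have "\<exists>b. (a, b) \<in> (\<Union>z\<in>UNIV. G z)" "\<exists>b. (b, a) \<in> (\<Union>z\<in>UNIV. G z)" for a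
    using G[of a] by (auto simp: Q_def)
  ultimately show ?thesis by blast
qed

section \<open>From partial isomorphisms to group isomorphisms\<close>

lemma UT_iso:
  fixes R :: "('a, 'm) ring_scheme" and S :: "('b, 'l) ring_scheme" and h :: "'a \<Rightarrow> 'b"
  assumes R: "cring R" and S: "cring S" and h: "h \<in> ring_hom R S"
    and bij: "bij_betw h (carrier R) (carrier S)"
  shows "UT k R \<cong> UT k S"
proof -
  interpret h: ring_hom_cring R S h
    using R S h by (simp add: ring_hom_cring_def ring_hom_cring_axioms_def)
  let ?K = "{..<k} \<times> {..<k}"
  define f where "f A = (\<lambda>x\<in>?K. h (A x))" for A
  define f' where "f' A = (\<lambda>x\<in>?K. inv_into (carrier R) h (A x))" for A
  have inv: "inv_into (carrier R) h (h a) = a" if "a \<in> carrier R" for a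
    using bij that by (simp add: bij_betw_def)
  have inv': "h (inv_into (carrier R) h b) = b" "inv_into (carrier R) h b \<in> carrier R" if "b \<in> carrier S" for b
    using bij that by (simp_all add: bij_betw_def f_inv_into_f inv_into_into)
  have carr: "A x \<in> carrier R" if "A \<in> carrier (UT k R)" "x \<in> ?K" for A x
    using that by (auto simp: UT_def)
  have carr': "A x \<in> carrier S" if "A \<in> carrier (UT k S)" "x \<in> ?K" for A x
    using that by (auto simp: UT_def)
  have inv_one: "inv_into (carrier R) h \<one>\<^bsub>S\<^esub> = \<one>\<^bsub>R\<^esub>" using inv[of "\<one>\<^bsub>R\<^esub>"] by simp
  have inv_zero: "inv_into (carrier R) h \<zero>\<^bsub>S\<^esub> = \<zero>\<^bsub>R\<^esub>" using inv[of "\<zero>\<^bsub>R\<^esub>"] by simp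
  have "f \<in> hom (UT k R) (UT k S)"
  proof (rule homI)
    fix A assume A: "A \<in> carrier (UT k R)"
    then show "f A \<in> carrier (UT k S)"
      using carr[OF A] by (auto simp: UT_def f_def)
    fix B assume B: "B \<in> carrier (UT k R)"
    have "h (\<Oplus>\<^bsub>R\<^esub>l\<in>{..<k}. A (i, l) \<otimes>\<^bsub>R\<^esub> B (l, j)) = (\<Oplus>\<^bsub>S\<^esub>l\<in>{..<k}. f A (i, l) \<otimes>\<^bsub>S\<^esub> f B (l, j))"
      if ij: "i < k" "j < k" for i j
    proof -
      have "h (\<Oplus>\<^bsub>R\<^esub>l\<in>{..<k}. A (i, l) \<otimes>\<^bsub>R\<^esub> B (l, j)) = (\<Oplus>\<^bsub>S\<^esub>l\<in>{..<k}. h (A (i, l) \<otimes>\<^bsub>R\<^esub> B (l, j)))"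
        using carr[OF A] carr[OF B] ij by (subst h.hom_finsum) (auto simp: o_def)
      also have "\<dots> = (\<Oplus>\<^bsub>S\<^esub>l\<in>{..<k}. f A (i, l) \<otimes>\<^bsub>S\<^esub> f B (l, j))"
        using carr[OF A] carr[OF B] ij by (intro h.S.finsum_cong') (auto simp: f_def)
      finally show ?thesis .
    qed
    then show "f (A \<otimes>\<^bsub>UT k R\<^esub> B) = f A \<otimes>\<^bsub>UT k S\<^esub> f B"
      unfolding f_def[of "A \<otimes>\<^bsub>UT k R\<^esub> B"] by (auto simp: UT_def intro!: restrict_ext)
  qed
  moreover have "bij_betw f (carrier (UT k R)) (carrier (UT k S))"
  proof (rule bij_betw_byWitness[where f' = f'])
    show "\<forall>A\<in>carrier (UT k R). f' (f A) = A"
    proof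
      fix A assume A: "A \<in> carrier (UT k R)"
      show "f' (f A) = A"
      proof (rule extensionalityI[of _ ?K])
        show "A \<in> extensional ?K" using A by (auto simp: UT_def PiE_def)
      qed (use carr[OF A] in \<open>auto simp: f_def f'_def inv\<close>)
    qed
    show "\<forall>A\<in>carrier (UT k S). f (f' A) = A"
    proof
      fix A assume A: "A \<in> carrier (UT k S)"
      show "f (f' A) = A"
      proof (rule extensionalityI[of _ ?K])
        show "A \<in> extensional ?K" using A by (auto simp: UT_def PiE_def)
      qed (use carr'[OF A] in \<open>auto simp: f_def f'_def inv'\<close>)
    qed
    show "f ` carrier (UT k R) \<subseteq> carrier (UT k S)"
      using calculation by (auto simp: hom_def)
    show "f' ` carrier (UT k S) \<subseteq> carrier (UT k R)"
    proof
      fix B assume "B \<in> f' ` carrier (UT k S)"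
      then obtain A where A: "A \<in> carrier (UT k S)" "B = f' A" by blast
      show "B \<in> carrier (UT k R)"
        using A(1) carr'[OF A(1)] by (auto simp: UT_def f'_def A(2) inv' inv_one inv_zero)
    qed
  qed
  ultimately show ?thesis by (auto simp: is_iso_def iso_def)
qed

text \<open>A Boolean identity says that certain cells on the first side are empty, hence null; the
  partial isomorphism makes the corresponding cells on the second side null. The unit, intersections
  and symmetric differences are all handled in this way.\<close>

lemma partial_iso_ring_iso:
  assumes f: "partial_iso m n f" and tot: "\<And>a. \<exists>b. (a, b) \<in> f" and sur: "\<And>b. \<exists>a. (a, b) \<in> f"
  shows "\<exists>h\<in>ring_hom (omega_ring m) (omega_ring n).
    bij_betw h (carrier (omega_ring m)) (carrier (omega_ring n))"
proof -
  obtain \<phi> where \<phi>: "\<And>a. (a, \<phi> a) \<in> f" using tot by metis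
  have empty_cell: "null n (cell snd P N)" if "finite P" "finite N" "P \<subseteq> f" "N \<subseteq> f" "cell fst P N = {}" for P N
    using partial_isoD[OF f that(1-4)] that(5) by simp
  have diff: "null m (a - a') \<longleftrightarrow> null n (b - b')" if "(a, b) \<in> f" "(a', b') \<in> f" for a b a' b'
    using partial_isoD[OF f, of "{(a, b)}" "{(a', b')}"] that by (auto simp: cell_def Diff_eq Int_def Compl_eq)
  have eq: "cls m a = cls m a' \<longleftrightarrow> cls n b = cls n b'" if "(a, b) \<in> f" "(a', b') \<in> f" for a b a' b'
    using diff[OF that] diff[OF that(2,1)] by (simp add: cls_eq_iff)
  define h where "h X = cls n (\<phi> (SOME a. X = cls m a))" for X
  have h: "h (cls m a) = cls n b" if "(a, b) \<in> f" for a b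
  proof -
    have "cls m a = cls m (SOME a'. cls m a = cls m a')" by (rule someI) simp
    from eq[OF \<phi> that, THEN iffD1, OF this[symmetric]] show ?thesis unfolding h_def .
  qed
  note h\<phi> = h[OF \<phi>]
  have 1: "h (cls m UNIV) = cls n UNIV"
  proof -
    have "null n (cell snd {} {(UNIV :: nat list set, \<phi> UNIV)})"
      by (intro empty_cell) (use \<phi> in \<open>auto simp: cell_def\<close>)
    then have "null n (sym_diff (\<phi> UNIV) UNIV)" by (auto simp: cell_def elim!: null_mono)
    then show ?thesis by (simp only: h\<phi> cls_eq_iff)
  qed
  have mult: "h (cls m (a \<inter> a')) = cls n (\<phi> a \<inter> \<phi> a')" for a a'
  proof -
    let ?D = "(a \<inter> a', \<phi> (a \<inter> a'))" and ?B = "(a, \<phi> a)" and ?C = "(a', \<phi> a')"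
    have "null n (cell snd {?D} {?B})" "null n (cell snd {?D} {?C})" "null n (cell snd {?B, ?C} {?D})"
      by (intro empty_cell; use \<phi> in \<open>auto simp: cell_def\<close>)+
    then have "null n (cell snd {?D} {?B} \<union> cell snd {?D} {?C} \<union> cell snd {?B, ?C} {?D})" by simp
    then have "null n (sym_diff (\<phi> (a \<inter> a')) (\<phi> a \<inter> \<phi> a'))" by (rule null_mono) (auto simp: cell_def)
    then show ?thesis by (simp only: h\<phi> cls_eq_iff)
  qed
  have add: "h (cls m (sym_diff a a')) = cls n (sym_diff (\<phi> a) (\<phi> a'))" for a a'
  proof -
    let ?D = "(sym_diff a a', \<phi> (sym_diff a a'))" and ?B = "(a, \<phi> a)" and ?C = "(a', \<phi> a')"
    \<comment> \<open>The three sets add up to zero modulo 2, so no point lies in an odd number of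
      them; these are the four odd cells.\<close>
    have "null n (cell snd {?D, ?B, ?C} {})" "null n (cell snd {?D} {?B, ?C})"
      "null n (cell snd {?B} {?C, ?D})" "null n (cell snd {?C} {?B, ?D})"
      by (intro empty_cell; use \<phi> in \<open>auto simp: cell_def\<close>)+
    then have "null n (cell snd {?D, ?B, ?C} {} \<union> cell snd {?D} {?B, ?C} \<union> cell snd {?B} {?C, ?D} \<union> cell snd {?C} {?B, ?D})"
      by simp
    then have "null n (sym_diff (\<phi> (sym_diff a a')) (sym_diff (\<phi> a) (\<phi> a')))"
      by (rule null_mono) (auto simp: cell_def)
    then show ?thesis by (simp only: h\<phi> cls_eq_iff)
  qed
  have "h \<in> ring_hom (omega_ring m) (omega_ring n)"
    by (rule ring_hom_memI)
      (auto simp: h\<phi> 1[unfolded h\<phi>] mult[unfolded h\<phi>] add[unfolded h\<phi>] cls_one elim!: omega_ring_carrierE)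
  moreover have "bij_betw h (carrier (omega_ring m)) (carrier (omega_ring n))"
    unfolding bij_betw_def
  proof
    show "inj_on h (carrier (omega_ring m))"
    proof (rule inj_onI)
      fix X Y assume XY: "X \<in> carrier (omega_ring m)" "Y \<in> carrier (omega_ring m)" "h X = h Y"
      obtain a where a: "X = cls m a" using XY(1) by (rule omega_ring_carrierE)
      obtain b where b: "Y = cls m b" using XY(2) by (rule omega_ring_carrierE)
      show "X = Y" unfolding a b eq[OF \<phi> \<phi>] using XY(3) by (simp only: a b h\<phi>)
    qed
    show "h ` carrier (omega_ring m) = carrier (omega_ring n)"
    proof (intro equalityI subsetI)
      fix Y assume "Y \<in> carrier (omega_ring n)"
      then obtain b where "Y = cls n b" by (rule omega_ring_carrierE)
      moreover obtain a where "(a, b) \<in> f" using sur by blast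
      ultimately have "Y = h (cls m a)" using h by simp
      then show "Y \<in> h ` carrier (omega_ring m)" by simp
    qed (auto simp: h\<phi> elim!: omega_ring_carrierE)
  qed
  ultimately show ?thesis by blast
qed

theorem CH_U_group_iso:
  assumes CH "m \<ge> 1" "n \<ge> 1"
  shows "U_group m k \<cong> U_group n k"
proof -
  obtain f where f: "partial_iso m n f" "\<forall>a. \<exists>b. (a, b) \<in> f" "\<forall>b. \<exists>a. (a, b) \<in> f"
    using CH_total_partial_iso[OF assms] by (elim exE conjE)
  obtain h where "h \<in> ring_hom (omega_ring m) (omega_ring n)"
    "bij_betw h (carrier (omega_ring m)) (carrier (omega_ring n))"
    using partial_iso_ring_iso[OF f(1) f(2)[rule_format] f(3)[rule_format]] by blast
  then show ?thesis unfolding U_group_def by (rule UT_iso[OF cring_omega_ring cring_omega_ring])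
qed

section \<open>Automata recognising the ideals\<close>

abbreviation zeros :: "nat list \<Rightarrow> bool" where
  "zeros xs \<equiv> set xs \<subseteq> {0}"

lemma zeros_iff: "zeros xs \<longleftrightarrow> xs = replicate (length xs) 0"
  by (induction xs) auto

lemma not_lexn_zeros: "zeros q \<Longrightarrow> (p, q) \<notin> lexn less_than m"
proof (induction m arbitrary: p q)
  case (Suc m)
  show ?case
  proof
    assume "(p, q) \<in> lexn less_than (Suc m)"
    then obtain a as b bs where *: "p = a # as" "q = b # bs" "length as = m" "length bs = m"
      "a < b \<or> a = b \<and> (as, bs) \<in> lexn less_than m" by (rule lexn_Suc_cases)
    then show False using Suc.IH[of bs as] Suc.prems by auto
  qed
qed simp

lemma zeros_lexn: "length p = m \<Longrightarrow> \<not> zeros p \<Longrightarrow> (replicate m 0, p) \<in> lexn less_than m"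
  using lexn_linear[of "replicate m 0" m p] not_lexn_zeros[of "replicate m 0" p m]
  by (auto simp: zeros_iff)

lemma lexn_trans: "(p, q) \<in> lexn less_than m \<Longrightarrow> (q, s) \<in> lexn less_than m \<Longrightarrow> (p, s) \<in> lexn less_than m"
  by (rule transD[OF lexn_transI[OF trans_less_than]])

lemma lexn_irrefl: "(p, p) \<notin> lexn less_than m"
  using wf_lexn[OF wf_less_than, of m] by auto

lemma lexn_succ:
  "(us @ [a], y) \<in> lexn less_than m \<Longrightarrow> y = us @ [Suc a] \<or> (us @ [Suc a], y) \<in> lexn less_than m"
proof (induction us arbitrary: m y)
  case Nil
  then have "length [a] = m" using lexn_length by fastforce
  then have m: "m = Suc 0" by simp
  from Nil[simplified, unfolded m] obtain b where "y = [b]" "a < b"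
    by (auto elim!: lexn_Suc_cases)
  then show ?case using m by (auto simp: Cons_Cons_lexn)
next
  case (Cons x us)
  then have "length ((x # us) @ [a]) = m" using lexn_length by fastforce
  then obtain k where m: "m = Suc k" "length us < k" by auto
  from Cons.prems[unfolded m(1)] obtain b bs where "y = b # bs" "length bs = k"
    "x < b \<or> x = b \<and> (us @ [a], bs) \<in> lexn less_than k"
    by (auto elim!: lexn_Suc_cases)
  moreover have "length us + 1 = k" using m \<open>length ((x # us) @ [a]) = m\<close> by simp
  ultimately show ?case using Cons.IH[of bs k] by (auto simp: m Cons_Cons_lexn)
qed

lemma lexn_snoc_Suc: "length us + 1 = m \<Longrightarrow> (us @ [a], us @ [Suc a]) \<in> lexn less_than m"
proof (induction us arbitrary: m)
  case Nil
  then show ?case by (cases m) (auto simp: Cons_Cons_lexn)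
next
  case (Cons x us)
  then obtain k where "m = Suc k" by (cases m) auto
  with Cons show ?case by (auto simp: Cons_Cons_lexn)
qed

text \<open>The state reached at a position with \<open>j\<close> trailing zeros is \<open>2 * j\<close>, plus one if the bad letters
  of the block of length \<open>\<omega>\<^sup>j\<close> ending there are not null.\<close>

fun pos_state :: "(nat list \<Rightarrow> bool) \<Rightarrow> nat list \<Rightarrow> nat" where
  "pos_state B [] = 0"
| "pos_state B (x # xs) = (if zeros xs
     then if x = 0 then 0 else 2 * length xs + (if null (length xs) {q. B ((x - 1) # q)} then 0 else 1)
     else pos_state (\<lambda>q. B (x # q)) xs)"

lemma pos_state_zeros: "zeros xs \<Longrightarrow> pos_state B xs = 0"
  by (cases xs) auto

lemma pos_state_less: "xs \<noteq> [] \<Longrightarrow> pos_state B xs < 2 * length xs"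
proof (induction xs arbitrary: B)
  case (Cons x xs)
  show ?case
  proof (cases "zeros xs")
    case False
    then have "xs \<noteq> []" by auto
    from Cons.IH[OF this, of "\<lambda>q. B (x # q)"] False show ?thesis by simp
  qed simp
qed simp

lemma pos_state_succ: "pos_state B (us @ [Suc a]) = (if B (us @ [a]) then 1 else 0)"
  by (induction us arbitrary: B) auto

text \<open>The states seen cofinally below \<open>y\<close> in the intended run. It coincides with
  \<open>cofinal_states\<close> once positions are translated into lists.\<close>

definition cofinal :: "nat \<Rightarrow> (nat list \<Rightarrow> bool) \<Rightarrow> nat list \<Rightarrow> nat set" where
  "cofinal m B y = {s. \<forall>a. (a, y) \<in> lexn less_than m \<longrightarrow>
     (\<exists>b. (a = b \<or> (a, b) \<in> lexn less_than m) \<and> (b, y) \<in> lexn less_than m \<and> pos_state B b = s)}"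

text \<open>Late positions below \<open>y\<close> that end a sub-block of length \<omega>^j carry
  state 2j or 2j + 1, all others a smaller one. Hence the largest cofinal state is 2j + 1 iff
  infinitely many sub-blocks are non-null, that is, iff the block of length \<omega>^(j+1) is
  non-null; adding 2 moves this bit one height up.\<close>

lemma cofinal_block_end:
  assumes y: "y = Suc a # replicate (Suc j) 0"
  shows "\<exists>M\<in>cofinal (Suc (Suc j)) B y. (\<forall>s\<in>cofinal (Suc (Suc j)) B y. s \<le> M) \<and> M + 2 = pos_state B y"
proof -
  let ?C = "cofinal (Suc (Suc j)) B y" and ?z = "replicate j (0::nat)"
  have below: "(b, y) \<in> lexn less_than (Suc (Suc j)) \<longleftrightarrow> length b = Suc (Suc j) \<and> hd b \<le> a" for b
  proof
    assume "(b, y) \<in> lexn less_than (Suc (Suc j))"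
    then obtain c cs where "b = c # cs" "length cs = Suc j" "c < Suc a \<or> (cs, replicate (Suc j) 0) \<in> lexn less_than (Suc j)"
      by (rule lexn_Suc_cases) (auto simp: y)
    then show "length b = Suc (Suc j) \<and> hd b \<le> a"
      using not_lexn_zeros[of "replicate (Suc j) 0" cs "Suc j"] by (auto simp del: replicate_Suc)
  next
    assume "length b = Suc (Suc j) \<and> hd b \<le> a"
    then show "(b, y) \<in> lexn less_than (Suc (Suc j))"
      by (cases b) (auto simp: y Cons_Cons_lexn)
  qed
  \<comment> \<open>The index is \<open>Suc c\<close> because the state at the start of a sub-block
    reports on the preceding one, with index \<open>c\<close>.\<close>
  have T: "\<exists>c\<ge>K. \<exists>z. length z = j \<and> pos_state B (a # Suc c # z) = s" if s: "s \<in> ?C" for s K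
  proof -
    let ?a = "a # Suc K # ?z"
    have "(?a, y) \<in> lexn less_than (Suc (Suc j))" by (simp add: below)
    then obtain b where b: "?a = b \<or> (?a, b) \<in> lexn less_than (Suc (Suc j))" "length b = Suc (Suc j)" "hd b \<le> a"
      "pos_state B b = s"
      using s unfolding cofinal_def below by blast
    obtain h c z where bz: "b = h # c # z" "length z = j" using b(2) by (auto simp: length_Suc_conv)
    have "h = a \<and> Suc K \<le> c" using b(1,3) bz by (auto simp: Cons_Cons_lexn)
    then show ?thesis using b(4) bz by (intro exI[of _ "c - 1"]) (auto intro!: exI[of _ z])
  qed
  have T': "s \<in> ?C" if s: "\<And>K. \<exists>c\<ge>K. pos_state B (a # Suc c # ?z) = s" for s
    unfolding cofinal_def
  proof (intro CollectI allI impI)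
    fix a0 assume "(a0, y) \<in> lexn less_than (Suc (Suc j))"
    then have a0: "length a0 = Suc (Suc j)" "hd a0 \<le> a" by (auto simp: below)
    then obtain h c0 z where a0z: "a0 = h # c0 # z" "length z = j" by (auto simp: length_Suc_conv)
    obtain c where c: "c \<ge> c0" "pos_state B (a # Suc c # ?z) = s" using s by blast
    have "(a0, a # Suc c # ?z) \<in> lexn less_than (Suc (Suc j))"
      using a0 a0z c(1) by (auto simp: Cons_Cons_lexn)
    then show "\<exists>b. (a0 = b \<or> (a0, b) \<in> lexn less_than (Suc (Suc j))) \<and> (b, y) \<in> lexn less_than (Suc (Suc j)) \<and> pos_state B b = s"
      using c(2) by (intro exI[of _ "a # Suc c # ?z"]) (auto simp: below)
  qed
  have st1: "pos_state B (a # Suc c # ?z) = 2 * j + (if null j {z. B (a # c # z)} then 0 else 1)" for c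
    by (simp add: set_replicate_conv_if)
  have st2: "pos_state B (a # Suc c # z) < 2 * j" if "length z = j" "\<not> zeros z" for c z
  proof -
    have "z \<noteq> []" using that(2) by auto
    then show ?thesis using that pos_state_less[of z] by simp
  qed
  have st3: "pos_state B (a # Suc c # z) \<le> 2 * j + (if null j {z. B (a # c # z)} then 0 else 1)" if "length z = j" for c z
  proof (cases "zeros z")
    case True
    then have "z = ?z" using that zeros_iff[of z] by simp
    then show ?thesis using st1[of c] by simp
  next
    case False
    then show ?thesis using st2[OF that, of c] by (simp del: pos_state.simps)
  qed
  show ?thesis
  proof (cases "null (Suc j) {q. B (a # q)}")
    case True
    then have "finite {c. \<not> null j {z. B (a # c # z)}}" by simp
    then obtain N where N: "\<And>c. c \<ge> N \<Longrightarrow> null j {z. B (a # c # z)}"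
      by (auto simp: finite_nat_set_iff_bounded linorder_not_le[symmetric])
    have "2 * j \<in> ?C"
    proof (rule T')
      fix K show "\<exists>c\<ge>K. pos_state B (a # Suc c # ?z) = 2 * j"
        using N[of "max K N"] st1[of "max K N"] by (intro exI[of _ "max K N"]) auto
    qed
    moreover have "s \<le> 2 * j" if s: "s \<in> ?C" for s
    proof -
      obtain c z where "c \<ge> N" "length z = j" "pos_state B (a # Suc c # z) = s" using T[OF s, of N] by blast
      then show ?thesis using st3[of z c] N[of c] by (simp del: pos_state.simps)
    qed
    moreover have "2 * j + 2 = pos_state B y" using True by (simp add: y set_replicate_conv_if del: null.simps)
    ultimately show ?thesis by blast
  next
    case False
    then have inf: "infinite {c. \<not> null j {z. B (a # c # z)}}" by simp
    have "2 * j + 1 \<in> ?C"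
    proof (rule T')
      fix K
      obtain c where "c \<ge> K" "\<not> null j {z. B (a # c # z)}"
        using inf by (auto simp: infinite_nat_iff_unbounded_le)
      then show "\<exists>c\<ge>K. pos_state B (a # Suc c # ?z) = 2 * j + 1" using st1[of c] by auto
    qed
    moreover have "s \<le> 2 * j + 1" if s: "s \<in> ?C" for s
    proof -
      obtain c z where "length z = j" "pos_state B (a # Suc c # z) = s" using T[OF s, of 0] by blast
      then show ?thesis using st3[of z c] by (simp split: if_splits del: pos_state.simps)
    qed
    moreover have "2 * j + 1 + 2 = pos_state B y" using False by (simp add: y set_replicate_conv_if del: null.simps)
    ultimately show ?thesis by blast
  qed
qed

text \<open>With zero tail \<open>b\<close>, the state at \<open>x # b\<close> reports on the
  preceding block and does not follow the recursion. Since \<open>xs\<close> is a limit, this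
  position can be skipped: its successor, with tail \<open>?one\<close>, is still below, so nonzero
  tails are cofinal.\<close>

lemma cofinal_Cons:
  assumes len: "length xs = m" and nz: "\<not> zeros xs" and lst: "last xs = 0"
  shows "cofinal (Suc m) B (x # xs) = cofinal m (\<lambda>q. B (x # q)) xs"
proof -
  let ?lt = "\<lambda>p q. (p, q) \<in> lexn less_than m" and ?lt' = "\<lambda>p q. (p, q) \<in> lexn less_than (Suc m)"
  have "m > 0" using nz len by auto
  let ?one = "replicate (m - 1) 0 @ [1::nat]"
  have rep: "replicate m 0 = replicate (m - 1) 0 @ [0::nat]"
    using \<open>m > 0\<close> by (metis replicate_Suc replicate_append_same Suc_pred')
  have one: "?lt ?one xs" "\<not> zeros ?one"
  proof -
    have "?lt (replicate (m - 1) 0 @ [0]) xs" using zeros_lexn[OF len nz] rep by simp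
    then have "xs = ?one \<or> ?lt ?one xs" using lexn_succ by fastforce
    then show "?lt ?one xs" using lst by auto
  qed auto
  have nzI: "\<not> zeros b" if "\<not> zeros a" "a = b \<or> ?lt a b" for a b
    using that not_lexn_zeros by blast
  have nzbelow: "\<exists>a'. (a = a' \<or> ?lt a a') \<and> ?lt a' xs \<and> \<not> zeros a'" if a: "?lt a xs" for a
  proof (cases "zeros a")
    case True
    moreover have "length a = m" using a lexn_length by blast
    ultimately have "a = replicate m 0" by (metis zeros_iff)
    moreover have "?lt (replicate m 0) ?one" using \<open>m > 0\<close> one(2) by (intro zeros_lexn) auto
    ultimately show ?thesis using one by blast
  qed (use a in blast)
  have st: "pos_state B (x # b) = pos_state (\<lambda>q. B (x # q)) b" if "\<not> zeros b" for b
    using that by simp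
  show ?thesis
  proof (intro equalityI subsetI)
    fix s assume s: "s \<in> cofinal (Suc m) B (x # xs)"
    show "s \<in> cofinal m (\<lambda>q. B (x # q)) xs"
      unfolding cofinal_def
    proof (intro CollectI allI impI)
      fix a assume "?lt a xs"
      then obtain a' where a': "a = a' \<or> ?lt a a'" "?lt a' xs" "\<not> zeros a'" using nzbelow by blast
      have "?lt' (x # a') (x # xs)" using a'(2) by (simp add: Cons_Cons_lexn)
      then obtain b where b: "x # a' = b \<or> ?lt' (x # a') b" "?lt' b (x # xs)" "pos_state B b = s"
        using s unfolding cofinal_def by blast
      from b(2) obtain h b' where b': "b = h # b'" by (rule lexn_Suc_cases)
      have "h = x \<and> (a' = b' \<or> ?lt a' b') \<and> ?lt b' xs"
        using b(1,2) by (auto simp: b' Cons_Cons_lexn)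
      moreover from this have "\<not> zeros b'" using nzI[OF a'(3)] by blast
      ultimately show "\<exists>b. (a = b \<or> ?lt a b) \<and> ?lt b xs \<and> pos_state (\<lambda>q. B (x # q)) b = s"
        using a'(1) b(3) st[of b'] lexn_trans[of a a' m b'] b' by (intro exI[of _ b']) auto
    qed
  next
    fix s assume s: "s \<in> cofinal m (\<lambda>q. B (x # q)) xs"
    show "s \<in> cofinal (Suc m) B (x # xs)"
      unfolding cofinal_def
    proof (intro CollectI allI impI)
      fix a assume "?lt' a (x # xs)"
      then obtain h t where ht: "a = h # t" "length t = m" "h < x \<or> h = x \<and> ?lt t xs"
        by (rule lexn_Suc_cases) auto
      obtain a' where a': "h < x \<or> h = x \<and> (t = a' \<or> ?lt t a')" "?lt a' xs" "\<not> zeros a'"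
        using ht(3)
      proof
        assume "h < x"
        then show ?thesis using that one by blast
      next
        assume "h = x \<and> ?lt t xs"
        then show ?thesis using that nzbelow[of t] by blast
      qed
      obtain b' where b': "a' = b' \<or> ?lt a' b'" "?lt b' xs" "pos_state (\<lambda>q. B (x # q)) b' = s"
        using s a'(2) unfolding cofinal_def by blast
      have "\<not> zeros b'" using nzI[OF a'(3) b'(1)] .
      then have "pos_state B (x # b') = s" using st b'(3) by simp
      moreover have "length b' = m" using b'(2) lexn_length by blast
      have "a = x # b' \<or> ?lt' a (x # b')"
        using a'(1) b'(1) ht \<open>length b' = m\<close> lexn_trans[of t a' m b']
        by (auto simp: Cons_Cons_lexn)
      moreover have "?lt' (x # b') (x # xs)" using b'(2) by (simp add: Cons_Cons_lexn)
      ultimately show "\<exists>b. (a = b \<or> ?lt' a b) \<and> ?lt' b (x # xs) \<and> pos_state B b = s" by blast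
    qed
  qed
qed

text \<open>Leading coordinates are stripped until only zeros follow; what is left is the end of a
  block.\<close>

lemma cofinal_limit:
  assumes "length y = m" "\<not> zeros y" "last y = 0"
  shows "\<exists>M\<in>cofinal m B y. (\<forall>s\<in>cofinal m B y. s \<le> M) \<and> M + 2 = pos_state B y"
  using assms
proof (induction y arbitrary: m B)
  case (Cons x xs)
  obtain k where m: "m = Suc k" "length xs = k" using Cons.prems(1) by auto
  show ?case
  proof (cases "zeros xs")
    case True
    then obtain a where a: "x = Suc a" using Cons.prems(2) by (cases x) auto
    then have "xs \<noteq> []" using Cons.prems(3) by auto
    then obtain j where j: "k = Suc j" using m(2) by (cases k) auto
    have "xs = replicate (Suc j) 0" using True zeros_iff[of xs] m(2) j by simp
    then show ?thesis using cofinal_block_end[of "x # xs" a j B] m j a by simp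
  next
    case False
    then have "xs \<noteq> []" by auto
    then have lst: "last xs = 0" using Cons.prems(3) by simp
    show ?thesis
      using Cons.IH[OF m(2) False lst, of "\<lambda>q. B (x # q)"] cofinal_Cons[OF m(2) False lst, of B x] False m(1)
      by simp
  qed
qed simp

lemma Max_cofinal:
  assumes "length y = m" "\<not> zeros y" "last y = 0"
  shows "cofinal m B y \<noteq> {}" "cofinal m B y \<subseteq> {..<pos_state B y - 1}" "Max (cofinal m B y) + 2 = pos_state B y"
proof -
  obtain M where M: "M \<in> cofinal m B y" "\<forall>s\<in>cofinal m B y. s \<le> M" "M + 2 = pos_state B y"
    using cofinal_limit[OF assms] by blast
  have "finite (cofinal m B y)" using M(2) finite_subset[of _ "{..M}"] by blast
  then have "Max (cofinal m B y) = M" using M by (intro Max_eqI) auto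
  then show "cofinal m B y \<noteq> {}" "cofinal m B y \<subseteq> {..<pos_state B y - 1}" "Max (cofinal m B y) + 2 = pos_state B y"
    using M by force+
qed

text \<open>Sends the positions of a run on \<open>\<omega>\<^sup>n\<close>, that is the ordinals up to \<open>\<omega>\<^sup>n\<close>, into \<open>\<omega>\<^bsup>n+1\<^esup>\<close>.\<close>

definition pos_list :: "nat \<Rightarrow> nat list option \<Rightarrow> nat list" where
  "pos_list n p = (case p of None \<Rightarrow> 1 # replicate n 0 | Some xs \<Rightarrow> 0 # xs)"

definition positions :: "nat \<Rightarrow> nat list option set" where
  "positions n = insert None (Some ` omega_pow n)"

lemma omega_le_iff: "(p, q) \<in> omega_le n \<longleftrightarrow> p \<in> omega_pow n \<and> q \<in> omega_pow n \<and> (p = q \<or> (p, q) \<in> lexn less_than n)"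
  by (auto simp: omega_le_def omega_pow_def Id_on_def dest: lexn_length)

lemma add_top_iff:
  "(p, q) \<in> add_top (omega_le n) \<longleftrightarrow>
     p \<in> positions n \<and> q \<in> positions n \<and> (p = q \<or> (pos_list n p, pos_list n q) \<in> lexn less_than (Suc n))"
proof (cases p; cases q)
  fix xs ys assume "p = Some xs" "q = Some ys"
  then show ?thesis
    by (auto simp: add_top_def omega_le_iff positions_def pos_list_def Cons_Cons_lexn)
next
  fix xs assume "p = Some xs" "q = None"
  then show ?thesis
    by (auto simp: add_top_def positions_def pos_list_def omega_pow_def Cons_Cons_lexn)
next
  fix ys assume "p = None" "q = Some ys"
  then show ?thesis
    by (auto simp: add_top_def positions_def pos_list_def Cons_Cons_lexn)
qed (auto simp: add_top_def positions_def)

lemma Field_add_top: "Field (add_top (omega_le n)) = positions n"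
  by (auto simp: Field_def add_top_iff)

lemma inj_pos_list: "pos_list n p = pos_list n q \<longleftrightarrow> p = q"
  by (auto simp: pos_list_def split: option.splits)

lemma length_pos_list: "p \<in> positions n \<Longrightarrow> length (pos_list n p) = Suc n"
  by (auto simp: pos_list_def positions_def omega_pow_def)

text \<open>Positions form an initial segment, so comparing cofinal states misses no list below a
  position.\<close>

lemma pos_list_down:
  assumes "(y, pos_list n p) \<in> lexn less_than (Suc n)"
  obtains q where "q \<in> positions n" "y = pos_list n q"
proof -
  obtain a as b bs where *: "y = a # as" "pos_list n p = b # bs" "length as = n"
    "a < b \<or> a = b \<and> (as, bs) \<in> lexn less_than n"
    using assms by (rule lexn_Suc_cases)
  have "a = 0"
  proof (cases p)
    case None
    then have "b = 1" "bs = replicate n 0" using *(2) by (auto simp: pos_list_def)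
    then show ?thesis using *(4) not_lexn_zeros[of bs as n] by (auto simp: set_replicate_conv_if)
  qed (use * in \<open>auto simp: pos_list_def\<close>)
  then show ?thesis using that[of "Some as"] * by (auto simp: positions_def pos_list_def omega_pow_def)
qed

lemma is_zero_pos_iff:
  assumes "p \<in> positions n"
  shows "is_zero_pos (add_top (omega_le n)) p \<longleftrightarrow> zeros (pos_list n p)"
proof
  assume "is_zero_pos (add_top (omega_le n)) p"
  then have *: "(p, q) \<in> add_top (omega_le n)" if "q \<in> positions n" for q
    using that by (auto simp: is_zero_pos_def Field_add_top)
  have z: "Some (replicate n 0) \<in> positions n" by (simp add: positions_def omega_pow_def)
  have "zeros (pos_list n (Some (replicate n 0)))" by (auto simp: pos_list_def set_replicate_conv_if)
  with *[OF z] show "zeros (pos_list n p)" using not_lexn_zeros unfolding add_top_iff by metis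
next
  assume z: "zeros (pos_list n p)"
  have "(p, q) \<in> add_top (omega_le n)" if q: "q \<in> positions n" for q
  proof (cases "zeros (pos_list n q)")
    case True
    then have "pos_list n p = pos_list n q"
      using z zeros_iff[of "pos_list n p"] zeros_iff[of "pos_list n q"] length_pos_list[OF q] length_pos_list[OF assms]
      by simp
    then show ?thesis using q by (simp add: inj_pos_list add_top_iff)
  next
    case False
    have "pos_list n p = replicate (Suc n) 0" using z zeros_iff length_pos_list[OF assms] by metis
    then show ?thesis using zeros_lexn[OF length_pos_list[OF q] False] q assms
      by (simp add: add_top_iff)
  qed
  then show "is_zero_pos (add_top (omega_le n)) p" using assms by (auto simp: is_zero_pos_def Field_add_top)
qed

lemma is_succ_pos_iff:
  assumes n: "n \<ge> 1" and us: "length us + 1 = n"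
  shows "is_succ_pos (add_top (omega_le n)) (Some (us @ [a])) p \<longleftrightarrow> p = Some (us @ [Suc a])"
proof -
  let ?i = "Some (us @ [a])" and ?s = "Some (us @ [Suc a])" and ?lt = "\<lambda>p q. (p, q) \<in> lexn less_than (Suc n)"
  have pos: "?i \<in> positions n" "?s \<in> positions n" using us by (auto simp: positions_def omega_pow_def)
  have lt: "?lt (pos_list n ?i) (pos_list n ?s)"
    using lexn_snoc_Suc[of "0 # us" "Suc n" a] us by (simp add: pos_list_def)
  have le: "q = ?s \<or> ?lt (pos_list n ?s) (pos_list n q)" if "?lt (pos_list n ?i) (pos_list n q)" for q
    using lexn_succ[of "0 # us" a "pos_list n q" "Suc n"] that inj_pos_list[of n q ?s]
    by (simp add: pos_list_def)
  show ?thesis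
  proof
    assume s: "is_succ_pos (add_top (omega_le n)) ?i p"
    then have p: "p \<in> positions n" "?lt (pos_list n ?i) (pos_list n p)" by (auto simp: is_succ_pos_def add_top_iff)
    from le[OF p(2)] show "p = ?s"
    proof
      assume "?lt (pos_list n ?s) (pos_list n p)"
      then have "(?i, ?s) \<in> add_top (omega_le n)" "(?s, p) \<in> add_top (omega_le n)" using lt pos p by (auto simp: add_top_iff)
      then have "?s = ?i \<or> ?s = p" using s unfolding is_succ_pos_def by blast
      then show ?thesis by auto
    qed
  next
    assume p: "p = ?s"
    have "z = ?i \<or> z = ?s" if z: "(?i, z) \<in> add_top (omega_le n)" "(z, ?s) \<in> add_top (omega_le n)" for z
    proof (rule ccontr)
      assume "\<not> ?thesis"
      then have "?lt (pos_list n ?i) (pos_list n z)" "?lt (pos_list n z) (pos_list n ?s)" "z \<noteq> ?s"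
        using z by (auto simp: add_top_iff)
      then show False using le[of z] lexn_trans lexn_irrefl by blast
    qed
    then show "is_succ_pos (add_top (omega_le n)) ?i p"
      using lt pos by (auto simp: p is_succ_pos_def add_top_iff)
  qed
qed

lemma is_lim_posD:
  assumes n: "n \<ge> 1" and p: "is_lim_pos (add_top (omega_le n)) p"
  shows "p \<in> positions n" "\<not> zeros (pos_list n p)" "last (pos_list n p) = 0"
proof -
  show pos: "p \<in> positions n" using p by (auto simp: is_lim_pos_def Field_add_top)
  show "\<not> zeros (pos_list n p)" using p is_zero_pos_iff[OF pos] by (auto simp: is_lim_pos_def)
  show "last (pos_list n p) = 0"
  proof (cases p)
    case None
    then show ?thesis using n by (auto simp: pos_list_def)
  next
    case (Some xs)
    then have len: "length xs = n" using pos by (auto simp: positions_def omega_pow_def)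
    then obtain us c where xs: "xs = us @ [c]" using n by (cases xs rule: rev_cases) auto
    show ?thesis
    proof (rule ccontr)
      assume "last (pos_list n p) \<noteq> 0"
      then obtain a where "c = Suc a" using Some xs by (cases c) (auto simp: pos_list_def)
      then have "is_succ_pos (add_top (omega_le n)) (Some (us @ [a])) p"
        using is_succ_pos_iff[OF n, of us a p] Some xs len by simp
      then show False using p by (auto simp: is_lim_pos_def)
    qed
  qed
qed

lemma cofinal_states_eq:
  assumes p: "p \<in> positions n"
    and x: "\<And>q. q \<in> positions n \<Longrightarrow> (pos_list n q, pos_list n p) \<in> lexn less_than (Suc n) \<Longrightarrow>
      x q = pos_state B (pos_list n q)"
  shows "cofinal_states (add_top (omega_le n)) x p = cofinal (Suc n) B (pos_list n p)"
proof -
  let ?lt = "\<lambda>p q. (p, q) \<in> lexn less_than (Suc n)" and ?r = "add_top (omega_le n)"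
  have lt: "(q, p) \<in> ?r \<and> q \<noteq> p \<longleftrightarrow> q \<in> positions n \<and> ?lt (pos_list n q) (pos_list n p)" for q
    using p lexn_irrefl[of "pos_list n p" "Suc n"] by (auto simp: add_top_iff)
  show ?thesis
  proof (intro equalityI subsetI)
    fix s assume s: "s \<in> cofinal_states ?r x p"
    show "s \<in> cofinal (Suc n) B (pos_list n p)"
      unfolding cofinal_def
    proof (intro CollectI allI impI)
      fix a assume a: "?lt a (pos_list n p)"
      then obtain q where q: "q \<in> positions n" "a = pos_list n q" by (rule pos_list_down)
      then have "(q, p) \<in> ?r \<and> q \<noteq> p" using a lt by blast
      then obtain b where b: "(q, b) \<in> ?r" "(b, p) \<in> ?r \<and> b \<noteq> p" "x b = s"
        using s unfolding cofinal_states_def by blast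
      then have b': "b \<in> positions n" "?lt (pos_list n b) (pos_list n p)" using lt by blast+
      then have "pos_state B (pos_list n b) = s" using x b(3) by simp
      moreover have "a = pos_list n b \<or> ?lt a (pos_list n b)" using b(1) q by (auto simp: add_top_iff)
      ultimately show "\<exists>b. (a = b \<or> ?lt a b) \<and> ?lt b (pos_list n p) \<and> pos_state B b = s" using b'(2) by blast
    qed
  next
    fix s assume s: "s \<in> cofinal (Suc n) B (pos_list n p)"
    show "s \<in> cofinal_states ?r x p"
      unfolding cofinal_states_def
    proof (intro CollectI allI impI)
      fix q assume "(q, p) \<in> ?r \<and> q \<noteq> p"
      then have q: "q \<in> positions n" "?lt (pos_list n q) (pos_list n p)" using lt by blast+
      then obtain b where b: "pos_list n q = b \<or> ?lt (pos_list n q) b" "?lt b (pos_list n p)" "pos_state B b = s"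
        using s unfolding cofinal_def by blast
      obtain b' where b': "b' \<in> positions n" "b = pos_list n b'" using b(2) by (rule pos_list_down)
      have "(b', p) \<in> ?r \<and> b' \<noteq> p" using lt b(2) b' by blast
      moreover have "(q, b') \<in> ?r" using b(1) b' q by (auto simp: add_top_iff inj_pos_list)
      moreover have "x b' = s" using x[OF b'(1)] b b' by simp
      ultimately show "\<exists>b. (q, b) \<in> ?r \<and> (b, p) \<in> ?r \<and> b \<noteq> p \<and> x b = s" by blast
    qed
  qed
qed

section \<open>The automaton, its unique run and its language\<close>

text \<open>State 2j or 2j + 1 records that the block of length \<omega>^j just completed is null or
  not; a successor step completes a block of length 1. States 2n and 2n + 1 arise only at the end of
  the word, so limit transitions need only sets of states below 2n, and 2n accepts.\<close>

definition null_automaton :: "nat \<Rightarrow> 'a set \<Rightarrow> 'a set \<Rightarrow> (nat, 'a) ordinal_buchi" where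
  "null_automaton n \<Sigma> Bad =
     \<lparr>states = {..<2 * n + 2}, alphabet = \<Sigma>, initial = 0,
      trans_succ = {(q, a, if a \<in> Bad then 1 else 0) |q a. q < 2 * n + 2 \<and> a \<in> \<Sigma>},
      trans_lim = {(S, Max S + 2) |S. S \<noteq> {} \<and> S \<subseteq> {..<2 * n}},
      accepting = {2 * n}\<rparr>"

lemma wf_null_automaton:
  assumes "finite \<Sigma>"
  shows "wf_ordinal_buchi (null_automaton n \<Sigma> Bad)"
proof -
  have "Max S + 2 < 2 * n + 2" if "S \<noteq> {}" "S \<subseteq> {..<2 * n}" for S
  proof -
    have "Max S \<in> S" using that finite_subset by (intro Max_in) auto
    then show ?thesis using that by auto
  qed
  then have "trans_lim (null_automaton n \<Sigma> Bad) \<subseteq> Pow {..<2 * n + 2} \<times> {..<2 * n + 2}"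
    by (force simp: null_automaton_def)
  then show ?thesis unfolding wf_ordinal_buchi_def
    using assms by (intro conjI) (auto simp: null_automaton_def)
qed

text \<open>The transitions determine each state from the earlier ones, so uniqueness follows by
  induction along the positions. \<open>B\<close> lives on lists of length n + 1: the word occupies
  head 0, and the end of the word is 1 followed by zeros, where the state reports on the whole block
  with head 0.\<close>

lemma null_automaton_run:
  assumes n: "n \<ge> 1" and w: "w \<in> omega_pow n \<rightarrow>\<^sub>E \<Sigma>"
    and B: "\<And>q. q \<in> omega_pow n \<Longrightarrow> B (0 # q) \<longleftrightarrow> w q \<in> Bad"
  shows "is_run (omega_le n) (null_automaton n \<Sigma> Bad) w (\<lambda>p. pos_state B (pos_list n p))"
    and "is_run (omega_le n) (null_automaton n \<Sigma> Bad) w x \<Longrightarrow> p \<in> positions n \<Longrightarrow>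
      x p = pos_state B (pos_list n p)"
proof -
  let ?A = "null_automaton n \<Sigma> Bad" and ?x = "\<lambda>p. pos_state B (pos_list n p)" and ?r = "add_top (omega_le n)"
  have snoc: "\<exists>us a. i = us @ [a] \<and> length us + 1 = n" if "i \<in> omega_pow n" for i
    using that n by (cases i rule: rev_cases) (auto simp: omega_pow_def)
  have bound: "pos_state B (pos_list n p) < 2 * n + 2" if "p \<in> positions n" for p
    using pos_state_less[of "pos_list n p" B] length_pos_list[OF that] by (cases "pos_list n p") (auto simp del: pos_state.simps)
  have succ: "pos_state B (pos_list n (Some (us @ [Suc a]))) = (if w (us @ [a]) \<in> Bad then 1 else 0)"
    if "length us + 1 = n" for us a
    using pos_state_succ[of B "0 # us" a] B[of "us @ [a]"] that by (simp add: pos_list_def omega_pow_def del: pos_state.simps)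
  have lim: "(cofinal (Suc n) B (pos_list n p), s) \<in> trans_lim ?A \<longleftrightarrow> s = pos_state B (pos_list n p)"
    if p: "is_lim_pos ?r p" for p s
  proof -
    note M = Max_cofinal[OF length_pos_list[OF is_lim_posD(1)[OF n p]] is_lim_posD(2,3)[OF n p], of B]
    have "cofinal (Suc n) B (pos_list n p) \<subseteq> {..<2 * n}"
      using M(2) bound[OF is_lim_posD(1)[OF n p]] by auto
    then show ?thesis using M(1,3) by (auto simp: null_automaton_def)
  qed
  show "is_run (omega_le n) ?A w ?x"
    unfolding is_run_def
  proof (intro conjI allI impI ballI)
    fix p assume "is_zero_pos ?r p"
    moreover from this have "p \<in> positions n" by (simp add: is_zero_pos_def Field_add_top)
    ultimately show "?x p = initial ?A" using is_zero_pos_iff pos_state_zeros by (simp add: null_automaton_def)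
  next
    fix i p assume i: "i \<in> Field (omega_le n)" and s: "is_succ_pos ?r (Some i) p"
    obtain us a where us: "i = us @ [a]" "length us + 1 = n" using snoc[of i] i by auto
    then have p: "p = Some (us @ [Suc a])" using s is_succ_pos_iff[OF n] by blast
    have "?x (Some i) < 2 * n + 2" using i by (intro bound) (auto simp: positions_def)
    moreover have "w i \<in> \<Sigma>" using w i by auto
    ultimately show "(?x (Some i), w i, ?x p) \<in> trans_succ ?A"
      using succ[OF us(2), of a] us(1) p by (simp add: null_automaton_def)
  next
    fix p assume p: "is_lim_pos ?r p"
    have "cofinal_states ?r ?x p = cofinal (Suc n) B (pos_list n p)"
      using is_lim_posD(1)[OF n p] by (rule cofinal_states_eq) simp
    then show "(cofinal_states ?r ?x p, ?x p) \<in> trans_lim ?A" using lim[OF p] by simp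
  qed
  assume run: "is_run (omega_le n) ?A w x" and "p \<in> positions n"
  have "x p = ?x p" if "p \<in> positions n" "pos_list n p = y" for y p
    using that
  proof (induction y arbitrary: p rule: wf_induct_rule[OF wf_lexn[OF wf_less_than, of "Suc n"]])
    case (1 y)
    note p = 1(2) and y = 1(3)
    consider "is_zero_pos ?r p" | q where "is_succ_pos ?r q p" | "is_lim_pos ?r p"
      using p by (auto simp: is_lim_pos_def Field_add_top)
    then show ?case
    proof cases
      case 1
      then have "x p = 0" using run by (simp add: is_run_def null_automaton_def)
      moreover have "zeros (pos_list n p)" using 1 is_zero_pos_iff[OF p] by blast
      ultimately show ?thesis using pos_state_zeros by simp
    next
      case 2
      then have q: "q \<in> positions n" "q \<noteq> p" "(pos_list n q, pos_list n p) \<in> lexn less_than (Suc n)"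
        by (auto simp: is_succ_pos_def add_top_iff)
      then obtain i where i: "q = Some i" "i \<in> omega_pow n"
      proof (cases q)
        case None
        obtain i where "p = Some i" "i \<in> omega_pow n" using None q(2) p by (auto simp: positions_def)
        then show ?thesis using q(3) None by (auto simp: pos_list_def Cons_Cons_lexn)
      qed (use that in \<open>auto simp: positions_def\<close>)
      obtain us a where us: "i = us @ [a]" "length us + 1 = n" using snoc i by blast
      then have p': "p = Some (us @ [Suc a])" using 2 i is_succ_pos_iff[OF n] by blast
      have "(x (Some i), w i, x p) \<in> trans_succ ?A" using run 2 i by (auto simp: is_run_def)
      then show ?thesis using succ[OF us(2), of a] us(1) p' by (auto simp: null_automaton_def)
    next
      case 3
      have "cofinal_states ?r x p = cofinal (Suc n) B (pos_list n p)"
        using p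
      proof (rule cofinal_states_eq)
        fix q assume "q \<in> positions n" "(pos_list n q, pos_list n p) \<in> lexn less_than (Suc n)"
        then show "x q = pos_state B (pos_list n q)" using 1(1) y by blast
      qed
      then show ?thesis using lim[OF 3, of "x p"] run 3 by (auto simp: is_run_def)
    qed
  qed
  then show "x p = ?x p" using \<open>p \<in> positions n\<close> by blast
qed

lemma null_automaton_language:
  assumes n: "n \<ge> 1"
  shows "buchi_language (omega_le n) (null_automaton n \<Sigma> Bad) =
    {w \<in> omega_pow n \<rightarrow>\<^sub>E \<Sigma>. null n {p \<in> omega_pow n. w p \<in> Bad}}"
proof -
  have "(\<exists>x. is_run (omega_le n) (null_automaton n \<Sigma> Bad) w x \<and> x None \<in> accepting (null_automaton n \<Sigma> Bad)) \<longleftrightarrow>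
      null n {p \<in> omega_pow n. w p \<in> Bad}" if w: "w \<in> omega_pow n \<rightarrow>\<^sub>E \<Sigma>" for w
  proof -
    define B where "B p \<longleftrightarrow> tl p \<in> omega_pow n \<and> w (tl p) \<in> Bad" for p
    have B: "B (0 # q) \<longleftrightarrow> w q \<in> Bad" if "q \<in> omega_pow n" for q using that by (simp add: B_def)
    note run = null_automaton_run[OF n w B]
    have None: "pos_state B (pos_list n None) = 2 * n + (if null n {p \<in> omega_pow n. w p \<in> Bad} then 0 else 1)"
      by (simp add: pos_list_def set_replicate_conv_if B_def)
    have "(\<exists>x. is_run (omega_le n) (null_automaton n \<Sigma> Bad) w x \<and> x None \<in> accepting (null_automaton n \<Sigma> Bad)) \<longleftrightarrow>
        pos_state B (pos_list n None) \<in> accepting (null_automaton n \<Sigma> Bad)"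
      using run by (metis insertI1 positions_def)
    also have "\<dots> \<longleftrightarrow> null n {p \<in> omega_pow n. w p \<in> Bad}" using None by (simp add: null_automaton_def)
    finally show ?thesis .
  qed
  moreover have "alphabet (null_automaton n \<Sigma> Bad) = \<Sigma>" by (simp add: null_automaton_def)
  ultimately show ?thesis unfolding buchi_language_def Field_omega_le by auto
qed

lemma regular_null_language:
  assumes "n \<ge> 1" "finite \<Sigma>"
  shows "regular_omega_lang n \<Sigma> {w \<in> omega_pow n \<rightarrow>\<^sub>E \<Sigma>. null n {p \<in> omega_pow n. w p \<in> Bad}}"
  unfolding regular_omega_lang_def
  using wf_null_automaton[OF assms(2), of n Bad] null_automaton_language[OF assms(1), of \<Sigma> Bad]
  by (intro exI[of _ "null_automaton n \<Sigma> Bad"]) (simp add: null_automaton_def)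

section \<open>Automatic presentations and the theorem\<close>

lemma null_omega_pow_conj: "null n {p \<in> omega_pow n. P p} \<longleftrightarrow> null n {p. P p}"
  using null_Int_omega_pow[of n "{p. P p}"] by (simp add: Int_def conj_commute)

lemma finite_product_alphabet: "finite \<Sigma> \<Longrightarrow> finite (product_alphabet \<Sigma> m)"
  unfolding product_alphabet_def using finite_lists_length_eq[of \<Sigma> m] by (simp add: conj_commute)

lemma convolution_surj:
  assumes v: "v \<in> omega_pow n \<rightarrow>\<^sub>E product_alphabet \<Sigma> m"
  shows "\<exists>us. length us = m \<and> set us \<subseteq> (omega_pow n \<rightarrow>\<^sub>E \<Sigma>) \<and> convolution n us = v"
proof (intro exI conjI)
  let ?us = "map (\<lambda>i. \<lambda>p\<in>omega_pow n. v p ! i) [0..<m]"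
  have vp: "length (v p) = m" "set (v p) \<subseteq> \<Sigma>" if "p \<in> omega_pow n" for p
    using PiE_mem[OF v that] by (auto simp: product_alphabet_def)
  show "length ?us = m" by simp
  show "set ?us \<subseteq> (omega_pow n \<rightarrow>\<^sub>E \<Sigma>)"
  proof
    fix u assume "u \<in> set ?us"
    then obtain i where i: "i < m" "u = (\<lambda>p\<in>omega_pow n. v p ! i)" by auto
    have "v p ! i \<in> \<Sigma>" if "p \<in> omega_pow n" for p using vp[OF that] i(1) nth_mem by blast
    then show "u \<in> omega_pow n \<rightarrow>\<^sub>E \<Sigma>" using i(2) by auto
  qed
  show "convolution n ?us = v"
  proof (rule extensionalityI[of _ "omega_pow n"])
    show "convolution n ?us \<in> extensional (omega_pow n)" by (simp add: convolution_def)
    show "v \<in> extensional (omega_pow n)" using v by (simp add: PiE_def)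
    fix p assume p: "p \<in> omega_pow n"
    then have "convolution n ?us p = map ((!) (v p)) [0..<m]" by (simp add: convolution_def o_def)
    also have "\<dots> = v p" using vp(1)[OF p] map_nth[of "v p"] by simp
    finally show "convolution n ?us p = v p" .
  qed
qed

text \<open>Each relation of the presentation holds iff the positions with a bad tuple of letters
  form a null set. As every word of tuples is a convolution, the one automaton with a suitable
  \<open>Bad\<close> recognises them all.\<close>

lemma regular_convolution_language:
  assumes n: "n \<ge> 1" and \<Sigma>: "finite \<Sigma>"
    and Q: "\<And>us. length us = m \<Longrightarrow> set us \<subseteq> (omega_pow n \<rightarrow>\<^sub>E \<Sigma>) \<Longrightarrow>
      Q us \<longleftrightarrow> null n {p. map (\<lambda>w. w p) us \<in> Bad}"
  shows "regular_omega_lang n (product_alphabet \<Sigma> m)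
    {convolution n us |us. length us = m \<and> set us \<subseteq> (omega_pow n \<rightarrow>\<^sub>E \<Sigma>) \<and> Q us}"
proof -
  have conv: "convolution n us \<in> omega_pow n \<rightarrow>\<^sub>E product_alphabet \<Sigma> m"
    "null n {p \<in> omega_pow n. convolution n us p \<in> Bad} \<longleftrightarrow> Q us"
    if us: "length us = m" "set us \<subseteq> (omega_pow n \<rightarrow>\<^sub>E \<Sigma>)" for us
  proof -
    have "w p \<in> \<Sigma>" if "w \<in> set us" "p \<in> omega_pow n" for w p using us(2) that by auto
    then show "convolution n us \<in> omega_pow n \<rightarrow>\<^sub>E product_alphabet \<Sigma> m"
      using us(1) by (auto simp: convolution_def product_alphabet_def)
    have "{p \<in> omega_pow n. convolution n us p \<in> Bad} = {p \<in> omega_pow n. map (\<lambda>w. w p) us \<in> Bad}"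
      by (auto simp: convolution_def)
    then show "null n {p \<in> omega_pow n. convolution n us p \<in> Bad} \<longleftrightarrow> Q us"
      using Q[OF us] by (simp add: null_omega_pow_conj)
  qed
  have "{convolution n us |us. length us = m \<and> set us \<subseteq> (omega_pow n \<rightarrow>\<^sub>E \<Sigma>) \<and> Q us} =
      {v \<in> omega_pow n \<rightarrow>\<^sub>E product_alphabet \<Sigma> m. null n {p \<in> omega_pow n. v p \<in> Bad}}" (is "?L = ?R")
  proof (intro equalityI subsetI)
    fix v assume "v \<in> ?L"
    then show "v \<in> ?R" using conv by blast
  next
    fix v assume v: "v \<in> ?R"
    then obtain us where us: "length us = m" "set us \<subseteq> (omega_pow n \<rightarrow>\<^sub>E \<Sigma>)" "v = convolution n us"
      using convolution_surj by blast
    then show "v \<in> ?L" using v conv(2)[OF us(1,2)] by blast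
  qed
  then show ?thesis using regular_null_language[OF n finite_product_alphabet[OF \<Sigma>]] by simp
qed

theorem U_group_automatic:
  assumes n: "n \<ge> 1"
  shows "omega_automatic_group n (U_group n k)"
proof -
  let ?G = "U_group n k"
  obtain enc :: "bit smat \<Rightarrow> nat" where enc: "inj_on enc (unitri k)"
    using finite_imp_inj_to_nat_seg[OF finite_unitri] by blast
  define \<Sigma> where "\<Sigma> = enc ` unitri k"
  \<comment> \<open>Words in \<open>L\<close> are \<open>undefined\<close> off
    \<open>omega_pow n\<close>; the default \<open>uone\<close> keeps the decoded letter
    unitriangular at every list.\<close>
  define dec :: "nat \<Rightarrow> bit smat" where "dec a = (if a \<in> \<Sigma> then inv_into (unitri k) enc a else uone)" for a
  have \<Sigma>: "finite \<Sigma>" by (simp add: \<Sigma>_def finite_unitri)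
  have dec_unitri: "dec a \<in> unitri k" for a
    by (auto simp: dec_def \<Sigma>_def uone_unitri inv_into_into)
  have dec_enc: "dec (enc A) = A" if "A \<in> unitri k" for A
    using that enc by (simp add: dec_def \<Sigma>_def)
  define L where "L = omega_pow n \<rightarrow>\<^sub>E \<Sigma>"
  define h where "h w = wclass n k (\<lambda>p. dec (w p))" for w :: "nat list \<Rightarrow> nat"
  have dw: "(\<lambda>p. dec (w p)) \<in> words k" for w by (simp add: words_def dec_unitri)
  have hG: "h w \<in> carrier ?G" for w unfolding h_def by (rule wclass_carrier[OF dw])
  have one: "(\<lambda>_. uone) \<in> words k" by (simp add: words_def uone_unitri)
  have "carrier ?G \<subseteq> h ` L"
  proof
    fix M assume "M \<in> carrier ?G"
    then obtain u where u: "u \<in> words k" "M = wclass n k u" by (rule U_group_carrierE)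
    define w where "w = (\<lambda>p\<in>omega_pow n. enc (u p))"
    have "w \<in> L" using u(1) by (auto simp: L_def w_def \<Sigma>_def words_def)
    \<comment> \<open>Off \<open>omega_pow n\<close> the decoded word may differ from
      \<open>u\<close>, but lists of other lengths do not affect nullity.\<close>
    moreover have "{p \<in> omega_pow n. dec (w p) \<noteq> u p} = {}"
      using u(1) by (auto simp: w_def dec_enc words_def)
    then have "null n {p. dec (w p) \<noteq> u p}" using null_omega_pow_conj null_empty by metis
    then have "h w = M" unfolding h_def u(2) using wclass_eq_iff[OF dw u(1)] by blast
    ultimately show "M \<in> h ` L" by blast
  qed
  then have surj: "h ` L = carrier ?G" using hG by blast
  have regL: "regular_omega_lang n \<Sigma> L"
    using regular_null_language[OF n \<Sigma>, of "{}"] by (simp add: L_def)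
  have "regular_omega_lang n (product_alphabet \<Sigma> 2)
      {convolution n us |us. length us = 2 \<and> set us \<subseteq> L \<and> h (us ! 0) = h (us ! 1)}"
    unfolding L_def h_def
    by (rule regular_convolution_language[OF n \<Sigma>, where Bad = "{as. dec (as ! 0) \<noteq> dec (as ! 1)}"])
      (simp add: wclass_eq_iff[OF dw dw])
  moreover have "{convolution n us |us. length us = 2 \<and> set us \<subseteq> L \<and> h (us ! 0) = h (us ! 1)} =
      {convolution n [u, v] |u v. u \<in> L \<and> v \<in> L \<and> h u = h v}"
    by (rule Collect_cong, rule iffI)
      (auto simp: length_Suc_conv numeral_2_eq_2, auto intro!: exI[of _ "[_, _]"])
  ultimately have regE: "regular_omega_lang n (product_alphabet \<Sigma> 2)
      {convolution n [u, v] |u v. u \<in> L \<and> v \<in> L \<and> h u = h v}" by simp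
  have reg3: "regular_omega_lang n (product_alphabet \<Sigma> 3) {convolution n us |us. length us = 3 \<and> set us \<subseteq> L \<and>
      map h us \<in> {[x, y, x \<otimes>\<^bsub>?G\<^esub> y] |x y. x \<in> carrier ?G \<and> y \<in> carrier ?G}}"
    unfolding L_def
  proof (rule regular_convolution_language[OF n \<Sigma>, where Bad = "{as. umul (dec (as ! 0)) (dec (as ! 1)) \<noteq> dec (as ! 2)}"])
    fix us :: "(nat list \<Rightarrow> nat) list" assume "length us = 3"
    then obtain u v w where us: "us = [u, v, w]" by (auto simp: length_Suc_conv numeral_3_eq_3)
    have "map h us \<in> {[x, y, x \<otimes>\<^bsub>?G\<^esub> y] |x y. x \<in> carrier ?G \<and> y \<in> carrier ?G} \<longleftrightarrow> h u \<otimes>\<^bsub>?G\<^esub> h v = h w"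
      using hG by (auto simp: us)
    also have "\<dots> \<longleftrightarrow> null n {p. umul (dec (u p)) (dec (v p)) \<noteq> dec (w p)}"
      unfolding h_def by (simp add: wclass_mult[OF dw dw] wclass_eq_iff[OF words_umul[OF dw dw] dw])
    finally show "map h us \<in> {[x, y, x \<otimes>\<^bsub>?G\<^esub> y] |x y. x \<in> carrier ?G \<and> y \<in> carrier ?G} \<longleftrightarrow>
        null n {p. map (\<lambda>w. w p) us \<in> {as. umul (dec (as ! 0)) (dec (as ! 1)) \<noteq> dec (as ! 2)}}"
      by (simp add: us)
  qed
  have reg2: "regular_omega_lang n (product_alphabet \<Sigma> 2) {convolution n us |us. length us = 2 \<and> set us \<subseteq> L \<and>
      map h us \<in> {[x, inv\<^bsub>?G\<^esub> x] |x. x \<in> carrier ?G}}"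
    unfolding L_def
  proof (rule regular_convolution_language[OF n \<Sigma>, where Bad = "{as. uinv (dec (as ! 0)) \<noteq> dec (as ! 1)}"])
    fix us :: "(nat list \<Rightarrow> nat) list" assume "length us = 2"
    then obtain u v where us: "us = [u, v]" by (auto simp: length_Suc_conv numeral_2_eq_2)
    have bw: "(\<lambda>p. uinv (dec (u p))) \<in> words k" by (simp add: words_def uinv_unitri dec_unitri)
    have "map h us \<in> {[x, inv\<^bsub>?G\<^esub> x] |x. x \<in> carrier ?G} \<longleftrightarrow> inv\<^bsub>?G\<^esub> (h u) = h v"
      using hG by (auto simp: us)
    also have "\<dots> \<longleftrightarrow> null n {p. uinv (dec (u p)) \<noteq> dec (v p)}"
      unfolding h_def by (simp add: inv_wclass[OF dw] wclass_eq_iff[OF bw dw])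
    finally show "map h us \<in> {[x, inv\<^bsub>?G\<^esub> x] |x. x \<in> carrier ?G} \<longleftrightarrow>
        null n {p. map (\<lambda>w. w p) us \<in> {as. uinv (dec (as ! 0)) \<noteq> dec (as ! 1)}}"
      by (simp add: us)
  qed
  have reg1: "regular_omega_lang n (product_alphabet \<Sigma> 1) {convolution n us |us. length us = 1 \<and> set us \<subseteq> L \<and>
      map h us \<in> {[\<one>\<^bsub>?G\<^esub>]}}"
    unfolding L_def
  proof (rule regular_convolution_language[OF n \<Sigma>, where Bad = "{as. dec (as ! 0) \<noteq> uone}"])
    fix us :: "(nat list \<Rightarrow> nat) list" assume "length us = 1"
    then obtain u where us: "us = [u]" by (auto simp: length_Suc_conv)
    show "map h us \<in> {[\<one>\<^bsub>?G\<^esub>]} \<longleftrightarrow> null n {p. map (\<lambda>w. w p) us \<in> {as. dec (as ! 0) \<noteq> uone}}"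
      unfolding h_def us wclass_one by (simp add: wclass_eq_iff[OF dw one])
  qed
  have "omega_automatic n (carrier ?G)
       [(3, {[x, y, x \<otimes>\<^bsub>?G\<^esub> y] |x y. x \<in> carrier ?G \<and> y \<in> carrier ?G}),
        (2, {[x, inv\<^bsub>?G\<^esub> x] |x. x \<in> carrier ?G}), (1, {[\<one>\<^bsub>?G\<^esub>]})]"
    unfolding omega_automatic_def
    by (rule exI[of _ \<Sigma>], rule exI[of _ L], rule exI[of _ h]) (use \<Sigma> regL surj regE reg1 reg2 reg3 in auto)
  then show ?thesis unfolding omega_automatic_group_def using group_U_group by blast
qed

theorem theorem6p8:
  fixes k :: nat
  assumes "k \<ge> 3"
  shows "(\<forall>n\<ge>1. omega_automatic_group n (U_group n k)) \<and>
         (CH \<longrightarrow> (\<forall>m\<ge>1. \<forall>n\<ge>1. U_group m k \<cong> U_group n k)) \<and>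
         (AT \<longrightarrow> (\<forall>m\<ge>1. \<forall>n\<ge>1. m \<noteq> n \<longrightarrow> \<not> U_group m k \<cong> U_group n k))"
proof (intro conjI allI impI)
  show "omega_automatic_group n (U_group n k)" if "n \<ge> 1" for n
    using that by (rule U_group_automatic)
  show "U_group m k \<cong> U_group n k" if CH "m \<ge> 1" "n \<ge> 1" for m n
    using that by (rule CH_U_group_iso)
  \<comment> \<open>Only isomorphisms from the larger to the smaller exponent are refuted directly;
    symmetry of isomorphism covers the other order.\<close>
  have no_iso: "\<not> U_group n k \<cong> U_group m k" if AT "m < n" for m n
    using U_group_iso_order_iso[OF assms, of n m] AT_no_isomorphism[OF that] by blast
  show "\<not> U_group m k \<cong> U_group n k" if AT "m \<noteq> n" for m n
    using no_iso[OF that(1), of m n] no_iso[OF that(1), of n m] that(2) group.iso_sym[OF group_U_group]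
    by (metis linorder_neqE_nat)
qed

end
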